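(* Consider the (ON/OFF-BMAP)/D/1/$K$ queue described in the context, and suppose: $\lambda>1$; there is a nonnegative random variable $Y\in\mathcal{S}$ with $\sum_{l=k+1}^\infty\boldsymbol{\alpha}(l)=O(\mathbb{P}(Y>k))$ and $\sum_{l=k+1}^\infty\boldsymbol{\Lambda}(l)=O(\mathbb{P}(Y>k))$ (entrywise, $k\to\infty$); and $\mathbb{E}[A]<\mathbb{E}[I^{\rm off}]$. Further suppose (i) $I^{\rm on}\in\mathcal{L}^{1/\theta}$ for some $0<\theta\le1/3$; (ii) $\mathbb{E}[I^{\rm on}]<\infty$ and the equilibrium random variable $I^{\rm on}_{\rm e}$ of $I^{\rm on}$ belongs to $\mathcal{S}$; and (iii) $\mathbb{E}[\exp\{Q(Y)\}]<\infty$ for some $Q\in\mathcal{SC}$ with $x^{3\theta/2}=O(Q(x))$. Then $$P_{\rm loss}^{(K)}\sim\frac{(\lambda-1)\mathbb{E}[I^{\rm on}]}{\mathbb{E}[A]+\mathbb{E}[I^{\rm on}]}\,\mathbb{P}\big(I^{\rm on}_{\rm e}>K/(\lambda-1)\big)\quad(K\to\infty).$$ If in addition (iv) for each $m\in\mathbb{Z}$ and all $n\ge0$, the event $\{I_m^{\rm on}\ge n+1\}$ is independent of $N_{m,n}$; and (v) $\boldsymbol{\alpha}(k)=\boldsymbol{\phi}\boldsymbol{\Lambda}(k)$ for $k\ge1$, then $P_{\rm loss}^{(K)}\sim\frac{\lambda-1}{\lambda}\mathbb{P}(I^{\rm on}_{\rm e}>K/(\lambda-1))$.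
   Context: Discrete time, slots $[n,n+1]$. ON/OFF-BMAP: on-periods and off-periods alternate, indexed by $m\in\mathbb{Z}$. No arrivals in off-slots. In the $m$th on-period, $N_{m,n}$ ($n=0,1,\dots$) is the number of arrivals in its $n$th slot and $J_{m,n}\in\mathbb{D}=\{0,\dots,d-1\}$ is a background state, with $\mathbb{P}(N_{m,0}=k,J_{m,0}=i)=\alpha_i(k)$ and $\mathbb{P}(N_{m,n}=k,J_{m,n}=j\mid J_{m,n-1}=i,\text{past})=\Lambda_{i,j}(k)$ for $k\ge1$, $n\ge1$; here $\boldsymbol{\alpha}(k)=(\alpha_i(k))$ is a nonnegative row vector with $\sum_{k\ge1}\boldsymbol{\alpha}(k)$ a probability vector and $\boldsymbol{\Lambda}(k)=(\Lambda_{i,j}(k))$ with $\sum_{k\ge1}\boldsymbol{\Lambda}(k)$ irreducible stochastic, with stationary vector $\boldsymbol{\phi}$; $\lambda=\boldsymbol{\phi}\sum_kk\boldsymbol{\Lambda}(k)\mathbf{e}$. $I_m^{\rm on}\ge1$ is the length (in slots) of the $m$th on-period, possibly dependent on the $m$th BMAP; the tuples $\Phi_m=\{I_m^{\rm on},(N_{m,0},J_{m,0}),\dots,(N_{m,I_m^{\rm on}-1},J_{m,I_m^{\rm on}-1})\}$ are i.i.d. over $m$; off-period lengths $I_m^{\rm off}$ are i.i.d. (and independent of the on-period data). $A_m=\sum_{n=0}^{I_m^{\rm on}-1}(N_{m,n}-1)$. Queue: single server, capacity $K$, unit service times; $L_m^{(K)}$, the queue length just after the $m$th off-period, satisfies $L_{m+1}^{(K)}=(\min(L_m^{(K)}+A_{m+1},K)-I_{m+1}^{\rm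 off})^+$. Loss probability $P_{\rm loss}^{(K)}=\mathbb{E}[(L_{m-1}^{(K)}+A_m-K)^+]/\mathbb{E}[A_m+I_m^{\rm on}]$ with $L^{(K)}$ in stationarity (long-run fraction of lost arrivals). $A,I^{\rm on},I^{\rm off}$ denote generic copies. The equilibrium r.v. $X_{\rm e}$ of $X\ge0$ with $\mathbb{E}X<\infty$ has $\mathbb{P}(X_{\rm e}\le x)=\frac{1}{\mathbb{E}X}\int_0^x\mathbb{P}(X>y)dy$. Classes: $\mathcal{S}$: $\mathbb{P}(X>x)>0$ and $\mathbb{P}(X_1+X_2>x)\sim2\mathbb{P}(X>x)$ for independent copies. $\mathcal{L}$: $\mathbb{P}(Z>x+y)\sim\mathbb{P}(Z>x)$ for some (all) $y>0$, tail positive; $X\in\mathcal{L}^p$ iff $X^{1/p}\in\mathcal{L}$. $\mathcal{SC}$: $Q_X=-\log\mathbb{P}(X>\cdot)$ eventually concave, $Q_X(x)/\log x\to\infty$, and $Q_X(x)/x^\alpha$ nonincreasing for $x\ge x_0$ for some $\alpha\in(0,1)$; "$Q\in\mathcal{SC}$" means $Q$ is such a cumulative hazard function. *)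

theory Defs
  imports "HOL-Probability.Probability" "HOL-Library.Landau_Symbols"
begin

definition real_distr :: "real measure \<Rightarrow> bool" where
  "real_distr D \<longleftrightarrow> prob_space D \<and> sets D = sets borel"

definition subexponential :: "real measure \<Rightarrow> bool" where
  "subexponential D \<longleftrightarrow> real_distr D \<and> (\<forall>x. measure D {x<..} > 0) \<and>
     ((\<lambda>x. measure (D \<Otimes>\<^sub>M D) {p. fst p + snd p > x}) \<sim>[at_top] (\<lambda>x. 2 * measure D {x<..}))"

(* class L, stated on a tail function G(x) = P(Z > x) *)
definition long_tailed :: "(real \<Rightarrow> real) \<Rightarrow> bool" where
  "long_tailed G \<longleftrightarrow> (\<forall>x. G x > 0) \<and> (\<forall>y>0. (\<lambda>x. G (x + y)) \<sim>[at_top] G)"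

definition in_L_pow :: "'a measure \<Rightarrow> real \<Rightarrow> ('a \<Rightarrow> real) \<Rightarrow> bool" where
  "in_L_pow M p X \<longleftrightarrow> long_tailed (\<lambda>x. measure M {\<omega>\<in>space M. X \<omega> powr (1 / p) > x})"

definition equilibrium :: "real measure \<Rightarrow> real measure" where
  "equilibrium D = density lborel
     (\<lambda>y. ennreal (indicator {0..} y * measure D {y<..} / (\<integral>x. x \<partial>D)))"

definition SC_hazard :: "(real \<Rightarrow> real) \<Rightarrow> bool" where
  "SC_hazard Q \<longleftrightarrow>
     (\<exists>D. real_distr D \<and> (\<forall>x. measure D {x<..} > 0) \<and> (\<forall>x. Q x = - ln (measure D {x<..}))) \<and>
     (\<exists>x0. concave_on {x0..} Q) \<and>
     filterlim (\<lambda>x. Q x / ln x) at_top at_top \<and>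
     (\<exists>\<alpha>. 0 < \<alpha> \<and> \<alpha> < 1 \<and> (\<exists>x0>0. \<forall>x y. x0 \<le> x \<longrightarrow> x \<le> y \<longrightarrow> Q y / y powr \<alpha> \<le> Q x / x powr \<alpha>))"

definition irreducible_mat :: "nat \<Rightarrow> (nat \<Rightarrow> nat \<Rightarrow> real) \<Rightarrow> bool" where
  "irreducible_mat d P \<longleftrightarrow>
     (\<forall>i<d. \<forall>j<d. (i, j) \<in> {(a, b). a < d \<and> b < d \<and> P a b > 0}\<^sup>+)"

definition indep_rv :: "'a measure \<Rightarrow> 'b measure \<Rightarrow> ('a \<Rightarrow> 'b) \<Rightarrow> 'c measure \<Rightarrow> ('a \<Rightarrow> 'c) \<Rightarrow> bool" where
  "indep_rv M Ma X Mb Y \<longleftrightarrow> (\<forall>S\<in>sets Ma. \<forall>T\<in>sets Mb.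
     measure M {\<omega>\<in>space M. X \<omega> \<in> S \<and> Y \<omega> \<in> T}
     = measure M {\<omega>\<in>space M. X \<omega> \<in> S} * measure M {\<omega>\<in>space M. Y \<omega> \<in> T})"

(* A = sum_{n < I^on} (N_n - 1) ; N_n \<ge> 1 almost surely *)
definition onA :: "(nat \<Rightarrow> 'a \<Rightarrow> nat) \<Rightarrow> ('a \<Rightarrow> nat) \<Rightarrow> 'a \<Rightarrow> nat" where
  "onA N Ion \<omega> = (\<Sum>n<Ion \<omega>. N n \<omega> - 1)"

definition trans_prob ::
  "'a measure \<Rightarrow> ('a \<Rightarrow> nat) \<Rightarrow> ('a \<Rightarrow> nat) \<Rightarrow> nat \<Rightarrow> nat \<Rightarrow> nat \<Rightarrow> real" where
  "trans_prob M A Ioff K l l' = measure M {\<omega>\<in>space M. min (l + A \<omega>) K - Ioff \<omega> = l'}"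

definition stationary_dist ::
  "'a measure \<Rightarrow> ('a \<Rightarrow> nat) \<Rightarrow> ('a \<Rightarrow> nat) \<Rightarrow> nat \<Rightarrow> (nat \<Rightarrow> real) \<Rightarrow> bool" where
  "stationary_dist M A Ioff K p \<longleftrightarrow>
     (\<forall>l. 0 \<le> p l) \<and> (\<forall>l>K. p l = 0) \<and> (\<Sum>l\<le>K. p l) = 1 \<and>
     (\<forall>l'\<le>K. p l' = (\<Sum>l\<le>K. p l * trans_prob M A Ioff K l l'))"

(* P_loss^(K) = E[(L + A - K)^+] / E[A + I^on], L stationary (distribution p) independent of A *)
definition loss_prob ::
  "'a measure \<Rightarrow> ('a \<Rightarrow> nat) \<Rightarrow> ('a \<Rightarrow> nat) \<Rightarrow> nat \<Rightarrow> (nat \<Rightarrow> real) \<Rightarrow> real" where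
  "loss_prob M A Ion K p =
     (\<Sum>l\<le>K. p l * (\<integral>\<omega>. real ((l + A \<omega>) - K) \<partial>M)) / (\<integral>\<omega>. real (A \<omega> + Ion \<omega>) \<partial>M)"

end

theory Submission
  imports Defs "HOL-Real_Asymp.Real_Asymp" "Jordan_Normal_Form.Determinant"
begin

text \<open>
  Write \<open>\<mu> = lam - 1\<close>. During the first \<open>m\<close> slots of an on-period the excess arrivals are
  \<open>\<mu> m\<close> up to a deviation of order \<open>m powr (1 - \<theta>)\<close>, except with probability
  \<open>O(m exp (- \<eta> m powr \<theta>))\<close>: the Poisson equation turns the Markov-modulated sum into a
  martingale, and truncating the batches at \<open>m powr (1 - \<theta>)\<close> (condition (iii) bounds the price)
  makes Chernoff's bound available. By (i), the tail of \<open>Ion\<close> decays slower than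
  \<open>exp (- \<epsilon> m powr \<theta>)\<close> for every \<open>\<epsilon>\<close> and does not feel shifts of order \<open>m powr (1 - \<theta>)\<close>,
  so \<open>P(A > n)\<close> is asymptotic to \<open>P(Ion > n / \<mu>)\<close>, and \<open>E (A - n)\<^sup>+\<close> to the subexponential
  equilibrium tail.

  For the queue, testing stationarity against \<open>l \<mapsto> (l - x)\<^sup>+\<close> gives a drift inequality for the
  stationary tail. It is a contraction up to subexponential convolution terms, hence the tail is
  bounded by the equilibrium tail uniformly in \<open>K\<close>; averaged over a long window below \<open>K\<close> it shows
  that \<open>P(L > K - y)\<close> is of smaller order. So only small \<open>L\<close> contribute to \<open>E (L + A - K)\<^sup>+\<close>,
  which is therefore asymptotic to \<open>E (A - K)\<^sup>+\<close>.
\<close>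

section \<open>Subexponential tails\<close>

text \<open>The exponents meet at \<theta> = 1/3. A deviation of order
  \<open>m powr (1 - \<theta>)\<close> at cost \<open>m powr \<theta>\<close> forces a tilt of order
  \<open>m powr (2 * \<theta> - 1)\<close>. The accumulated quadratic term
  \<open>m powr (4 * \<theta> - 1)\<close> must not exceed \<open>m powr \<theta>\<close>; the tilt
  must not outweigh a tail \<open>exp (- c * k powr (3 * \<theta> / 2))\<close> for k up to
  \<open>m powr (1 - \<theta>)\<close>; and a single larger batch must be as rare as the deviation,
  that is, \<open>(1 - \<theta>) * (3 * \<theta> / 2) \<ge> \<theta>\<close>. Each of the three
  amounts to \<open>\<theta> \<le> 1 / 3\<close>. The law known to be subexponential is the
  equilibrium law of \<open>Ion\<close>, so it is the integrated tail of \<open>A\<close> that is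
  compared with it; the plain tail enters the queue only as a quantity of smaller order. The uniform
  bound alone gives P(L > K - y) the same order as the claimed loss. The finite buffer supplies the
  missing gain: seen from a level x near \<open>K\<close>, a jump counts for at most K - x, and E
  min(A - n, K - x) is at most (K - x) P(A > n), which is of smaller order.\<close>

lemma asymp_equiv_upper_bound:
  fixes f g :: "'a \<Rightarrow> real"
  assumes "f \<sim>[F] g" "e > 0" "eventually (\<lambda>x. g x > 0) F"
  shows "eventually (\<lambda>x. f x \<le> (1 + e) * g x) F"
proof -
  have "((\<lambda>x. f x / g x) \<longlongrightarrow> 1) F"
    using assms(1) by (rule asymp_equivD_strong) (use assms(3) in eventually_elim, auto)
  then have "eventually (\<lambda>x. f x / g x < 1 + e) F"
    by (rule order_tendstoD) (use assms in auto)
  then show ?thesis using assms(3)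
    by eventually_elim (simp add: divide_simps less_imp_le)
qed

lemma asymp_equiv_sandwich:
  fixes f g :: "'a \<Rightarrow> real"
  assumes upper: "\<And>e. e > 0 \<Longrightarrow> eventually (\<lambda>x. f x \<le> (1 + e) * g x) F"
    and lower: "\<And>e. e > 0 \<Longrightarrow> eventually (\<lambda>x. (1 - e) * g x \<le> f x) F"
    and pos: "eventually (\<lambda>x. g x > 0) F"
  shows "f \<sim>[F] g"
proof (rule asymp_equivI', rule order_tendstoI)
  fix b :: real assume b: "b < 1"
  have "(1 - b) / 2 > 0" using b by simp
  from lower[OF this] pos show "eventually (\<lambda>x. b < f x / g x) F"
  proof eventually_elim
    case (elim x)
    have "b < 1 - (1 - b) / 2" using b by (simp add: field_simps)
    also have "\<dots> \<le> f x / g x" using elim by (simp add: pos_le_divide_eq)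
    finally show ?case .
  qed
next
  fix b :: real assume b: "1 < b"
  have "(b - 1) / 2 > 0" using b by simp
  from upper[OF this] pos show "eventually (\<lambda>x. f x / g x < b) F"
  proof eventually_elim
    case (elim x)
    have "f x / g x \<le> 1 + (b - 1) / 2" using elim by (simp add: pos_divide_le_eq)
    also have "\<dots> < b" using b by (simp add: field_simps)
    finally show ?case .
  qed
qed

lemma asymp_equiv_from_above:
  fixes f g :: "'a \<Rightarrow> real"
  assumes upper: "\<And>e. e > 0 \<Longrightarrow> eventually (\<lambda>x. f x \<le> (1 + e) * g x) F"
    and pos: "eventually (\<lambda>x. g x > 0) F" and le: "\<And>x. g x \<le> f x"
  shows "f \<sim>[F] g"
proof (rule asymp_equiv_sandwich[OF upper _ pos])
  fix e :: real assume "e > 0"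
  show "eventually (\<lambda>x. (1 - e) * g x \<le> f x) F" using pos
  proof eventually_elim
    case (elim x)
    then have "e * g x \<ge> 0" using \<open>e > 0\<close> by simp
    with le[of x] show ?case by (simp add: algebra_simps)
  qed
qed

text \<open>Lets two successive relative errors share one budget: for \<open>e' \<le> 1\<close> the
  product exceeds 1 by at most \<open>3 * e'\<close>.\<close>

lemma square_one_plus_le:
  fixes e :: real
  assumes "e > 0"
  obtains e' where "e' > 0" "(1 + e') * (1 + e') \<le> 1 + e"
proof (rule that[of "min 1 e / 3"])
  define e' where "e' = min 1 e / 3"
  have e': "e' > 0" "e' \<le> 1" "3 * e' \<le> e" using assms by (auto simp: e'_def)
  have "e' * e' \<le> e'" using e' by (simp add: mult_left_le)
  moreover have "(1 + e') * (1 + e') = 1 + 2 * e' + e' * e'" by (simp add: algebra_simps)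
  ultimately show "(1 + min 1 e / 3) * (1 + min 1 e / 3) \<le> 1 + e"
    using e' unfolding e'_def[symmetric] by linarith
qed (use assms in simp)

section \<open>Subexponential laws on the half-line\<close>

locale subexp_nonneg =
  fixes D :: "real measure" and V :: "real \<Rightarrow> real"
  assumes D: "subexponential D" and nonneg: "measure D {..<0} = 0"
  defines "V \<equiv> \<lambda>y. measure D {y<..}"
begin

lemma prob_D: "prob_space D" and sets_D [measurable_cong]: "sets D = sets borel"
  and V_pos: "V y > 0"
  using D by (auto simp: subexponential_def real_distr_def V_def)

sublocale D: prob_space D by (rule prob_D)
sublocale DD: pair_prob_space D D ..

lemma space_D: "space D = UNIV"
  using sets_eq_imp_space_eq[OF sets_D] by simp

lemma sets_DD [measurable_cong]: "sets (D \<Otimes>\<^sub>M D) = sets (borel \<Otimes>\<^sub>M borel)"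
  by (intro sets_pair_measure_cong sets_D)

abbreviation "joint \<equiv> measure (D \<Otimes>\<^sub>M D)"

lemma measure_rect:
  assumes "A \<in> sets borel" "B \<in> sets borel"
  shows "joint (A \<times> B) = measure D A * measure D B"
  using assms by (simp add: measure_def D.emeasure_pair_measure_Times sets_D enn2real_mult)

lemma V_antimono: "x \<le> y \<Longrightarrow> V y \<le> V x"
  unfolding V_def by (intro D.finite_measure_mono) (auto simp: sets_D)

lemma V_le_1: "V y \<le> 1"
  unfolding V_def by (rule D.prob_le_1)

lemma V_tendsto_0: "(V \<longlongrightarrow> 0) at_top"
proof -
  interpret R: real_distribution D
    by (simp add: real_distribution_def real_distribution_axioms_def prob_D sets_D space_D)
  have "V = (\<lambda>x. 1 - cdf D x)"
  proof
    fix x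
    have "{x<..} = space D - {..x}" by (auto simp: space_D)
    then show "V x = 1 - cdf D x"
      unfolding V_def cdf_def by (simp only:) (rule D.prob_compl, simp add: sets_D)
  qed
  moreover have "((\<lambda>x. 1 - cdf D x) \<longlongrightarrow> 1 - 1) at_top"
    by (intro tendsto_intros R.cdf_lim_at_top_prob)
  ultimately show ?thesis by simp
qed

lemma measure_atMost: "measure D {..y} = 1 - V y"
proof -
  have "{..y} = space D - {y<..}" by (auto simp: space_D)
  then show ?thesis unfolding V_def by (simp only:) (rule D.prob_compl, simp add: sets_D)
qed

lemma measure_Ioc: "x \<le> y \<Longrightarrow> measure D {x<..y} = V x - V y"
proof -
  assume "x \<le> y"
  then have "{x<..y} = {x<..} - {y<..}" by auto
  then show ?thesis unfolding V_def using \<open>x \<le> y\<close>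
    by (simp only:) (subst D.finite_measure_Diff, auto simp: sets_D)
qed

lemma measure_Icc: "0 \<le> y \<Longrightarrow> measure D {0..y} = 1 - V y"
proof -
  assume "0 \<le> y"
  have "{..y} = {..<0} \<union> {0..y}" using \<open>0 \<le> y\<close> by auto
  then have "measure D {..y} = measure D {..<0} + measure D {0..y}"
    by (simp only:) (subst D.finite_measure_Union, auto simp: sets_D)
  then show ?thesis by (simp add: nonneg measure_atMost)
qed

lemma sets_Collect_DD: "Measurable.pred (borel \<Otimes>\<^sub>M borel) P \<Longrightarrow> {p. P p} \<in> sets (D \<Otimes>\<^sub>M D)"
  unfolding sets_DD by (simp add: pred_def space_pair_measure)

abbreviation "conv_tail y \<equiv> joint {p. fst p + snd p > y}"

lemma sets_conv [measurable]: "{p::real\<times>real. fst p + snd p > y} \<in> sets (D \<Otimes>\<^sub>M D)"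
  by (rule sets_Collect_DD) measurable

lemma conv_tail_upper:
  assumes "e > 0"
  shows "\<forall>\<^sub>F y in at_top. conv_tail y \<le> (2 + e) * V y"
proof -
  have "conv_tail \<sim>[at_top] (\<lambda>y. 2 * V y)"
    using D by (simp add: subexponential_def V_def)
  from asymp_equiv_upper_bound[OF this, of "e/2"] assms V_pos
  show ?thesis by (simp add: algebra_simps)
qed

text \<open>The subexponential asymptotics is already exhausted by one large and one moderate summand.\<close>

lemma both_large:
  assumes "e > 0"
  shows "\<forall>\<^sub>F y in at_top. joint {p. fst p > R \<and> snd p > R \<and> fst p + snd p > y}
           \<le> (e + 2 * V R) * V y"
  using conv_tail_upper[OF assms] eventually_ge_at_top[of "max 0 R"]
proof eventually_elim
  case (elim y)
  let ?B = "{p. fst p > R \<and> snd p > R \<and> fst p + snd p > y}"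
  have B [measurable]: "?B \<in> sets (D \<Otimes>\<^sub>M D)" by (rule sets_Collect_DD) measurable
  show ?case
  proof (cases "R \<ge> 0")
    case True
    \<comment> \<open>These two rectangles and \<open>?B\<close> are disjoint parts of the event
      that the sum exceeds \<open>y\<close>. The rectangles already carry
      \<open>2 * V y * (1 - V R)\<close>, so \<open>?B\<close> gets only what the convolution tail
      has beyond that.\<close>
    let ?A1 = "{y<..} \<times> {0..R}" and ?A2 = "{0..R} \<times> {y<..}"
    have "joint (?A1 \<union> ?A2 \<union> ?B)
        = joint ?A1 + joint ?A2 + joint ?B"
      using elim True by (subst DD.P.finite_measure_Union; (subst DD.P.finite_measure_Union)?)
        (auto simp: sets_D intro!: pair_measureI B[unfolded sets_DD])
    moreover have "joint (?A1 \<union> ?A2 \<union> ?B) \<le> conv_tail y"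
      using elim by (intro DD.P.finite_measure_mono) auto
    ultimately have "2 * (V y * (1 - V R)) + joint ?B \<le> (2 + e) * V y"
      using elim by (simp add: measure_rect measure_Icc[OF True] V_def[symmetric] mult.commute)
        (simp add: V_def mult.commute)
    then show ?thesis by (simp add: algebra_simps)
  next
    \<comment> \<open>A negative threshold excludes nothing: \<open>V R = 1\<close>, and the claim
      reduces to the convolution bound.\<close>
    case False
    have "V R = 1"
    proof -
      have "measure D {..R} \<le> measure D {..<0}"
        using False by (intro D.finite_measure_mono) (auto simp: sets_D)
      then show ?thesis using nonneg measure_atMost[of R] V_le_1[of R] by simp
    qed
    moreover have "joint ?B \<le> conv_tail y"
      by (intro DD.P.finite_measure_mono) auto
    ultimately show ?thesis using elim by (simp add: algebra_simps)
  qed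
qed

text \<open>The classical inclusion of subexponential in long-tailed laws. Splitting by the first
  summand into \<open>[0, t]\<close>, \<open>(t, y]\<close> and \<open>(y, \<infinity>)\<close>
  bounds the convolution tail below by
  \<open>V y + (1 - V t) * V y + (V t - V y) * V (y - t)\<close>. As the left side is nearly
  \<open>2 * V y\<close>, division by \<open>V t - V y\<close>, which tends to
  \<open>V t > 0\<close>, gives the claim; hence \<open>e'\<close> is taken relative to
  \<open>V t\<close>.\<close>

lemma long_tailed_V:
  assumes "t \<ge> 0" "e > 0"
  shows "\<forall>\<^sub>F y in at_top. V (y - t) \<le> (1 + e) * V y"
proof -
  define e' where "e' = e * V t / 4"
  have e': "e' > 0" using assms V_pos[of t] by (simp add: e'_def)
  have small: "\<forall>\<^sub>F y in at_top. V y < V t * e / (2 * (1 + e))"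
    using V_pos[of t] assms by (intro order_tendstoD[OF V_tendsto_0]) auto
  show ?thesis using conv_tail_upper[OF e'] eventually_ge_at_top[of t] small
  proof eventually_elim
    case (elim y)
    let ?A1 = "{y<..} \<times> {0..}" and ?A2 = "{0..t} \<times> {y<..}" and ?A3 = "{t<..y} \<times> {y-t<..}"
    have V0: "measure D {0..} = 1"
    proof -
      have "{0..} = space D - {..<0}" by (auto simp: space_D)
      then show ?thesis using nonneg
        by (simp only:) (subst D.prob_compl, auto simp: sets_D)
    qed
    have "joint (?A1 \<union> ?A2 \<union> ?A3)
        = joint ?A1 + joint ?A2 + joint ?A3"
      using elim by (subst DD.P.finite_measure_Union; (subst DD.P.finite_measure_Union)?)
        (auto simp: sets_D intro!: pair_measureI)
    moreover have "joint (?A1 \<union> ?A2 \<union> ?A3) \<le> conv_tail y"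
      using elim assms by (intro DD.P.finite_measure_mono) auto
    moreover have "joint ?A1 = V y"
      "joint ?A2 = (1 - V t) * V y"
      "joint ?A3 = (V t - V y) * V (y - t)"
      using elim assms by (simp_all add: measure_rect measure_Icc measure_Ioc V0)
        (simp_all add: V_def)
    ultimately have *: "(V t - V y) * V (y - t) \<le> (e' + V t) * V y"
      using elim by (simp add: algebra_simps)
    have "e' + V t \<le> (1 + e) * (V t - V y)"
    proof -
      have "(1 + e) * V y \<le> V t * e / 2" using elim assms by (simp add: field_simps)
      moreover have "e * V t > 0" using V_pos[of t] assms by simp
      ultimately show ?thesis by (simp add: e'_def algebra_simps)
    qed
    then have "(V t - V y) * V (y - t) \<le> (1 + e) * (V t - V y) * V y"
      using * V_pos[of y] by (meson mult_right_mono less_imp_le order_trans)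
    then have "(V t - V y) * V (y - t) \<le> (V t - V y) * ((1 + e) * V y)"
      by (simp add: algebra_simps)
    moreover have "V t * e / (2 * (1 + e)) \<le> V t"
      using V_pos[of t] assms by (simp add: field_simps)
    then have "V t - V y > 0" using elim by linarith
    ultimately show ?case using mult_le_cancel_left_pos by blast
  qed
qed

end

text \<open>Discretised subexponentiality: \<open>U n\<close> plays the role of a tail \<open>P(X > n)\<close>.\<close>

locale subexp_seq =
  fixes U :: "nat \<Rightarrow> real"
  assumes U_pos: "U n > 0" and U_antimono: "m \<le> n \<Longrightarrow> U n \<le> U m"
    and U_tendsto_0: "U \<longlonglongrightarrow> 0"
    and U_Suc: "e > 0 \<Longrightarrow> \<forall>\<^sub>F n in sequentially. U n \<le> (1 + e) * U (Suc n)"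
    and U_middle: "e > 0 \<Longrightarrow> \<forall>\<^sub>F R in sequentially. \<forall>\<^sub>F n in sequentially.
          (\<Sum>k\<in>{R<..n - R}. (U (k - 1) - U k) * U (n - k)) \<le> e * U n"

text \<open>The scaling by \<open>\<mu>\<close> turns durations into numbers of excess arrivals.
  Each term of the middle sum is the probability of a rectangle; the rectangles are disjoint and lie
  where both summands exceed \<open>R / \<mu>\<close> and the sum exceeds
  \<open>(n - 1) / \<mu>\<close>. The lost cell of width \<open>1 / \<mu>\<close> is recovered by
  long-tailedness.\<close>

lemma (in subexp_nonneg) subexp_seq_scaled:
  assumes "\<mu> > 0"
  shows "subexp_seq (\<lambda>n. V (real n / \<mu>))"
proof
  fix e :: real assume e: "e > 0"
  have top: "filterlim (\<lambda>n. real n / \<mu>) at_top sequentially" using assms by real_asymp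
  have top': "filterlim (\<lambda>n. real n / \<mu> - 1 / \<mu>) at_top sequentially" using assms by real_asymp
  have top1: "filterlim (\<lambda>n. (real n + 1) / \<mu>) at_top sequentially" using assms by real_asymp
  show "\<forall>\<^sub>F n in sequentially. V (real n / \<mu>) \<le> (1 + e) * V (real (Suc n) / \<mu>)"
    using eventually_compose_filterlim[OF long_tailed_V[of "1/\<mu>", OF _ e] top1] assms
    by (simp add: add_divide_distrib add.commute)
  define e' where "e' = min 1 e / 8"
  have e': "0 < e'" "e' \<le> 1" "(3 * e') * (1 + 1) \<le> e" using e by (auto simp: e'_def)
  have "((\<lambda>n. V (real n / \<mu>)) \<longlongrightarrow> 0) sequentially"
    using V_tendsto_0 top by (rule filterlim_compose)
  then have evR: "\<forall>\<^sub>F R in sequentially. V (real R / \<mu>) < e'"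
    by (rule order_tendstoD) (rule e')
  show "\<forall>\<^sub>F R in sequentially. \<forall>\<^sub>F n in sequentially.
      (\<Sum>k\<in>{R<..n - R}. (V (real (k - 1) / \<mu>) - V (real k / \<mu>)) * V (real (n - k) / \<mu>))
        \<le> e * V (real n / \<mu>)"
    using evR
  proof eventually_elim
    case R: (elim R)
    have ev1: "\<forall>\<^sub>F n in sequentially.
      joint {p. fst p > real R / \<mu> \<and> snd p > real R / \<mu> \<and> fst p + snd p > real n / \<mu> - 1 / \<mu>}
        \<le> (e' + 2 * V (real R / \<mu>)) * V (real n / \<mu> - 1 / \<mu>)"
      using eventually_compose_filterlim[OF both_large[OF e'(1), of "real R / \<mu>"] top'] .
    have ev2: "\<forall>\<^sub>F n in sequentially. V (real n / \<mu> - 1 / \<mu>) \<le> (1 + 1) * V (real n / \<mu>)"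
      using eventually_compose_filterlim[OF long_tailed_V[of "1/\<mu>" 1] top] assms by simp
    show ?case using ev1 ev2
    proof eventually_elim
      case (elim n)
      let ?B = "{p. fst p > real R / \<mu> \<and> snd p > real R / \<mu> \<and> fst p + snd p > real n / \<mu> - 1 / \<mu>}"
      let ?S = "\<lambda>k. {real (k - 1) / \<mu><..real k / \<mu>} \<times> {real (n - k) / \<mu><..}"
      have [measurable]: "?S k \<in> sets (D \<Otimes>\<^sub>M D)" for k
        by (intro pair_measureI) (auto simp: sets_D)
      have "(\<Sum>k\<in>{R<..n - R}. (V (real (k - 1) / \<mu>) - V (real k / \<mu>)) * V (real (n - k) / \<mu>))
        = (\<Sum>k\<in>{R<..n - R}. joint (?S k))"
        using assms by (intro sum.cong refl)
          (simp add: measure_rect, simp add: measure_Ioc divide_right_mono V_def)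
      also have "\<dots> = joint (\<Union>k\<in>{R<..n - R}. ?S k)"
      proof (rule DD.P.finite_measure_finite_Union[symmetric])
        show "disjoint_family_on ?S {R<..n - R}"
        unfolding disjoint_family_on_def
        proof (intro ballI impI)
          fix k l assume kl: "k \<in> {R<..n - R}" "l \<in> {R<..n - R}" "k \<noteq> l"
          have *: "{real (k - 1) / \<mu><..real k / \<mu>} \<inter> {real (l - 1) / \<mu><..real l / \<mu>} = {}"
            if "k < l" for k l
          proof -
            have "real k / \<mu> \<le> real (l - 1) / \<mu>"
              using that assms by (intro divide_right_mono) auto
            then show ?thesis by auto
          qed
          show "?S k \<inter> ?S l = {}"
            using *[of k l] *[of l k] kl(3) by (cases "k < l") auto
        qed
      qed auto
      also have "\<dots> \<le> joint
         ?B"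
      proof (rule DD.P.finite_measure_mono)
        show "?B
            \<in> sets (D \<Otimes>\<^sub>M D)"
          by (rule sets_Collect_DD) measurable
        show "(\<Union>k\<in>{R<..n - R}. ?S k) \<subseteq>
          ?B"
        proof
          fix z assume "z \<in> (\<Union>k\<in>{R<..n - R}. ?S k)"
          then obtain k x y where z: "z = (x, y)" and k: "k \<in> {R<..n - R}"
            and x: "x \<in> {real (k - 1) / \<mu><..real k / \<mu>}" and y: "y \<in> {real (n - k) / \<mu><..}"
            by blast
          have "real R \<le> real (k - 1)" "real R \<le> real (n - k)" using k by auto
          then have "real R / \<mu> \<le> real (k - 1) / \<mu>" "real R / \<mu> \<le> real (n - k) / \<mu>"
            using assms by (auto intro: divide_right_mono)
          then have "x > real R / \<mu>" "y > real R / \<mu>" using x y by auto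
          moreover have "real (k - 1) + real (n - k) = real n - 1" using k by auto
          then have "real (k - 1) / \<mu> + real (n - k) / \<mu> = real n / \<mu> - 1 / \<mu>"
            by (simp add: add_divide_distrib[symmetric] diff_divide_distrib[symmetric])
          then have "x + y > real n / \<mu> - 1 / \<mu>" using x y by auto
          ultimately show "z \<in> ?B"
            by (simp add: z)
        qed
      qed
      also have "\<dots> \<le> (3 * e') * V (real n / \<mu> - 1 / \<mu>)"
      proof -
        have "(e' + 2 * V (real R / \<mu>)) * V (real n / \<mu> - 1 / \<mu>) \<le> (3 * e') * V (real n / \<mu> - 1 / \<mu>)"
          using R by (intro mult_right_mono less_imp_le[OF V_pos]) linarith
        with elim(1) show ?thesis by (rule order_trans)
      qed
      also have "\<dots> \<le> (3 * e') * ((1 + 1) * V (real n / \<mu>))"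
        using elim(2) e' by (intro mult_left_mono) auto
      also have "\<dots> \<le> e * V (real n / \<mu>)"
        using e'(3) V_pos[of "real n / \<mu>"] by (simp only: mult.assoc[symmetric] mult_le_cancel_right) auto
      finally show ?case .
    qed
  qed
next
  show "(\<lambda>n. V (real n / \<mu>)) \<longlonglongrightarrow> 0"
    using assms by (intro filterlim_compose[OF V_tendsto_0]) real_asymp
qed (use assms V_pos in \<open>auto intro!: V_antimono divide_right_mono\<close>)

section \<open>Finite-buffer queues with subexponential input\<close>

text \<open>Weight of those splittings of \<open>n\<close> in which both parts exceed
  \<open>R\<close>. The first product is the boundary term left by summation by parts; it is
  harmless because \<open>U R\<close> is small while \<open>U (n - R)\<close> is comparable to
  \<open>U n\<close>.\<close>

definition (in subexp_seq) mid :: "nat \<Rightarrow> nat \<Rightarrow> real" where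
  "mid R n = U R * U (n - R) + (\<Sum>k\<in>{R<..n - R}. (U (k - 1) - U k) * U (n - k))"

context subexp_seq
begin

lemma U_add: "e > 0 \<Longrightarrow> \<forall>\<^sub>F n in sequentially. U n \<le> (1 + e) * U (n + k)"
proof (induction k arbitrary: e)
  case 0
  then show ?case using U_pos by (intro always_eventually allI) (simp add: less_imp_le)
next
  case (Suc k)
  obtain e' where e': "e' > 0" and e2: "(1 + e') * (1 + e') \<le> 1 + e"
    by (rule square_one_plus_le[OF Suc.prems]) blast
  have "\<forall>\<^sub>F n in sequentially. U (n + k) \<le> (1 + e') * U (Suc (n + k))"
    using U_Suc[OF e'] by (rule eventually_compose_filterlim)
      (simp add: filterlim_add_const_nat_at_top)
  with Suc.IH[OF e'] show ?case
  proof eventually_elim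
    case (elim n)
    have "U n \<le> (1 + e') * U (n + k)" by fact
    also have "\<dots> \<le> (1 + e') * ((1 + e') * U (Suc (n + k)))"
      using elim e' by (intro mult_left_mono) auto
    also have "\<dots> \<le> (1 + e) * U (n + Suc k)"
      using e2 U_pos[of "n + Suc k"] by (simp only: mult.assoc[symmetric] add_Suc_right) (simp add: mult_right_mono less_imp_le)
    finally show ?case .
  qed
qed

lemma U_diff: "e > 0 \<Longrightarrow> \<forall>\<^sub>F n in sequentially. U (n - k) \<le> (1 + e) * U n"
proof -
  assume "e > 0"
  have "\<forall>\<^sub>F n in sequentially. U (n - k) \<le> (1 + e) * U ((n - k) + k)"
    using U_add[OF \<open>e > 0\<close>] by (rule eventually_compose_filterlim)
      (simp add: filterlim_minus_const_nat_at_top)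
  then show ?thesis using eventually_ge_at_top[of k]
    by eventually_elim simp
qed

lemma eventually_mid:
  assumes "e > 0"
  shows "\<forall>\<^sub>F R in sequentially. \<forall>\<^sub>F n in sequentially. mid R n \<le> e * U n"
proof -
  have "\<forall>\<^sub>F R in sequentially. U R < e / 4"
    using assms by (intro order_tendstoD[OF U_tendsto_0]) auto
  moreover have "\<forall>\<^sub>F R in sequentially. \<forall>\<^sub>F n in sequentially.
      (\<Sum>k\<in>{R<..n - R}. (U (k - 1) - U k) * U (n - k)) \<le> (e/2) * U n"
    using assms by (intro U_middle) auto
  ultimately show ?thesis
  proof eventually_elim
    case R: (elim R)
    have "\<forall>\<^sub>F n in sequentially. U (n - R) \<le> (1 + 1) * U n" by (rule U_diff) simp
    with R(2) show ?case
    proof eventually_elim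
      case (elim n)
      have "U R * U (n - R) \<le> (e / 4) * (2 * U n)"
        using R elim U_pos[of R] U_pos[of "n - R"] by (intro mult_mono) (auto simp: less_imp_le)
      with elim show ?case by (simp add: mid_def)
    qed
  qed
qed

lemma summation_by_parts:
  fixes G F :: "nat \<Rightarrow> real"
  assumes "a \<le> b"
  shows "(\<Sum>l\<in>{a<..b}. (G (l - 1) - G l) * F l)
       = G a * F a - G b * F b + (\<Sum>l\<in>{a<..b}. G (l - 1) * (F l - F (l - 1)))"
  using assms
proof (induction b rule: dec_induct)
  case (step n)
  have "{a<..Suc n} = insert (Suc n) {a<..n}" using step by auto
  then show ?case using step by (simp add: algebra_simps)
qed simp

text \<open>Only the size of \<open>G\<close> is controlled by \<open>U\<close>, not its increments.
  Summation by parts moves the increments over to \<open>U\<close>, and the reflection of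
  \<open>l\<close> to \<open>n + 1 - l\<close> brings the result back to the form of
  \<open>mid\<close>.\<close>

lemma middle_sum_le:
  fixes G :: "nat \<Rightarrow> real"
  assumes B: "\<And>l. l \<le> n \<Longrightarrow> G l \<le> B * U l" and G: "\<And>l. G l \<ge> 0" and R: "2 * R \<le> n"
  shows "(\<Sum>l\<in>{R<..n - R}. (G (l - 1) - G l) * U (n - l)) \<le> B * mid R n"
proof -
  have "(\<Sum>l\<in>{R<..n - R}. (G (l - 1) - G l) * U (n - l))
      = G R * U (n - R) - G (n - R) * U (n - (n - R))
        + (\<Sum>l\<in>{R<..n - R}. G (l - 1) * (U (n - l) - U (n - (l - 1))))"
    using R by (intro summation_by_parts) auto
  also have "(\<Sum>l\<in>{R<..n - R}. G (l - 1) * (U (n - l) - U (n - (l - 1))))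
      = (\<Sum>k\<in>{R<..n - R}. G (n - k) * (U (k - 1) - U k))"
  proof (rule sum.reindex_bij_witness[of _ "\<lambda>k. n + 1 - k" "\<lambda>k. n + 1 - k"])
    fix l assume "l \<in> {R<..n - R}"
    then have "n - (n + 1 - l) = l - 1" "n + 1 - l - 1 = n - l" "n - (l - 1) = n + 1 - l"
      using R by auto
    then show "G (n - (n + 1 - l)) * (U (n + 1 - l - 1) - U (n + 1 - l))
        = G (l - 1) * (U (n - l) - U (n - (l - 1)))" by simp
  qed (use R in auto)
  also have "\<dots> \<le> (\<Sum>k\<in>{R<..n - R}. B * U (n - k) * (U (k - 1) - U k))"
    using U_antimono by (intro sum_mono mult_right_mono B) auto
  also have "\<dots> = B * (\<Sum>k\<in>{R<..n - R}. (U (k - 1) - U k) * U (n - k))"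
    by (simp add: sum_distrib_left mult_ac)
  also have "G R * U (n - R) - G (n - R) * U (n - (n - R)) \<le> B * U R * U (n - R) - 0"
    using R G U_pos by (intro diff_mono mult_right_mono B mult_nonneg_nonneg) (auto simp: less_imp_le)
  finally show ?thesis by (simp add: mid_def algebra_simps)
qed

end

text \<open>Every unit of the shift telescopes to at most \<open>q 0\<close>. The bound does not
  depend on the window length \<open>Y\<close>, so it disappears in the average over a long
  window.\<close>

lemma telescope_shift_le:
  fixes q :: "nat \<Rightarrow> real"
  assumes "decseq q" "\<And>n. q n \<ge> 0"
  shows "(\<Sum>i<Y. q i - q (i + s)) \<le> real s * q 0"
proof (induction s)
  case (Suc s)
  have "(\<Sum>i<Y. q i - q (i + Suc s)) = (\<Sum>i<Y. q i - q (i + s)) + (\<Sum>i<Y. q (s + i) - q (s + Suc i))"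
    by (simp add: sum.distrib[symmetric] add_ac)
  also have "(\<Sum>i<Y. q (s + i) - q (s + Suc i)) = q s - q (s + Y)"
    using sum_lessThan_telescope'[of "\<lambda>i. q (s + i)" Y] by simp
  also have "\<dots> \<le> q 0" using assms(2)[of "s + Y"] decseqD[OF assms(1), of 0 s] by simp
  finally show ?case using Suc by (simp add: algebra_simps)
qed simp

section \<open>The integrated tail of a counting variable\<close>

locale integrable_count = prob_space M for M :: "'a measure" +
  fixes A :: "'a \<Rightarrow> nat"
  assumes A_meas [measurable]: "A \<in> M \<rightarrow>\<^sub>M count_space UNIV"
    and A_int: "integrable M (\<lambda>\<omega>. real (A \<omega>))"
begin

text \<open>Mean overflow of a batch \<open>A\<close> into \<open>n\<close> free places. Its
  decrements are the plain tail \<open>T\<close>, so it is the integrated tail of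
  \<open>A\<close>.\<close>

definition H :: "nat \<Rightarrow> real" where "H n = (\<integral>\<omega>. real (A \<omega> - n) \<partial>M)"
definition T :: "nat \<Rightarrow> real" where "T n = prob {\<omega>\<in>space M. A \<omega> > n}"

abbreviation "excess n y \<equiv> \<integral>\<omega>. real (min (A \<omega> - n) y) \<partial>M"

lemma integrable_indicator: "S \<in> sets M \<Longrightarrow> integrable M (indicator S :: 'a \<Rightarrow> real)"
  by (rule integrable_real_indicator) (auto simp: less_top[symmetric])

lemma integrable_nat_le_A:
  assumes [measurable]: "f \<in> M \<rightarrow>\<^sub>M count_space UNIV" and "\<And>\<omega>. f \<omega> \<le> A \<omega> + c"
  shows "integrable M (\<lambda>\<omega>. real (f \<omega>))"
proof (rule Bochner_Integration.integrable_bound)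
  show "integrable M (\<lambda>\<omega>. real (A \<omega>) + real c)" using A_int by simp
  show "AE \<omega> in M. norm (real (f \<omega>)) \<le> norm (real (A \<omega>) + real c)"
  proof (rule AE_I2)
    fix \<omega> show "norm (real (f \<omega>)) \<le> norm (real (A \<omega>) + real c)"
      using assms(2)[of \<omega>] of_nat_mono[of "f \<omega>" "A \<omega> + c", where 'a = real] by simp
  qed
qed measurable

lemma H_antimono: "m \<le> n \<Longrightarrow> H n \<le> H m"
  unfolding H_def by (intro integral_mono integrable_nat_le_A[where c = 0]) auto

lemma H_nonneg: "H n \<ge> 0" unfolding H_def by (intro Bochner_Integration.integral_nonneg) auto

lemma H_0: "H 0 = (\<integral>\<omega>. real (A \<omega>) \<partial>M)" by (simp add: H_def)

lemma H_diff_Suc: "H n - H (Suc n) = T n"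
proof -
  have "H n - H (Suc n) = (\<integral>\<omega>. real (A \<omega> - n) - real (A \<omega> - Suc n) \<partial>M)"
    unfolding H_def by (intro Bochner_Integration.integral_diff[symmetric] integrable_nat_le_A[where c = 0]) auto
  also have "\<dots> = (\<integral>\<omega>. indicator {\<omega>\<in>space M. A \<omega> > n} \<omega> \<partial>M)"
    by (intro Bochner_Integration.integral_cong) (auto simp: indicator_def of_nat_diff)
  finally show ?thesis by (simp add: T_def)
qed

lemma excess_le_H: "excess n y \<le> H n"
  unfolding H_def by (intro integral_mono integrable_nat_le_A[where c = 0]) auto

text \<open>The truncated overflow vanishes unless \<open>A > n\<close>. For bounded
  \<open>y\<close> this trades the integrated tail for the plain one, which is of smaller order; it
  serves the levels close to a full buffer.\<close>

lemma excess_le_T: "excess n y \<le> real y * T n"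
proof -
  have "excess n y \<le> (\<integral>\<omega>. real y * indicator {\<omega>\<in>space M. A \<omega> > n} \<omega> \<partial>M)"
  proof (intro integral_mono integrable_nat_le_A[where c = 0])
    show "integrable M (\<lambda>\<omega>. real y * indicator {\<omega>\<in>space M. A \<omega> > n} \<omega>)"
      by (intro integrable_mult_right integrable_indicator) measurable
  qed (auto simp: indicator_def)
  then show ?thesis by (simp add: T_def)
qed

lemma H_tendsto_0: "H \<longlonglongrightarrow> 0"
proof -
  have "(\<lambda>n. \<integral>\<omega>. real (A \<omega> - n) \<partial>M) \<longlonglongrightarrow> (\<integral>\<omega>. 0 \<partial>M)"
  proof (rule integral_dominated_convergence[where w = "\<lambda>\<omega>. real (A \<omega>)"])
    show "AE \<omega> in M. (\<lambda>n. real (A \<omega> - n)) \<longlonglongrightarrow> 0"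
    proof (rule AE_I2)
      fix \<omega>
      have "\<forall>\<^sub>F n in sequentially. real (A \<omega> - n) = 0"
        using eventually_ge_at_top[of "A \<omega>"] by eventually_elim simp
      then show "(\<lambda>n. real (A \<omega> - n)) \<longlonglongrightarrow> 0" by (rule tendsto_eventually)
    qed
  qed (use A_int in auto)
  then show ?thesis by (simp add: H_def[abs_def])
qed

end

section \<open>A stationary queue with a fixed buffer\<close>

locale buffer_queue = integrable_count M A for M :: "'a measure" and A +
  fixes C :: "'a \<Rightarrow> nat" and K :: nat and p :: "nat \<Rightarrow> real"
  assumes C_meas [measurable]: "C \<in> M \<rightarrow>\<^sub>M count_space UNIV"
    and stat: "stationary_dist M A C K p"
begin

lemma AC_meas: "(\<lambda>\<omega>. f (A \<omega>) (C \<omega>)) \<in> M \<rightarrow>\<^sub>M count_space UNIV"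
  by (rule measurable_compose_countable[OF measurable_compose[OF C_meas measurable_count_space] A_meas])

definition G :: "nat \<Rightarrow> real" where "G n = (\<Sum>l\<in>{n<..K}. p l)"

lemma p_nonneg: "p l \<ge> 0" and p_sum: "(\<Sum>l\<le>K. p l) = 1" and p_zero: "l > K \<Longrightarrow> p l = 0"
  and p_stat: "l \<le> K \<Longrightarrow> p l = (\<Sum>i\<le>K. p i * trans_prob M A C K i l)"
  using stat by (auto simp: stationary_dist_def)

lemma p_supp: "p l \<noteq> 0 \<Longrightarrow> l \<le> K" using p_zero by (meson not_le)

lemma G_nonneg: "G n \<ge> 0" unfolding G_def by (intro sum_nonneg p_nonneg)

lemma G_antimono: "m \<le> n \<Longrightarrow> G n \<le> G m"
  unfolding G_def by (intro sum_mono2) (auto simp: p_nonneg)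

lemma G_le_1: "G n \<le> 1"
  unfolding G_def p_sum[symmetric] by (intro sum_mono2) (auto simp: p_nonneg)

lemma p_eq_G_diff: "l \<ge> 1 \<Longrightarrow> p l = G (l - 1) - G l"
proof -
  assume l: "l \<ge> 1"
  show ?thesis
  proof (cases "l \<le> K")
    case True
    then have "{l - 1<..K} = insert l {l<..K}" using l by auto
    then show ?thesis unfolding G_def by simp
  qed (simp add: G_def p_zero)
qed

text \<open>Stationarity is given for point masses; on the finite set of levels every test function
  is a combination of these, so the balance extends by linearity.\<close>

lemma stationary_expectation:
  fixes f :: "nat \<Rightarrow> real"
  shows "(\<Sum>l\<le>K. p l * f l) = (\<Sum>l\<le>K. p l * (\<integral>\<omega>. f (min (l + A \<omega>) K - C \<omega>) \<partial>M))"
proof -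
  have *: "(\<integral>\<omega>. f (min (l + A \<omega>) K - C \<omega>) \<partial>M) = (\<Sum>l'\<le>K. f l' * trans_prob M A C K l l')" for l
  proof -
    have "(\<integral>\<omega>. f (min (l + A \<omega>) K - C \<omega>) \<partial>M)
      = (\<integral>\<omega>. (\<Sum>l'\<le>K. f l' * indicator {\<omega>\<in>space M. min (l + A \<omega>) K - C \<omega> = l'} \<omega>) \<partial>M)"
    proof (intro Bochner_Integration.integral_cong refl)
      fix \<omega> assume "\<omega> \<in> space M"
      then have "(\<Sum>l'\<le>K. f l' * indicator {\<omega>\<in>space M. min (l + A \<omega>) K - C \<omega> = l'} \<omega>)
        = (\<Sum>l'\<le>K. if min (l + A \<omega>) K - C \<omega> = l' then f l' else 0)"
        by (intro sum.cong) (auto simp: indicator_def)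
      also have "\<dots> = f (min (l + A \<omega>) K - C \<omega>)" by (subst sum.delta') auto
      finally show "f (min (l + A \<omega>) K - C \<omega>) = (\<Sum>l'\<le>K. f l' * indicator {\<omega>\<in>space M. min (l + A \<omega>) K - C \<omega> = l'} \<omega>)"
        by simp
    qed
    also have "\<dots> = (\<Sum>l'\<le>K. f l' * trans_prob M A C K l l')"
    proof (subst Bochner_Integration.integral_sum)
      fix l'
      have "{\<omega>\<in>space M. min (l + A \<omega>) K - C \<omega> = l'} \<in> sets M"
        using AC_meas[of "\<lambda>a c. min (l + a) K - c = l'"] by (simp add: pred_def)
      then show "integrable M (\<lambda>\<omega>. f l' * indicator {\<omega>\<in>space M. min (l + A \<omega>) K - C \<omega> = l'} \<omega>)"
        by (intro integrable_mult_right integrable_indicator)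
    qed (simp add: trans_prob_def)
    finally show ?thesis .
  qed
  have "(\<Sum>l'\<le>K. p l' * f l') = (\<Sum>l'\<le>K. (\<Sum>l\<le>K. p l * trans_prob M A C K l l') * f l')"
    by (intro sum.cong refl arg_cong2[where f = "(*)"] p_stat) auto
  also have "\<dots> = (\<Sum>l'\<le>K. \<Sum>l\<le>K. p l * (f l' * trans_prob M A C K l l'))"
    by (simp add: sum_distrib_right sum_distrib_left mult_ac)
  also have "\<dots> = (\<Sum>l\<le>K. p l * (\<Sum>l'\<le>K. f l' * trans_prob M A C K l l'))"
    by (subst sum.swap) (simp add: sum_distrib_left)
  finally show ?thesis by (simp add: *)
qed

text \<open>The balance of the test function \<open>l \<mapsto> (l - x)\<^sup>+\<close> under the stationary law:
  well above \<open>x\<close> it has the full negative drift.\<close>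

lemma level_balance:
  fixes r x :: nat
  defines "a \<equiv> (\<integral>\<omega>. real (min (C \<omega>) r) \<partial>M) - H 0"
  shows "a * (\<Sum>l\<in>{x + r..K}. p l) \<le> H 0 * (\<Sum>l\<in>{x..<x + r} \<inter> {..K}. p l)
    + (\<Sum>l\<in>{..<x} \<inter> {..K}. p l * excess (x - l) (K - x))"
proof -
  define h where "h l = excess (x - l) (K - x)" for l
  define \<psi> where "\<psi> l = (\<integral>\<omega>. real (min (l + A \<omega>) K - C \<omega> - x) \<partial>M) - real (l - x)" for l
  have intC: "integrable M (\<lambda>\<omega>. real (min (C \<omega>) r))"
    by (rule integrable_const_bound[where B = r]) auto
  have int: "integrable M (\<lambda>\<omega>. real (min (l + A \<omega>) K - C \<omega> - x))" for l
    by (rule integrable_nat_le_A[where c = l]) auto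
  \<comment> \<open>From \<open>x + r\<close> on, removing at most \<open>r\<close> customers does
    not bring the level below \<open>x\<close>, so the positive part in the test function does not
    clip the downward drift.\<close>
  have 1: "\<psi> l \<le> - a" if "x + r \<le> l" for l
  proof -
    have "(\<integral>\<omega>. real (min (l + A \<omega>) K - C \<omega> - x) \<partial>M)
        \<le> (\<integral>\<omega>. real (l - x) + real (A \<omega>) - real (min (C \<omega>) r) \<partial>M)"
    proof (intro integral_mono int)
      fix \<omega>
      have "min (l + A \<omega>) K - C \<omega> - x + min (C \<omega>) r \<le> (l - x) + A \<omega>" using that by auto
      then show "real (min (l + A \<omega>) K - C \<omega> - x) \<le> real (l - x) + real (A \<omega>) - real (min (C \<omega>) r)"
        by linarith
    qed (use A_int intC in auto)
    also have "\<dots> = real (l - x) + H 0 - (\<integral>\<omega>. real (min (C \<omega>) r) \<partial>M)"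
      using A_int intC by (simp add: H_0 prob_space)
    finally show ?thesis by (simp add: \<psi>_def a_def)
  qed
  have 2: "\<psi> l \<le> H 0" if "x \<le> l" for l
  proof -
    have "(\<integral>\<omega>. real (min (l + A \<omega>) K - C \<omega> - x) \<partial>M) \<le> (\<integral>\<omega>. real (l - x) + real (A \<omega>) \<partial>M)"
    proof (intro integral_mono int)
      fix \<omega>
      have "min (l + A \<omega>) K - C \<omega> - x \<le> (l - x) + A \<omega>" using that by auto
      then show "real (min (l + A \<omega>) K - C \<omega> - x) \<le> real (l - x) + real (A \<omega>)"
        by linarith
    qed (use A_int in auto)
    also have "\<dots> = real (l - x) + H 0" using A_int by (simp add: H_0 prob_space)
    finally show ?thesis by (simp add: \<psi>_def)
  qed
  have 3: "\<psi> l \<le> h l" if "l < x" for l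
  proof -
    have "(\<integral>\<omega>. real (min (l + A \<omega>) K - C \<omega> - x) \<partial>M) \<le> h l"
      unfolding h_def using that by (intro integral_mono int integrable_nat_le_A[where c = 0]) auto
    then show ?thesis using that by (simp add: \<psi>_def)
  qed
  have "0 = (\<Sum>l\<le>K. p l * \<psi> l)"
    using stationary_expectation[of "\<lambda>l. real (l - x)"]
    by (simp add: \<psi>_def right_diff_distrib sum_subtractf)
  also have "{..K} = {x + r..K} \<union> ({x..<x + r} \<inter> {..K}) \<union> ({..<x} \<inter> {..K})" by auto
  also have "(\<Sum>l\<in>\<dots>. p l * \<psi> l) = (\<Sum>l\<in>{x + r..K}. p l * \<psi> l)
     + (\<Sum>l\<in>{x..<x + r} \<inter> {..K}. p l * \<psi> l) + (\<Sum>l\<in>{..<x} \<inter> {..K}. p l * \<psi> l)"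
    by (subst sum.union_disjoint; (subst sum.union_disjoint)?) auto
  also have "\<dots> \<le> (\<Sum>l\<in>{x + r..K}. p l * (- a))
     + (\<Sum>l\<in>{x..<x + r} \<inter> {..K}. p l * H 0) + (\<Sum>l\<in>{..<x} \<inter> {..K}. p l * h l)"
    by (intro add_mono sum_mono mult_left_mono p_nonneg) (auto intro: 1 2 3)
  finally show ?thesis unfolding h_def[symmetric]
    by (simp add: sum_distrib_left sum_distrib_right mult_ac sum_negf)
qed

text \<open>Levels below \<open>n - R\<close> reach \<open>n\<close> either by one big arrival batch, or with both
  the level and the batch exceeding \<open>R\<close>.\<close>

lemma low_levels_le:
  assumes "subexp_seq U" and F: "\<And>n. F n \<le> c * U n" "\<And>m n. m \<le> n \<Longrightarrow> F n \<le> F m" "\<And>n. F n \<ge> 0" "c \<ge> 0"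
    and B: "\<And>l. l \<le> n \<Longrightarrow> G l \<le> B * U l" and R: "2 * R \<le> n"
  shows "(\<Sum>l\<le>n - R. p l * F (n - l)) \<le> F (n - R) + c * B * subexp_seq.mid U R n"
proof -
  interpret subexp_seq U by fact
  have "{..n - R} = {..R} \<union> {R<..n - R}" using R by auto
  then have "(\<Sum>l\<le>n - R. p l * F (n - l))
      = (\<Sum>l\<le>R. p l * F (n - l)) + (\<Sum>l\<in>{R<..n - R}. p l * F (n - l))"
    by (simp only:) (rule sum.union_disjoint, auto)
  also have "(\<Sum>l\<le>R. p l * F (n - l)) \<le> (\<Sum>l\<le>R. p l * F (n - R))"
    using R by (intro sum_mono mult_left_mono F p_nonneg) auto
  also have "\<dots> = (\<Sum>l\<le>R. p l) * F (n - R)" by (simp add: sum_distrib_right)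
  also have "\<dots> \<le> 1 * F (n - R)"
  proof (intro mult_right_mono F)
    have "(\<Sum>l\<le>R. p l) = (\<Sum>l\<in>{..R} \<inter> {..K}. p l)"
      by (intro sum.mono_neutral_right) (auto dest: p_supp)
    also have "\<dots> \<le> 1" unfolding p_sum[symmetric] by (intro sum_mono2) (auto simp: p_nonneg)
    finally show "(\<Sum>l\<le>R. p l) \<le> 1" .
  qed
  also have "(\<Sum>l\<in>{R<..n - R}. p l * F (n - l)) \<le> (\<Sum>l\<in>{R<..n - R}. p l * (c * U (n - l)))"
    by (intro sum_mono mult_left_mono F p_nonneg)
  \<comment> \<open>Only the tail \<open>G\<close> is bounded, not the single masses; written as
    differences of \<open>G\<close> they become accessible to summation by parts.\<close>
  also have "\<dots> = c * (\<Sum>l\<in>{R<..n - R}. (G (l - 1) - G l) * U (n - l))"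
    by (auto simp: sum_distrib_left p_eq_G_diff mult_ac intro!: sum.cong)
  also have "\<dots> \<le> c * (B * mid R n)"
    using F B R by (intro mult_left_mono middle_sum_le G_nonneg) auto
  finally show ?thesis by simp
qed

end

context buffer_queue
begin

text \<open>The levels below \<open>x\<close> are cut at \<open>x - R0\<close> and
  \<open>x - R\<close>. Those above \<open>x - R0\<close> are charged the full mean
  \<open>H 0\<close>, the band in between only \<open>H R0\<close>, which is small for large
  \<open>R0\<close>, and the low levels keep their exact truncated overflow. Two cutoffs are offered
  because \<open>R\<close> may have to be chosen long after \<open>R0\<close>.\<close>

lemma drift_inequality:
  fixes r x R0 R :: nat
  defines "a \<equiv> (\<integral>\<omega>. real (min (C \<omega>) r) \<partial>M) - H 0"
  assumes a: "a \<ge> 0" and R: "1 \<le> R0" "R0 \<le> R" "R \<le> x"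
  shows "(a + H 0) * G (x + r) \<le> H 0 * G (x - R0) + H R0 * (G (x - R) - G (x - R0))
    + (\<Sum>l\<le>x - R. p l * excess (x - l) (K - x))"
proof -
  define h where "h l = excess (x - l) (K - x)" for l
  have h: "0 \<le> h l" "h l \<le> H (x - l)" for l
    unfolding h_def by (rule Bochner_Integration.integral_nonneg, simp, rule excess_le_H)
  define Q where "Q = (\<Sum>l\<in>{x + r..K}. p l)"
  define S where "S = (\<Sum>l\<in>{x..<x + r} \<inter> {..K}. p l)"
  define S' where "S' = (\<Sum>l\<in>{x - R0<..<x} \<inter> {..K}. p l)"
  have "(\<Sum>l\<in>{..<x} \<inter> {..K}. p l * h l) \<le> (\<Sum>l\<in>{..x - R} \<union> ({x - R<..x - R0} \<inter> {..K}) \<union> ({x - R0<..<x} \<inter> {..K}). p l * h l)"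
    using p_nonneg h(1) R by (intro sum_mono2) auto
  also have "\<dots> = (\<Sum>l\<le>x - R. p l * h l) + (\<Sum>l\<in>{x - R<..x - R0} \<inter> {..K}. p l * h l)
      + (\<Sum>l\<in>{x - R0<..<x} \<inter> {..K}. p l * h l)"
    using R by (subst sum.union_disjoint; (subst sum.union_disjoint)?) auto
  also have "(\<Sum>l\<in>{x - R<..x - R0} \<inter> {..K}. p l * h l) \<le> (\<Sum>l\<in>{x - R<..x - R0} \<inter> {..K}. p l * H R0)"
    using R by (intro sum_mono mult_left_mono p_nonneg order_trans[OF h(2)] H_antimono) auto
  also have "\<dots> = H R0 * (\<Sum>l\<in>{x - R<..x - R0} \<inter> {..K}. p l)" by (simp add: sum_distrib_left mult_ac)
  also have "(\<Sum>l\<in>{x - R<..x - R0} \<inter> {..K}. p l) = G (x - R) - G (x - R0)"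
  proof -
    have "{x - R<..K} = ({x - R<..x - R0} \<inter> {..K}) \<union> {x - R0<..K}" using R by auto
    then show ?thesis unfolding G_def by (simp only:) (subst sum.union_disjoint, auto)
  qed
  also have "(\<Sum>l\<in>{x - R0<..<x} \<inter> {..K}. p l * h l) \<le> (\<Sum>l\<in>{x - R0<..<x} \<inter> {..K}. p l * H 0)"
    by (intro sum_mono mult_left_mono p_nonneg order_trans[OF h(2)] H_antimono) auto
  also have "\<dots> = H 0 * S'" by (simp add: S'_def sum_distrib_left mult_ac)
  finally have "a * Q \<le> H 0 * (S + S') + H R0 * (G (x - R) - G (x - R0)) + (\<Sum>l\<le>x - R. p l * h l)"
    using level_balance[of r x] unfolding a_def[symmetric] h_def[symmetric] Q_def[symmetric] S_def[symmetric]
    by (simp add: algebra_simps)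
  \<comment> \<open>Bringing \<open>Q\<close> to the left raises its coefficient from
    \<open>a\<close> to \<open>a + H 0\<close>, against \<open>H 0\<close> on the right. This ratio
    is the contraction.\<close>
  also have "S + S' = G (x - R0) - Q"
  proof -
    have "{x - R0<..K} = ({x..<x + r} \<inter> {..K}) \<union> ({x - R0<..<x} \<inter> {..K}) \<union> {x + r..K}" using R by auto
    then have "G (x - R0) = S + S' + Q" unfolding G_def S_def S'_def Q_def
      by (simp only:) (subst sum.union_disjoint; (subst sum.union_disjoint)?; auto)
    then show ?thesis by simp
  qed
  finally have "(a + H 0) * Q \<le> H 0 * G (x - R0) + H R0 * (G (x - R) - G (x - R0)) + (\<Sum>l\<le>x - R. p l * h l)"
    by (simp add: algebra_simps)
  moreover have "G (x + r) \<le> Q" unfolding G_def Q_def by (intro sum_mono2) (auto simp: p_nonneg)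
  then have "(a + H 0) * G (x + r) \<le> (a + H 0) * Q"
    using a H_nonneg by (intro mult_left_mono) auto
  ultimately show ?thesis unfolding h_def by simp
qed

end

section \<open>Asymptotics as the buffer grows\<close>

locale buffer_queues = prob_space M + U: subexp_seq U
  for M :: "'a measure" and U +
  fixes A C :: "'a \<Rightarrow> nat" and p :: "nat \<Rightarrow> nat \<Rightarrow> real" and c :: real
  assumes A_meas [measurable]: "A \<in> M \<rightarrow>\<^sub>M count_space UNIV"
    and C_meas [measurable]: "C \<in> M \<rightarrow>\<^sub>M count_space UNIV"
    and A_int: "integrable M (\<lambda>\<omega>. real (A \<omega>))"
    and p_stat: "stationary_dist M A C K (p K)"
    and stable: "(\<integral>\<^sup>+\<omega>. ennreal (real (A \<omega>)) \<partial>M) < (\<integral>\<^sup>+\<omega>. ennreal (real (C \<omega>)) \<partial>M)"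
    and c_pos: "c > 0"
    and H_asymp: "(\<lambda>n. \<integral>\<omega>. real (A \<omega> - n) \<partial>M) \<sim>[sequentially] (\<lambda>n. c * U n)"
begin

sublocale Q: buffer_queue M A C K "p K" for K
  by unfold_locales (use A_int p_stat in auto)

abbreviation "H \<equiv> Q.H"
abbreviation "T \<equiv> Q.T"

text \<open>The mean of \<open>C\<close> may be infinite. By monotone convergence a finite
  truncation already has a mean above that of \<open>A\<close>; its height \<open>r\<close> is also
  the margin above the test level that the balance requires.\<close>

lemma exists_truncation:
  obtains r a where "r \<ge> 1" "a > 0" "a = (\<integral>\<omega>. real (min (C \<omega>) r) \<partial>M) - H 0"
proof -
  have int: "integrable M (\<lambda>\<omega>. real (min (C \<omega>) r))" for r
    by (rule integrable_const_bound[where B = r]) auto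
  have "(\<integral>\<^sup>+\<omega>. ennreal (real (C \<omega>)) \<partial>M) = (\<integral>\<^sup>+\<omega>. (SUP r. ennreal (real (min (C \<omega>) r))) \<partial>M)"
  proof (intro nn_integral_cong)
    fix \<omega>
    show "ennreal (real (C \<omega>)) = (SUP r. ennreal (real (min (C \<omega>) r)))"
      by (rule antisym) (auto intro!: SUP_upper2[of "C \<omega>"] SUP_least ennreal_leI)
  qed
  also have "\<dots> = (SUP r. \<integral>\<^sup>+\<omega>. ennreal (real (min (C \<omega>) r)) \<partial>M)"
    by (intro nn_integral_monotone_convergence_SUP) (auto simp: incseq_def le_fun_def intro!: ennreal_leI)
  finally obtain r where r: "(\<integral>\<^sup>+\<omega>. ennreal (real (A \<omega>)) \<partial>M) < (\<integral>\<^sup>+\<omega>. ennreal (real (min (C \<omega>) r)) \<partial>M)"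
    using stable by (auto simp: less_SUP_iff)
  then have "ennreal (H 0) < ennreal (\<integral>\<omega>. real (min (C \<omega>) r) \<partial>M)"
    using A_int int by (subst (asm) (1 2) nn_integral_eq_integral) (auto simp: Q.H_0)
  then have *: "H 0 < (\<integral>\<omega>. real (min (C \<omega>) r) \<partial>M)"
    using Q.H_nonneg[of 0] by (simp add: ennreal_less_iff)
  moreover have "r \<ge> 1"
  proof (rule ccontr)
    assume "\<not> r \<ge> 1"
    then have "r = 0" by simp
    then show False using * Q.H_nonneg[of 0] by simp
  qed
  ultimately show ?thesis using that[of r "(\<integral>\<omega>. real (min (C \<omega>) r) \<partial>M) - H 0"] by simp
qed

lemma H_asymp': "H \<sim>[sequentially] (\<lambda>n. c * U n)"
  using H_asymp by (simp add: Q.H_def[abs_def])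

lemma H_ratio: "(\<lambda>n. H n / U n) \<longlonglongrightarrow> c"
proof -
  have "(\<lambda>n. H n / (c * U n)) \<longlonglongrightarrow> 1"
    using H_asymp' by (rule asymp_equivD_strong) (use c_pos U.U_pos in \<open>auto intro!: always_eventually simp: less_imp_neq[symmetric]\<close>)
  then have "(\<lambda>n. c * (H n / (c * U n))) \<longlonglongrightarrow> c * 1" by (intro tendsto_intros)
  then show ?thesis using c_pos by simp
qed

lemma H_bound: obtains c' where "c' > 0" "\<And>n. H n \<le> c' * U n"
proof -
  have "Bseq (\<lambda>n. H n / U n)" using H_ratio by (intro convergent_imp_Bseq) (auto simp: convergent_def)
  then obtain c' where c': "c' > 0" "\<And>n. norm (H n / U n) \<le> c'" by (auto simp: Bseq_def)
  have "H n \<le> c' * U n" for n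
    using c'(2)[of n] U.U_pos[of n] Q.H_nonneg[of n] by (simp add: field_simps)
  with c'(1) show ?thesis by (rule that)
qed

lemma U_ratio_Suc: "(\<lambda>n. U (Suc n) / U n) \<longlonglongrightarrow> 1"
proof -
  have "U \<sim>[sequentially] (\<lambda>n. U (Suc n))"
    by (rule asymp_equiv_from_above[OF U.U_Suc]) (simp_all add: U.U_pos U.U_antimono)
  then show ?thesis
    by (rule asymp_equivD_strong[OF asymp_equiv_symI]) (simp add: U.U_pos less_imp_neq[symmetric])
qed

text \<open>\<open>T\<close> is the decrement of \<open>H\<close>, and consecutive values of
  \<open>H\<close> are both asymptotic to \<open>c * U n\<close> because \<open>U (Suc n)\<close> is
  asymptotic to \<open>U n\<close>.\<close>

lemma T_small: "e > 0 \<Longrightarrow> \<forall>\<^sub>F n in sequentially. T n \<le> e * U n"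
proof -
  assume e: "e > 0"
  have "(\<lambda>n. H n / U n - (H (Suc n) / U (Suc n)) * (U (Suc n) / U n)) \<longlonglongrightarrow> c - c * 1"
    by (intro tendsto_intros H_ratio U_ratio_Suc LIMSEQ_Suc[OF H_ratio])
  then have "\<forall>\<^sub>F n in sequentially. H n / U n - (H (Suc n) / U (Suc n)) * (U (Suc n) / U n) < e"
    by (rule order_tendstoD) (use e in simp)
  then show ?thesis
  proof eventually_elim
    case (elim n)
    have "H n / U n - (H (Suc n) / U (Suc n)) * (U (Suc n) / U n) = T n / U n"
      using U.U_pos[of "Suc n"] Q.H_diff_Suc[of n] by (simp add: diff_divide_distrib[symmetric])
    then show ?case using elim U.U_pos[of n] by (simp add: field_simps)
  qed
qed

lemma T_nonneg: "T n \<ge> 0" by (simp add: Q.T_def)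

lemma T_antimono: "m \<le> n \<Longrightarrow> T n \<le> T m"
  unfolding Q.T_def by (intro finite_measure_mono) auto

lemma T_le_H: "T n \<le> H n" using Q.H_diff_Suc[of n] Q.H_nonneg[of "Suc n"] by simp

text \<open>The drift inequality bounds \<open>G (x + r)\<close> by a contraction of \<open>G (x - R)\<close>, so
  the ratio of \<open>G\<close> to \<open>U\<close> can be controlled by induction, uniformly in the buffer size.\<close>

lemma uniform_tail_bound:
  obtains B where "B > 0" "\<And>K n. Q.G K n \<le> B * U n"
proof -
  obtain r a where r: "r \<ge> 1" and a: "a > 0" and a_eq: "a = (\<integral>\<omega>. real (min (C \<omega>) r) \<partial>M) - H 0"
    by (rule exists_truncation)
  obtain c' where c': "c' > 0" "\<And>n. H n \<le> c' * U n" by (rule H_bound) blast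
  \<comment> \<open>Pays for the shift from \<open>x - R\<close> to \<open>x + r\<close>: at most
    \<open>a / 4\<close> on top of \<open>H 0\<close>. With \<open>c' * \<epsilon> = a / 8\<close>,
    \<open>c' \<le> B * a / 4\<close> and \<open>1 + \<delta> \<le> 2\<close> the errors add up to
    \<open>a * B\<close>, which is all the drift allows.\<close>
  define \<delta> where "\<delta> = a / (4 * (H 0 + a))"
  have H0: "H 0 \<ge> 0" by (rule Q.H_nonneg)
  have \<delta>: "\<delta> > 0" "H 0 * \<delta> \<le> a / 4" "\<delta> \<le> 1"
    using a H0 by (auto simp: \<delta>_def field_simps)
  define \<epsilon> where "\<epsilon> = a / (8 * c')"
  have \<epsilon>: "\<epsilon> > 0" using a c' by (simp add: \<epsilon>_def)
  have "\<forall>\<^sub>F R in sequentially. R \<ge> 1 \<and> (\<forall>\<^sub>F n in sequentially. U.mid R n \<le> \<epsilon> * U n)"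
    using U.eventually_mid[OF \<epsilon>] eventually_ge_at_top[of 1] by eventually_elim simp
  then obtain R where R: "R \<ge> 1" "\<forall>\<^sub>F n in sequentially. U.mid R n \<le> \<epsilon> * U n"
    using eventually_happens'[OF sequentially_bot] by blast
  have "\<forall>\<^sub>F n in sequentially. U (n - R) \<le> (1 + \<delta>) * U (n + r)"
  proof -
    have "\<forall>\<^sub>F n in sequentially. U (n - R) \<le> (1 + \<delta>) * U ((n - R) + (R + r))"
      using U.U_add[OF \<delta>(1)] by (rule eventually_compose_filterlim)
        (simp add: filterlim_minus_const_nat_at_top)
    then show ?thesis using eventually_ge_at_top[of R]
      by eventually_elim (simp add: add.assoc[symmetric])
  qed
  with R(2) have "\<forall>\<^sub>F n in sequentially. 2 * R \<le> n \<and> U.mid R n \<le> \<epsilon> * U n \<and> U (n - R) \<le> (1 + \<delta>) * U (n + r)"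
    using eventually_ge_at_top[of "2 * R"] by eventually_elim simp
  then obtain x0 where x0: "\<And>n. n \<ge> x0 \<Longrightarrow> 2 * R \<le> n \<and> U.mid R n \<le> \<epsilon> * U n \<and> U (n - R) \<le> (1 + \<delta>) * U (n + r)"
    by (auto simp: eventually_sequentially)
  \<comment> \<open>The first entry starts the induction, since \<open>G \<le> 1\<close> suffices
    below \<open>x0 + r\<close>; the second makes the direct jumps, of weight \<open>c'\<close>,
    cheap compared with the drift.\<close>
  define B where "B = max (1 / U (x0 + r)) (4 * c' / a)"
  have B: "B > 0" "1 / U (x0 + r) \<le> B" "4 * c' / a \<le> B"
    using U.U_pos by (auto simp: B_def less_max_iff_disj)
  have "Q.G K n \<le> B * U n" for K n
  proof (induction n rule: less_induct)
    case (less n)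
    show ?case
    proof (cases "n < x0 + r")
      case True
      have "1 = (1 / U (x0 + r)) * U (x0 + r)" using U.U_pos[of "x0 + r"] by simp
      also have "\<dots> \<le> B * U n"
        using B True U.U_pos[of "x0 + r"] by (intro mult_mono U.U_antimono) auto
      finally show ?thesis using Q.G_le_1[of K n] by linarith
    next
      case False
      define x where "x = n - r"
      have x: "n = x + r" "x0 \<le> x" using False by (auto simp: x_def)
      have IH: "Q.G K l \<le> B * U l" if "l \<le> x" for l using less[of l] that x r by simp
      note X = x0[OF x(2)]
      \<comment> \<open>Equal cutoffs empty the intermediate band, so its term vanishes.\<close>
      have "(a + H 0) * Q.G K n \<le> H 0 * Q.G K (x - R) + H R * (Q.G K (x - R) - Q.G K (x - R))
        + (\<Sum>l\<le>x - R. p K l * Q.excess (x - l) (K - x))"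
        unfolding x a_eq by (rule Q.drift_inequality) (use R X a a_eq in auto)
      also have "(\<Sum>l\<le>x - R. p K l * Q.excess (x - l) (K - x))
        \<le> (\<Sum>l\<le>x - R. p K l * H (x - l))"
        by (intro sum_mono mult_left_mono Q.p_nonneg Q.excess_le_H)
      also have "\<dots> \<le> H (x - R) + c' * B * U.mid R x"
        by (rule Q.low_levels_le[OF U.subexp_seq_axioms c'(2) Q.H_antimono Q.H_nonneg])
          (use c' IH X in auto)
      also have "H (x - R) \<le> c' * U (x - R)" by (rule c')
      also have "c' * B * U.mid R x \<le> c' * B * (\<epsilon> * U (x - R))"
      proof (intro mult_left_mono)
        have "\<epsilon> * U x \<le> \<epsilon> * U (x - R)" using \<epsilon> by (intro mult_left_mono U.U_antimono) auto
        then show "U.mid R x \<le> \<epsilon> * U (x - R)" using X by linarith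
      qed (use c' B in auto)
      also have "H 0 * Q.G K (x - R) \<le> H 0 * (B * U (x - R))"
        using H0 by (intro mult_left_mono IH) auto
      also have "H 0 * (B * U (x - R)) + H R * (Q.G K (x - R) - Q.G K (x - R)) + (c' * U (x - R) + c' * B * (\<epsilon> * U (x - R)))
        = (H 0 * B + c' + c' * B * \<epsilon>) * U (x - R)" by (simp add: algebra_simps)
      also have "\<dots> \<le> (H 0 * B + c' + c' * B * \<epsilon>) * ((1 + \<delta>) * U n)"
        using X B c' \<epsilon> H0 x by (intro mult_left_mono) auto
      also have "(H 0 * B + c' + c' * B * \<epsilon>) * ((1 + \<delta>) * U n) \<le> (a + H 0) * B * U n"
      proof -
        have e: "c' * \<epsilon> = a / 8" using c' by (simp add: \<epsilon>_def)
        have "c' \<le> B * a / 4" using B(3) a by (simp add: field_simps)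
        moreover have "(c' + B * (a / 8)) * (1 + \<delta>) \<le> (c' + B * (a / 8)) * 2"
          using \<delta> c' B a by (intro mult_left_mono) auto
        moreover have "B * (H 0 * \<delta>) \<le> B * (a / 4)" using \<delta> B by (intro mult_left_mono) auto
        moreover have "H 0 * B * (1 + \<delta>) = H 0 * B + B * (H 0 * \<delta>)" by (simp add: algebra_simps)
        moreover have "(H 0 * B + c' + B * (a / 8)) * (1 + \<delta>) = H 0 * B * (1 + \<delta>) + (c' + B * (a / 8)) * (1 + \<delta>)"
          by (simp add: algebra_simps)
        ultimately have "(H 0 * B + c' + B * (a / 8)) * (1 + \<delta>) \<le> (a + H 0) * B"
          by (simp add: algebra_simps)
        moreover have "c' * B * \<epsilon> = B * (a / 8)" by (simp only: e[symmetric] mult_ac)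
        ultimately have "(H 0 * B + c' + c' * B * \<epsilon>) * (1 + \<delta>) \<le> (a + H 0) * B"
          by (simp only:)
        then show ?thesis using U.U_pos[of n] by (simp only: mult.assoc[symmetric]) (simp add: mult_right_mono)
      qed
      finally show ?thesis using a H0 by (simp add: mult.assoc)
    qed
  qed
  with B(1) show ?thesis by (rule that)
qed

text \<open>Averaging the drift inequality over a long window of levels just below \<open>K\<close>: the
  difference terms telescope, and the truncation of the jumps at \<open>K\<close> turns the
  contribution of low levels into \<open>P(A > \<cdot>)\<close>, which is of smaller order than \<open>U\<close>.\<close>

lemma near_full_negligible:
  assumes \<epsilon>: "\<epsilon> > 0"
  shows "\<forall>\<^sub>F K in sequentially. Q.G K (K - y) \<le> \<epsilon> * U K"
proof -
  obtain r a where r: "r \<ge> 1" and a: "a > 0" and a_eq: "a = (\<integral>\<omega>. real (min (C \<omega>) r) \<partial>M) - H 0"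
    by (rule exists_truncation)
  obtain c' where c': "c' > 0" "\<And>n. H n \<le> c' * U n" by (rule H_bound) blast
  obtain B where B: "B > 0" "\<And>K n. Q.G K n \<le> B * U n" by (rule uniform_tail_bound) blast
  have H0: "H 0 \<ge> 0" by (rule Q.H_nonneg)
  \<comment> \<open>Of the budget \<open>a * \<epsilon> = 4 * \<eta>\<close>, one part goes to the
    levels between \<open>x - R\<close> and \<open>x - R0\<close>, two to the levels up to
    \<open>x - R\<close>, and one to the telescoped differences. The order of choice is
    \<open>R0\<close>, \<open>Y\<close>, \<open>\<delta>'\<close>, \<open>R\<close>: the window
    \<open>Y\<close> grows with \<open>R0\<close>, while \<open>R\<close> depends on
    \<open>Y\<close>, so a single cutoff would be circular.\<close>
  define \<eta> where "\<eta> = a * \<epsilon> / 4"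
  have \<eta>: "\<eta> > 0" using a \<epsilon> by (simp add: \<eta>_def)
  have "\<forall>\<^sub>F n in sequentially. H n < \<eta> / (2 * B) \<and> n \<ge> 1"
    using order_tendstoD(2)[OF Q.H_tendsto_0, of "\<eta> / (2 * B)"] \<eta> B eventually_ge_at_top[of 1]
    by (auto simp: eventually_conj_iff)
  then obtain R0 where R0: "R0 \<ge> 1" "2 * B * H R0 \<le> \<eta>"
    using B by (auto simp: eventually_sequentially field_simps intro: less_imp_le)
  obtain Y0 :: nat where Y0: "H 0 * real (R0 + r) * (2 * B) / \<eta> \<le> real Y0"
    using real_arch_simple by blast
  \<comment> \<open>The window consists of \<open>Y\<close> levels starting \<open>2 * Y\<close>
    below \<open>K\<close>; \<open>Y \<ge> y + r\<close> keeps \<open>x + r\<close> at or below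
    \<open>K - y\<close> for every \<open>x\<close> in it.\<close>
  define Y where "Y = max Y0 (y + r)"
  have Y: "Y \<ge> 1" "Y \<ge> y + r" "H 0 * real (R0 + r) * (2 * B) \<le> \<eta> * real Y"
  proof -
    have "H 0 * real (R0 + r) * (2 * B) / \<eta> \<le> real Y" using Y0 by (simp add: Y_def)
    then show "H 0 * real (R0 + r) * (2 * B) \<le> \<eta> * real Y" using \<eta> by (simp add: field_simps)
  qed (use r in \<open>auto simp: Y_def\<close>)
  define \<delta> where "\<delta> = \<eta> / (4 * real Y)"
  define \<delta>' where "\<delta>' = \<eta> / (4 * real Y * c' * B)"
  have \<delta>: "\<delta> > 0" "\<delta>' > 0" using \<eta> Y B c' by (auto simp: \<delta>_def \<delta>'_def)
  have "\<forall>\<^sub>F R in sequentially. R \<ge> R0 \<and> (\<forall>\<^sub>F n in sequentially. U.mid R n \<le> \<delta>' * U n)"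
    using U.eventually_mid[OF \<delta>(2)] eventually_ge_at_top[of R0] by eventually_elim simp
  then obtain R where R: "R \<ge> R0" "\<forall>\<^sub>F n in sequentially. U.mid R n \<le> \<delta>' * U n"
    using eventually_happens'[OF sequentially_bot] by blast
  have "\<forall>\<^sub>F n in sequentially. U.mid R n \<le> \<delta>' * U n \<and> T n \<le> \<delta> * U n"
    using R(2) T_small[OF \<delta>(1)] by (rule eventually_conj)
  then obtain n0 where n0: "\<And>n. n \<ge> n0 \<Longrightarrow> U.mid R n \<le> \<delta>' * U n" "\<And>n. n \<ge> n0 \<Longrightarrow> T n \<le> \<delta> * U n"
    by (auto simp: eventually_sequentially)
  have "\<forall>\<^sub>F K in sequentially. U (K - (2 * Y + R)) \<le> (1 + 1) * U K" by (rule U.U_diff) simp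
  then show ?thesis using eventually_ge_at_top[of "n0 + 2 * Y + 2 * R"]
  proof eventually_elim
    case (elim K)
    have UK: "U m \<le> 2 * U K" if "m \<ge> K - (2 * Y + R)" for m
      using order_trans[OF U.U_antimono[OF that] elim(1)] by simp
    define q where "q i = Q.G K (K - 2 * Y - R0 + i)" for i
    have step: "a * Q.G K (K - y) \<le> H 0 * (q i - q (i + (R0 + r))) + 3 * \<eta> * U K" if i: "i < Y" for i
    proof -
      define x where "x = K - 2 * Y + i"
      have x: "x \<ge> n0 + R" "x \<ge> 2 * R" "x \<ge> K - 2 * Y" "K - x \<le> 2 * Y" "x + r \<le> K - y" "x \<ge> 1"
        "x - R0 = K - 2 * Y - R0 + i" "x + r = K - 2 * Y - R0 + (i + (R0 + r))"
        using elim i Y R R0 by (auto simp: x_def)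
      have "(a + H 0) * Q.G K (x + r) \<le> H 0 * Q.G K (x - R0) + H R0 * (Q.G K (x - R) - Q.G K (x - R0))
        + (\<Sum>l\<le>x - R. p K l * Q.excess (x - l) (K - x))"
        unfolding a_eq by (rule Q.drift_inequality) (use R R0 x a a_eq in auto)
      also have "(\<Sum>l\<le>x - R. p K l * Q.excess (x - l) (K - x))
        \<le> (\<Sum>l\<le>x - R. p K l * (real (2 * Y) * T (x - l)))"
      proof (intro sum_mono mult_left_mono Q.p_nonneg order_trans[OF Q.excess_le_T] mult_right_mono T_nonneg)
        show "real (K - x) \<le> real (2 * Y)" using x by linarith
      qed
      also have "\<dots> = real (2 * Y) * (\<Sum>l\<le>x - R. p K l * T (x - l))"
        by (simp add: sum_distrib_left mult_ac)
      also have "\<dots> \<le> real (2 * Y) * (T (x - R) + c' * B * U.mid R x)"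
        by (intro mult_left_mono Q.low_levels_le[OF U.subexp_seq_axioms _ T_antimono T_nonneg])
          (use c' B x order_trans[OF T_le_H c'(2)] in auto)
      also have "\<dots> \<le> real (2 * Y) * (\<delta> * (2 * U K) + c' * B * (\<delta>' * (2 * U K)))"
      proof (intro mult_left_mono add_mono)
        have "n0 \<le> x - R" using x(1) by linarith
        then have "T (x - R) \<le> \<delta> * U (x - R)" by (rule n0)
        also have "\<dots> \<le> \<delta> * (2 * U K)" using \<delta> x(3) by (intro mult_left_mono UK) linarith+
        finally show "T (x - R) \<le> \<delta> * (2 * U K)" .
        have "U.mid R x \<le> \<delta>' * U x" using x by (intro n0) auto
        also have "\<dots> \<le> \<delta>' * (2 * U K)" using \<delta> x(3) by (intro mult_left_mono UK) linarith+
        finally show "U.mid R x \<le> \<delta>' * (2 * U K)" .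
      qed (use c' B in auto)
      also have "\<dots> = 2 * \<eta> * U K" using Y c' B by (simp add: \<delta>_def \<delta>'_def field_simps)
      also have "H R0 * (Q.G K (x - R) - Q.G K (x - R0)) \<le> H R0 * (B * (2 * U K))"
      proof (intro mult_left_mono Q.H_nonneg)
        have "Q.G K (x - R) \<le> B * U (x - R)" by (rule B)
        also have "\<dots> \<le> B * (2 * U K)" using B(1) x(3) by (intro mult_left_mono UK) linarith+
        finally show "Q.G K (x - R) - Q.G K (x - R0) \<le> B * (2 * U K)"
          using Q.G_nonneg[of K "x - R0"] by linarith
      qed
      also have "\<dots> = (2 * B * H R0) * U K" by simp
      also have "\<dots> \<le> \<eta> * U K" using R0 U.U_pos[of K] by (intro mult_right_mono) auto
      finally have "a * Q.G K (x + r) \<le> H 0 * (Q.G K (x - R0) - Q.G K (x + r)) + 3 * \<eta> * U K"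
        by (simp add: algebra_simps)
      moreover have "a * Q.G K (K - y) \<le> a * Q.G K (x + r)"
        using a x by (intro mult_left_mono Q.G_antimono) auto
      ultimately show ?thesis using x(7,8) by (simp add: q_def)
    qed
    \<comment> \<open>The left side of \<open>step\<close> does not depend on \<open>i\<close>.
      Summed over the window it gains a factor \<open>Y\<close>, while the differences of
      \<open>q\<close> contribute an amount independent of \<open>Y\<close>.\<close>
    have "real Y * (a * Q.G K (K - y)) = (\<Sum>i<Y. a * Q.G K (K - y))" by simp
    also have "\<dots> \<le> (\<Sum>i<Y. H 0 * (q i - q (i + (R0 + r))) + 3 * \<eta> * U K)"
      by (intro sum_mono step) auto
    also have "\<dots> = H 0 * (\<Sum>i<Y. q i - q (i + (R0 + r))) + real Y * (3 * \<eta> * U K)"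
      by (simp add: sum.distrib sum_distrib_left)
    also have "H 0 * (\<Sum>i<Y. q i - q (i + (R0 + r))) \<le> H 0 * (real (R0 + r) * (B * (2 * U K)))"
    proof (intro mult_left_mono H0)
      have "(\<Sum>i<Y. q i - q (i + (R0 + r))) \<le> real (R0 + r) * q 0"
        by (rule telescope_shift_le) (auto simp: q_def decseq_def intro!: Q.G_antimono Q.G_nonneg)
      also have "q 0 \<le> B * U (K - 2 * Y - R0)" unfolding q_def using B by simp
      also have "\<dots> \<le> B * (2 * U K)" using B(1) R by (intro mult_left_mono UK) linarith+
      finally show "(\<Sum>i<Y. q i - q (i + (R0 + r))) \<le> real (R0 + r) * (B * (2 * U K))"
        by (simp add: mult_left_mono)
    qed
    also have "H 0 * (real (R0 + r) * (B * (2 * U K))) = (H 0 * real (R0 + r) * (2 * B)) * U K" by simp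
    also have "\<dots> \<le> \<eta> * real Y * U K" using Y U.U_pos[of K] by (intro mult_right_mono) auto
    also have "\<eta> * real Y * U K + real Y * (3 * \<eta> * U K) = real Y * (a * (\<epsilon> * U K))"
      by (simp add: \<eta>_def algebra_simps)
    finally show ?case using H0 Y a by simp
  qed
qed

text \<open>The lower bound is free because \<open>H\<close> is decreasing. For the upper bound the
  levels up to \<open>K - R\<close> give \<open>H (K - R)\<close>, asymptotic to \<open>H K\<close>,
  plus a small middle term; the last \<open>R\<close> levels are charged \<open>H 0\<close> each,
  which is affordable because their stationary mass is negligible against
  \<open>U K\<close>.\<close>

theorem loss_asymp: "(\<lambda>K. \<Sum>l\<le>K. p K l * H (K - l)) \<sim>[sequentially] H"
proof -
  obtain c' where c': "c' > 0" "\<And>n. H n \<le> c' * U n" by (rule H_bound) blast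
  obtain B where B: "B > 0" "\<And>K n. Q.G K n \<le> B * U n" by (rule uniform_tail_bound) blast
  have H_pos: "\<forall>\<^sub>F n in sequentially. H n \<ge> c / 2 * U n"
  proof -
    have "\<forall>\<^sub>F n in sequentially. c / 2 < H n / U n"
      by (rule order_tendstoD[OF H_ratio]) (use c_pos in simp)
    then show ?thesis by eventually_elim (use U.U_pos in \<open>simp add: field_simps less_imp_le\<close>)
  qed
  have H_pos': "\<forall>\<^sub>F n in sequentially. H n > 0"
    using H_pos
  proof eventually_elim
    case (elim n)
    have "0 < c / 2 * U n" using c_pos U.U_pos[of n] by simp
    with elim show ?case by linarith
  qed
  have lower: "H K \<le> (\<Sum>l\<le>K. p K l * H (K - l))" for K
  proof -
    have "H K = (\<Sum>l\<le>K. p K l * H K)" by (simp add: sum_distrib_right[symmetric] Q.p_sum)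
    also have "\<dots> \<le> (\<Sum>l\<le>K. p K l * H (K - l))"
      by (intro sum_mono mult_left_mono Q.H_antimono Q.p_nonneg) auto
    finally show ?thesis .
  qed
  have upper: "\<forall>\<^sub>F K in sequentially. (\<Sum>l\<le>K. p K l * H (K - l)) \<le> (1 + \<epsilon>) * H K" if "\<epsilon> > 0" for \<epsilon>
  proof -
    \<comment> \<open>Two errors \<open>\<eta> * U K\<close> must fit into
      \<open>\<epsilon> / 2 * H K\<close>, where only \<open>H K \<ge> c / 2 * U K\<close> is
      available.\<close>
    define \<eta> where "\<eta> = c * \<epsilon> / 8"
    have \<eta>: "\<eta> > 0" using that c_pos by (simp add: \<eta>_def)
    define \<delta> where "\<delta> = \<eta> / (c' * B)"
    have \<delta>: "\<delta> > 0" using \<eta> c' B by (simp add: \<delta>_def)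
    define \<delta>' where "\<delta>' = \<eta> / (H 0 + 1)"
    have \<delta>': "\<delta>' > 0" "H 0 * \<delta>' \<le> \<eta>" using \<eta> Q.H_nonneg[of 0] by (auto simp: \<delta>'_def field_simps)
    have "\<exists>R. \<forall>\<^sub>F n in sequentially. U.mid R n \<le> \<delta> * U n"
      by (rule eventually_happens'[OF sequentially_bot U.eventually_mid[OF \<delta>]])
    then obtain R where R: "\<forall>\<^sub>F n in sequentially. U.mid R n \<le> \<delta> * U n" by blast
    have shift: "\<forall>\<^sub>F K in sequentially. H (K - R) \<le> (1 + \<epsilon> / 2) * H K"
    proof (rule asymp_equiv_upper_bound)
      have "(\<lambda>n. H (n - R)) \<sim>[sequentially] (\<lambda>n. c * U (n - R))"
        by (rule asymp_equiv_compose'[OF H_asymp']) (simp add: filterlim_minus_const_nat_at_top)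
      also have "(\<lambda>n. c * U (n - R)) \<sim>[sequentially] (\<lambda>n. c * U n)"
        by (intro asymp_equiv_intros asymp_equiv_from_above[OF U.U_diff]) (simp_all add: U.U_pos U.U_antimono)
      also have "(\<lambda>n. c * U n) \<sim>[sequentially] H" by (rule asymp_equiv_symI[OF H_asymp'])
      finally show "(\<lambda>n. H (n - R)) \<sim>[sequentially] H" .
    qed (use that H_pos' in auto)
    show ?thesis
      using near_full_negligible[OF \<delta>'(1), of R] R shift H_pos eventually_ge_at_top[of "2 * R"]
    proof eventually_elim
      case (elim K)
      have "{..K} = {..K - R} \<union> {K - R<..K}" by auto
      then have "(\<Sum>l\<le>K. p K l * H (K - l)) = (\<Sum>l\<le>K - R. p K l * H (K - l)) + (\<Sum>l\<in>{K - R<..K}. p K l * H (K - l))"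
        by (simp only:) (rule sum.union_disjoint, auto)
      also have "(\<Sum>l\<le>K - R. p K l * H (K - l)) \<le> H (K - R) + c' * B * U.mid R K"
        by (rule Q.low_levels_le[OF U.subexp_seq_axioms c'(2) Q.H_antimono Q.H_nonneg])
          (use c' B elim in auto)
      also have "c' * B * U.mid R K \<le> c' * B * (\<delta> * U K)"
        using elim c' B by (intro mult_left_mono) auto
      also have "\<dots> = \<eta> * U K" using c' B by (simp add: \<delta>_def)
      also have "(\<Sum>l\<in>{K - R<..K}. p K l * H (K - l)) \<le> (\<Sum>l\<in>{K - R<..K}. p K l * H 0)"
        by (intro sum_mono mult_left_mono Q.H_antimono Q.p_nonneg) auto
      also have "\<dots> = H 0 * Q.G K (K - R)" by (simp add: Q.G_def sum_distrib_left mult_ac)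
      also have "\<dots> \<le> H 0 * (\<delta>' * U K)" using elim Q.H_nonneg by (intro mult_left_mono) auto
      also have "\<dots> \<le> \<eta> * U K"
        using \<delta>' U.U_pos[of K] by (simp only: mult.assoc[symmetric]) (simp add: mult_right_mono less_imp_le)
      also have "H (K - R) \<le> (1 + \<epsilon> / 2) * H K" using elim by simp
      also have "(1 + \<epsilon> / 2) * H K + \<eta> * U K + \<eta> * U K \<le> (1 + \<epsilon>) * H K"
      proof -
        have "2 * \<eta> * U K = \<epsilon> / 2 * (c / 2 * U K)" by (simp add: \<eta>_def)
        also have "\<dots> \<le> \<epsilon> / 2 * H K" using elim that by (intro mult_left_mono) auto
        finally show ?thesis by (simp add: algebra_simps)
      qed
      finally show ?case by simp
    qed
  qed
  show ?thesis by (rule asymp_equiv_from_above[OF upper H_pos' lower])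
qed

end

section \<open>The Poisson equation of a finite irreducible chain\<close>

text \<open>Maximum principle: where a harmonic function attains its maximum, so do all successors,
  and irreducibility carries the maximum to every state.\<close>

lemma irreducible_harmonic_const:
  fixes P :: "nat \<Rightarrow> nat \<Rightarrow> real" and w :: "nat \<Rightarrow> real"
  assumes nonneg: "\<And>i j. 0 \<le> P i j" and stoch: "\<And>i. i < d \<Longrightarrow> (\<Sum>j<d. P i j) = 1"
    and irred: "irreducible_mat d P" and harm: "\<And>i. i < d \<Longrightarrow> w i = (\<Sum>j<d. P i j * w j)"
    and ij: "i < d" "j < d"
  shows "w i = w j"
proof -
  define m where "m = Max (w ` {..<d})"
  have fin: "finite (w ` {..<d})" "w ` {..<d} \<noteq> {}" using ij by auto
  have le: "w k \<le> m" if "k < d" for k unfolding m_def using that by (intro Max_ge) auto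
  obtain i0 where i0: "i0 < d" "w i0 = m" using Max_in[OF fin] by (auto simp: m_def)
  have step: "w l = m" if "k < d" "l < d" "P k l > 0" "w k = m" for k l
  proof -
    have "(\<Sum>j<d. P k j * (m - w j)) = (\<Sum>j<d. P k j) * m - (\<Sum>j<d. P k j * w j)"
      by (simp add: right_diff_distrib sum_subtractf sum_distrib_right)
    also have "\<dots> = 0" using that stoch harm[of k] by simp
    finally have "\<forall>j\<in>{..<d}. P k j * (m - w j) = 0"
      using nonneg le by (subst (asm) sum_nonneg_eq_0_iff) auto
    with that have "P k l * (m - w l) = 0" by blast
    then show ?thesis using that by simp
  qed
  have "w k = m" if "k < d" for k
  proof -
    have "(i0, k) \<in> {(a, b). a < d \<and> b < d \<and> P a b > 0}\<^sup>+"
      using irred that i0 by (auto simp: irreducible_mat_def)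
    then show ?thesis
    proof (induction rule: trancl_induct)
      case (base y)
      then show ?case using step[of i0 y] i0 by blast
    next
      case (step y z)
      then show ?case using \<open>\<And>k l. k < d \<Longrightarrow> l < d \<Longrightarrow> P k l > 0 \<Longrightarrow> w k = m \<Longrightarrow> w l = m\<close>[of y z] by blast
    qed
  qed
  with ij show ?thesis by simp
qed

text \<open>The matrix \<open>I - P\<close> is singular; adding the rank-one matrix with all rows
  \<phi> makes it invertible. Since \<phi> is stationary, \<phi> applied to \<open>B v\<close>
  equals \<phi> applied to \<open>v\<close>. Hence a kernel vector has \<phi>-mean zero, is
  harmonic, therefore constant, therefore zero; and for \<open>f\<close> of mean zero the correction
  vanishes at the solution.\<close>

lemma poisson_equation_solvable:
  fixes P :: "nat \<Rightarrow> nat \<Rightarrow> real" and \<phi> f :: "nat \<Rightarrow> real"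
  assumes nonneg: "\<And>i j. 0 \<le> P i j" and stoch: "\<And>i. i < d \<Longrightarrow> (\<Sum>j<d. P i j) = 1"
    and irred: "irreducible_mat d P"
    and \<phi>: "(\<Sum>i<d. \<phi> i) = 1" "\<And>j. j < d \<Longrightarrow> (\<Sum>i<d. \<phi> i * P i j) = \<phi> j"
    and f: "(\<Sum>i<d. \<phi> i * f i) = 0"
  obtains g where "\<And>i. i < d \<Longrightarrow> g i - (\<Sum>j<d. P i j * g j) = f i"
proof -
  define B where "B = mat d d (\<lambda>(i, j). (if i = j then 1 else 0) - P i j + \<phi> j)"
  have B: "B \<in> carrier_mat d d" by (simp add: B_def)
  have Bv: "(B *\<^sub>v v) $ i = v $ i - (\<Sum>j<d. P i j * v $ j) + (\<Sum>j<d. \<phi> j * v $ j)"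
    if "v \<in> carrier_vec d" "i < d" for v i
  proof -
    have "(B *\<^sub>v v) $ i = (\<Sum>j<d. ((if i = j then 1 else 0) - P i j + \<phi> j) * v $ j)"
      using that by (simp add: B_def scalar_prod_def atLeast0LessThan)
    also have "\<dots> = (\<Sum>j<d. (if i = j then v $ j else 0) - P i j * v $ j + \<phi> j * v $ j)"
      by (intro sum.cong) (auto simp: algebra_simps)
    also have "\<dots> = v $ i - (\<Sum>j<d. P i j * v $ j) + (\<Sum>j<d. \<phi> j * v $ j)"
      using that by (simp add: sum.distrib sum_subtractf)
    finally show ?thesis .
  qed
  have mean: "(\<Sum>i<d. \<phi> i * (B *\<^sub>v v) $ i) = (\<Sum>j<d. \<phi> j * v $ j)" if "v \<in> carrier_vec d" for v
  proof -
    define s where "s = (\<Sum>j<d. \<phi> j * v $ j)"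
    have "(\<Sum>i<d. \<phi> i * (B *\<^sub>v v) $ i) = (\<Sum>i<d. \<phi> i * (v $ i - (\<Sum>j<d. P i j * v $ j) + s))"
      using that by (simp add: Bv s_def)
    also have "\<dots> = (\<Sum>i<d. \<phi> i * v $ i - (\<Sum>j<d. \<phi> i * P i j * v $ j) + \<phi> i * s)"
      by (simp add: distrib_left right_diff_distrib sum_distrib_left mult.assoc)
    also have "\<dots> = s - (\<Sum>i<d. \<Sum>j<d. \<phi> i * P i j * v $ j) + (\<Sum>i<d. \<phi> i) * s"
      by (simp only: sum.distrib sum_subtractf sum_distrib_right s_def)
    also have "(\<Sum>i<d. \<Sum>j<d. \<phi> i * P i j * v $ j) = (\<Sum>j<d. (\<Sum>i<d. \<phi> i * P i j) * v $ j)"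
      by (subst sum.swap) (simp add: sum_distrib_right)
    also have "\<dots> = s" using \<phi> by (simp add: s_def)
    finally show ?thesis using \<phi> by (simp add: s_def)
  qed
  have "det B \<noteq> 0"
  proof
    assume "det B = 0"
    then obtain v where v: "v \<in> carrier_vec d" "v \<noteq> 0\<^sub>v d" "B *\<^sub>v v = 0\<^sub>v d"
      using det_0_iff_vec_prod_zero[OF B] by auto
    have s: "(\<Sum>j<d. \<phi> j * v $ j) = 0" using mean[OF v(1)] v(3) by simp
    have harm: "v $ i = (\<Sum>j<d. P i j * v $ j)" if "i < d" for i
      using Bv[OF v(1) that] v(3) that s by simp
    have "v $ i = 0" if "i < d" for i
    proof -
      have "v $ j = v $ i" if "j < d" for j
        by (rule irreducible_harmonic_const[OF nonneg stoch irred harm that \<open>i < d\<close>])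
      then have "(\<Sum>j<d. \<phi> j * v $ j) = (\<Sum>j<d. \<phi> j * v $ i)" by simp
      then show ?thesis using s \<phi> by (simp add: sum_distrib_right[symmetric])
    qed
    then show False using v by auto
  qed
  then obtain C where C: "C \<in> carrier_mat d d" "B * C = 1\<^sub>m d"
    using det_non_zero_imp_unit[OF B, of "()"] by (auto simp: Units_def ring_mat_def)
  define v where "v = C *\<^sub>v vec d f"
  have v: "v \<in> carrier_vec d" using C by (simp add: v_def)
  have "B *\<^sub>v v = vec d f"
    unfolding v_def using C B by (simp add: assoc_mult_mat_vec[symmetric])
  with mean[OF v] f have "(\<Sum>j<d. \<phi> j * v $ j) = 0" by simp
  then have "v $ i - (\<Sum>j<d. P i j * v $ j) = f i" if "i < d" for i
    using Bv[OF v that] \<open>B *\<^sub>v v = vec d f\<close> that by simp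
  then show ?thesis by (rule that)
qed

section \<open>Batch Markovian arrivals and large deviations\<close>

text \<open>The law of a countably valued variable has its point probabilities as density against
  counting measure. This turns conditioning on the past into sums over atoms.\<close>

lemma nn_integral_discrete_rv:
  fixes Z :: "'a \<Rightarrow> 'b :: countable"
  assumes [measurable]: "Z \<in> M \<rightarrow>\<^sub>M count_space UNIV"
  shows "(\<integral>\<^sup>+\<omega>. f (Z \<omega>) \<partial>M) = (\<integral>\<^sup>+z. f z * emeasure M {\<omega>\<in>space M. Z \<omega> = z} \<partial>count_space UNIV)"
proof -
  have eq: "distr M (count_space UNIV) Z = density (count_space UNIV) (\<lambda>z. emeasure M {\<omega>\<in>space M. Z \<omega> = z})"
    (is "?L = ?R")
  proof (rule measure_eqI)
    fix S assume "S \<in> sets ?L"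
    have "emeasure ?L S = emeasure M (\<Union>z\<in>S. {\<omega>\<in>space M. Z \<omega> = z})"
      by (subst emeasure_distr) (auto intro!: arg_cong[where f = "emeasure M"])
    also have "\<dots> = (\<integral>\<^sup>+z. emeasure M {\<omega>\<in>space M. Z \<omega> = z} \<partial>count_space S)"
      by (rule emeasure_UN_countable) (auto simp: disjoint_family_on_def)
    also have "\<dots> = (\<integral>\<^sup>+z. emeasure M {\<omega>\<in>space M. Z \<omega> = z} * indicator S z \<partial>count_space UNIV)"
      by (rule nn_integral_count_space_indicator) simp
    also have "\<dots> = emeasure ?R S" by (subst emeasure_density) auto
    finally show "emeasure ?L S = emeasure ?R S" .
  qed simp
  have "(\<integral>\<^sup>+\<omega>. f (Z \<omega>) \<partial>M) = (\<integral>\<^sup>+z. f z \<partial>?L)" by (subst nn_integral_distr) auto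
  also have "\<dots> = (\<integral>\<^sup>+z. emeasure M {\<omega>\<in>space M. Z \<omega> = z} * f z \<partial>count_space UNIV)"
    unfolding eq by (subst nn_integral_density) auto
  finally show ?thesis by (simp add: mult.commute)
qed

lemma measurable_count_space_Pair:
  assumes "X \<in> M \<rightarrow>\<^sub>M count_space UNIV" "Y \<in> M \<rightarrow>\<^sub>M count_space UNIV"
  shows "(\<lambda>\<omega>. (X \<omega> :: 'b :: countable, Y \<omega>)) \<in> M \<rightarrow>\<^sub>M count_space UNIV"
  by (rule measurable_compose_countable[OF measurable_compose[OF assms(2) measurable_count_space] assms(1)])

section \<open>Markov property of the arrival process\<close>

locale bmap = prob_space M for M :: "'a measure" +
  fixes d :: nat and \<alpha> :: "nat \<Rightarrow> nat \<Rightarrow> real" and \<Lambda> :: "nat \<Rightarrow> nat \<Rightarrow> nat \<Rightarrow> real"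
    and N J :: "nat \<Rightarrow> 'a \<Rightarrow> nat"
  assumes \<alpha>_nonneg: "0 \<le> \<alpha> k i" and \<alpha>_supp: "d \<le> i \<Longrightarrow> \<alpha> k i = 0"
    and \<alpha>_summable: "summable (\<lambda>k. \<alpha> k i)" and \<alpha>_prob: "(\<Sum>i<d. \<Sum>k. \<alpha> k i) = 1"
    and \<Lambda>_nonneg: "0 \<le> \<Lambda> k i j" and \<Lambda>_supp: "d \<le> i \<or> d \<le> j \<Longrightarrow> \<Lambda> k i j = 0"
    and \<Lambda>_summable: "summable (\<lambda>k. \<Lambda> k i j)"
    and P_stoch: "i < d \<Longrightarrow> (\<Sum>j<d. \<Sum>k. \<Lambda> k i j) = 1"
    and N_meas [measurable]: "N n \<in> M \<rightarrow>\<^sub>M count_space UNIV"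
    and J_meas [measurable]: "J n \<in> M \<rightarrow>\<^sub>M count_space UNIV"
    and BMAP: "measure M {\<omega>\<in>space M. \<forall>i\<le>n. N i \<omega> = ks i \<and> J i \<omega> = js i}
                 = \<alpha> (ks 0) (js 0) * (\<Prod>i\<in>{1..n}. \<Lambda> (ks i) (js (i - 1)) (js i))"
begin

abbreviation "P i j \<equiv> \<Sum>k. \<Lambda> k i j"
abbreviation "mean_batch i \<equiv> \<Sum>j<d. \<Sum>k. real k * \<Lambda> k i j"

lemma N_real_meas [measurable]: "(\<lambda>\<omega>. real (N n \<omega>)) \<in> borel_measurable M"
  by (rule measurable_compose[OF N_meas]) simp

text \<open>Kept as a list because finite lists over a countable type are again countable: the whole
  past is then a discrete variable with atoms of explicit probability.\<close>

definition hist :: "nat \<Rightarrow> 'a \<Rightarrow> (nat \<times> nat) list" where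
  "hist n \<omega> = map (\<lambda>i. (N i \<omega>, J i \<omega>)) [0..<Suc n]"

lemma hist_nth: "i \<le> n \<Longrightarrow> hist n \<omega> ! i = (N i \<omega>, J i \<omega>)"
  by (simp add: hist_def nth_append del: upt_Suc)

lemma length_hist [simp]: "length (hist n \<omega>) = Suc n"
  by (simp add: hist_def)

lemma hist_eq_iff:
  "hist n \<omega> = h \<longleftrightarrow> length h = Suc n \<and> (\<forall>i\<le>n. N i \<omega> = fst (h ! i) \<and> J i \<omega> = snd (h ! i))"
  by (auto simp: list_eq_iff_nth_eq hist_nth less_Suc_eq_le prod_eq_iff)

lemma hist_meas [measurable]: "hist n \<in> M \<rightarrow>\<^sub>M count_space UNIV"
proof (subst measurable_count_space_eq_countable, safe)
  fix h
  have "hist n -` {h} \<inter> space M = {\<omega>\<in>space M. length h = Suc n \<and> (\<forall>i\<in>{..n}. N i \<omega> = fst (h ! i) \<and> J i \<omega> = snd (h ! i))}"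
    by (intro Set.set_eqI)
      (simp only: vimage_def Int_iff mem_Collect_eq singleton_iff hist_eq_iff atMost_iff Ball_def; blast)
  also have "\<dots> \<in> sets M" by measurable
  finally show "hist n -` {h} \<inter> space M \<in> sets M" .
qed auto

text \<open>The product formula for \<open>n + 1\<close> steps is the one for \<open>n\<close> steps
  times a last factor that depends on the past only through the current state. Lists of the wrong
  length are impossible, so both sides are zero for them.\<close>

lemma one_step_prob:
  "emeasure M {\<omega>\<in>space M. (hist n \<omega>, N (Suc n) \<omega>, J (Suc n) \<omega>) = (h, k, j)}
    = emeasure M {\<omega>\<in>space M. hist n \<omega> = h} * ennreal (\<Lambda> k (snd (h ! n)) j)"
proof (cases "length h = Suc n")
  case True
  define ks js where "ks i = (if i \<le> n then fst (h ! i) else k)" and "js i = (if i \<le> n then snd (h ! i) else j)" for i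
  have eq: "{\<omega>\<in>space M. (hist n \<omega>, N (Suc n) \<omega>, J (Suc n) \<omega>) = (h, k, j)}
      = {\<omega>\<in>space M. \<forall>i\<le>Suc n. N i \<omega> = ks i \<and> J i \<omega> = js i}"
    using True by (auto simp: hist_eq_iff ks_def js_def le_Suc_eq)
  have eq': "{\<omega>\<in>space M. hist n \<omega> = h} = {\<omega>\<in>space M. \<forall>i\<le>n. N i \<omega> = ks i \<and> J i \<omega> = js i}"
    using True by (auto simp: hist_eq_iff ks_def js_def)
  have "measure M {\<omega>\<in>space M. \<forall>i\<le>Suc n. N i \<omega> = ks i \<and> J i \<omega> = js i}
     = measure M {\<omega>\<in>space M. \<forall>i\<le>n. N i \<omega> = ks i \<and> J i \<omega> = js i} * \<Lambda> k (snd (h ! n)) j"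
    unfolding BMAP by (simp add: ks_def js_def)
  then show ?thesis unfolding eq eq' by (simp add: emeasure_eq_measure ennreal_mult' \<Lambda>_nonneg)
next
  case False
  then have "{\<omega>\<in>space M. (hist n \<omega>, N (Suc n) \<omega>, J (Suc n) \<omega>) = (h, k, j)} = {}" "{\<omega>\<in>space M. hist n \<omega> = h} = {}"
    by (simp_all add: hist_eq_iff)
  then show ?thesis by (simp only: emeasure_empty mult_zero_left)
qed

text \<open>Conditional expectation of a function of the next batch and state, given the current
  state \<open>i\<close>. With values in \<open>ennreal\<close> it is defined before any summability
  is known.\<close>

definition kernel_nn :: "(nat \<Rightarrow> nat \<Rightarrow> ennreal) \<Rightarrow> nat \<Rightarrow> ennreal" where
  "kernel_nn f i = (\<integral>\<^sup>+(k, j). ennreal (\<Lambda> k i j) * f k j \<partial>count_space UNIV)"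

text \<open>The Markov property in integrated form: the factor \<open>F\<close> of the past stays,
  and the next step is averaged with the kernel of the current state.\<close>

lemma one_step_nn_integral:
  fixes F :: "(nat \<times> nat) list \<Rightarrow> ennreal" and f :: "nat \<Rightarrow> nat \<Rightarrow> nat \<Rightarrow> ennreal"
  shows "(\<integral>\<^sup>+\<omega>. F (hist n \<omega>) * f (J n \<omega>) (N (Suc n) \<omega>) (J (Suc n) \<omega>) \<partial>M)
       = (\<integral>\<^sup>+\<omega>. F (hist n \<omega>) * kernel_nn (f (J n \<omega>)) (J n \<omega>) \<partial>M)"
proof -
  define Z where "Z \<omega> = (hist n \<omega>, N (Suc n) \<omega>, J (Suc n) \<omega>)" for \<omega>
  have Z [measurable]: "Z \<in> M \<rightarrow>\<^sub>M count_space UNIV"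
    unfolding Z_def by (intro measurable_count_space_Pair hist_meas N_meas J_meas)
  define p where "p h = emeasure M {\<omega>\<in>space M. hist n \<omega> = h}" for h
  define \<Phi> where "\<Phi> = (\<lambda>(h, k, j). F h * f (snd (h ! n)) k j)"
  have "(\<integral>\<^sup>+\<omega>. F (hist n \<omega>) * f (J n \<omega>) (N (Suc n) \<omega>) (J (Suc n) \<omega>) \<partial>M) = (\<integral>\<^sup>+\<omega>. \<Phi> (Z \<omega>) \<partial>M)"
    by (simp add: \<Phi>_def Z_def hist_nth)
  also have "\<dots> = (\<integral>\<^sup>+z. \<Phi> z * emeasure M {\<omega>\<in>space M. Z \<omega> = z} \<partial>count_space UNIV)"
    by (rule nn_integral_discrete_rv) simp
  also have "\<dots> = (\<integral>\<^sup>+(h, z). F h * p h * (case z of (k, j) \<Rightarrow> ennreal (\<Lambda> k (snd (h ! n)) j) * f (snd (h ! n)) k j) \<partial>count_space UNIV)"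
    unfolding Z_def by (intro nn_integral_cong) (auto simp: one_step_prob \<Phi>_def p_def mult_ac simp del: prod.inject)
  also have "\<dots> = (\<integral>\<^sup>+h. \<integral>\<^sup>+z. F h * p h * (case z of (k, j) \<Rightarrow> ennreal (\<Lambda> k (snd (h ! n)) j) * f (snd (h ! n)) k j) \<partial>count_space UNIV \<partial>count_space UNIV)"
    by (subst nn_integral_fst_count_space[symmetric]) simp
  also have "\<dots> = (\<integral>\<^sup>+h. F h * kernel_nn (f (snd (h ! n))) (snd (h ! n)) * p h \<partial>count_space UNIV)"
    by (intro nn_integral_cong) (simp add: nn_integral_cmult kernel_nn_def mult_ac)
  also have "\<dots> = (\<integral>\<^sup>+\<omega>. F (hist n \<omega>) * kernel_nn (f (snd (hist n \<omega> ! n))) (snd (hist n \<omega> ! n)) \<partial>M)"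
    unfolding p_def by (rule nn_integral_discrete_rv[symmetric]) simp
  also have "\<dots> = (\<integral>\<^sup>+\<omega>. F (hist n \<omega>) * kernel_nn (f (J n \<omega>)) (J n \<omega>) \<partial>M)"
    by (simp add: hist_nth)
  finally show ?thesis .
qed

lemma one_step_marginal:
  "(\<integral>\<^sup>+\<omega>. f (J n \<omega>) (N (Suc n) \<omega>) (J (Suc n) \<omega>) \<partial>M) = (\<integral>\<^sup>+\<omega>. kernel_nn (f (J n \<omega>)) (J n \<omega>) \<partial>M)"
  using one_step_nn_integral[of "\<lambda>_. 1" n f] by simp

lemma kernel_nn_eq:
  assumes "\<And>k j. 0 \<le> q k j" "\<And>j. summable (\<lambda>k. \<Lambda> k i j * q k j)"
  shows "kernel_nn (\<lambda>k j. ennreal (q k j)) i = ennreal (\<Sum>j<d. \<Sum>k. \<Lambda> k i j * q k j)"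
proof -
  have "kernel_nn (\<lambda>k j. ennreal (q k j)) i = (\<integral>\<^sup>+(k, j). ennreal (\<Lambda> k i j * q k j) \<partial>count_space UNIV)"
    unfolding kernel_nn_def by (intro nn_integral_cong) (auto simp: ennreal_mult assms \<Lambda>_nonneg)
  also have "\<dots> = (\<integral>\<^sup>+j. \<integral>\<^sup>+k. ennreal (\<Lambda> k i j * q k j) \<partial>count_space UNIV \<partial>count_space UNIV)"
    by (subst nn_integral_snd_count_space[symmetric]) simp
  also have "\<dots> = (\<integral>\<^sup>+j. ennreal (\<Sum>k. \<Lambda> k i j * q k j) \<partial>count_space UNIV)"
    by (intro nn_integral_cong) (simp add: nn_integral_count_space_nat suminf_ennreal2 assms \<Lambda>_nonneg)
  also have "\<dots> = (\<Sum>j<d. ennreal (\<Sum>k. \<Lambda> k i j * q k j))"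
    by (rule nn_integral_count_space') (auto simp: \<Lambda>_supp not_less)
  also have "\<dots> = ennreal (\<Sum>j<d. \<Sum>k. \<Lambda> k i j * q k j)"
    by (intro sum_ennreal suminf_nonneg assms mult_nonneg_nonneg \<Lambda>_nonneg)
  finally show ?thesis .
qed

lemma kernel_nn_mono: "(\<And>k j. f k j \<le> g k j) \<Longrightarrow> kernel_nn f i \<le> kernel_nn g i"
  unfolding kernel_nn_def by (intro nn_integral_mono) (auto intro: mult_left_mono)

lemma kernel_nn_outside: "d \<le> i \<Longrightarrow> kernel_nn f i = 0"
  unfolding kernel_nn_def by (simp add: \<Lambda>_supp case_prod_unfold)

lemma initial_prob: "emeasure M {\<omega>\<in>space M. (N 0 \<omega>, J 0 \<omega>) = (k, j)} = ennreal (\<alpha> k j)"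
  using BMAP[of 0 "\<lambda>_. k" "\<lambda>_. j"] by (simp add: emeasure_eq_measure)

lemma initial_nn_integral:
  assumes "\<And>k j. 0 \<le> q k j" "\<And>j. summable (\<lambda>k. \<alpha> k j * q k j)"
  shows "(\<integral>\<^sup>+\<omega>. ennreal (q (N 0 \<omega>) (J 0 \<omega>)) \<partial>M) = ennreal (\<Sum>j<d. \<Sum>k. \<alpha> k j * q k j)"
proof -
  define Z where "Z \<omega> = (N 0 \<omega>, J 0 \<omega>)" for \<omega>
  have Z [measurable]: "Z \<in> M \<rightarrow>\<^sub>M count_space UNIV"
    unfolding Z_def by (intro measurable_count_space_Pair N_meas J_meas)
  have "(\<integral>\<^sup>+\<omega>. ennreal (q (N 0 \<omega>) (J 0 \<omega>)) \<partial>M) = (\<integral>\<^sup>+\<omega>. (\<lambda>(k, j). ennreal (q k j)) (Z \<omega>) \<partial>M)"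
    by (simp add: Z_def)
  also have "\<dots> = (\<integral>\<^sup>+z. (\<lambda>(k, j). ennreal (q k j)) z * emeasure M {\<omega>\<in>space M. Z \<omega> = z} \<partial>count_space UNIV)"
    by (rule nn_integral_discrete_rv) simp
  also have "\<dots> = (\<integral>\<^sup>+(k, j). ennreal (\<alpha> k j * q k j) \<partial>count_space UNIV)"
    unfolding Z_def
    by (intro nn_integral_cong) (auto simp: initial_prob ennreal_mult assms \<alpha>_nonneg mult_ac simp del: prod.inject)
  also have "\<dots> = (\<integral>\<^sup>+j. \<integral>\<^sup>+k. ennreal (\<alpha> k j * q k j) \<partial>count_space UNIV \<partial>count_space UNIV)"
    by (subst nn_integral_snd_count_space[symmetric]) simp
  also have "\<dots> = (\<integral>\<^sup>+j. ennreal (\<Sum>k. \<alpha> k j * q k j) \<partial>count_space UNIV)"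
    by (intro nn_integral_cong) (simp add: nn_integral_count_space_nat suminf_ennreal2 assms \<alpha>_nonneg)
  also have "\<dots> = (\<Sum>j<d. ennreal (\<Sum>k. \<alpha> k j * q k j))"
    by (rule nn_integral_count_space') (auto simp: \<alpha>_supp not_less)
  also have "\<dots> = ennreal (\<Sum>j<d. \<Sum>k. \<alpha> k j * q k j)"
    by (intro sum_ennreal suminf_nonneg assms mult_nonneg_nonneg \<alpha>_nonneg)
  finally show ?thesis .
qed

end

text \<open>After division by \<open>a + b\<close> both summands lie in the unit interval, where
  \<open>t \<le> t powr \<gamma>\<close>.\<close>

lemma powr_subadditive:
  fixes a b \<gamma> :: real
  assumes "0 \<le> a" "0 \<le> b" "0 < \<gamma>" "\<gamma> \<le> 1"
  shows "(a + b) powr \<gamma> \<le> a powr \<gamma> + b powr \<gamma>"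
proof (cases "a + b = 0")
  case False
  then have pos: "a + b > 0" using assms by simp
  have le: "t \<le> t powr \<gamma>" if "0 \<le> t" "t \<le> 1" for t :: real
    using that assms powr_mono'[of \<gamma> 1 t] by (cases "t = 0") auto
  have "1 = a / (a + b) + b / (a + b)" using pos by (simp add: add_divide_distrib[symmetric])
  also have "\<dots> \<le> (a / (a + b)) powr \<gamma> + (b / (a + b)) powr \<gamma>"
    using pos assms by (intro add_mono le) auto
  also have "\<dots> = (a powr \<gamma> + b powr \<gamma>) / (a + b) powr \<gamma>"
    using assms pos by (simp add: powr_divide add_divide_distrib)
  finally show ?thesis using pos by (simp add: field_simps)
qed (use assms in auto)

text \<open>Valid for all \<open>y\<close>, since batches of growing size get tilted; the factor
  \<open>exp \<bar>y\<bar>\<close> is later paid for by half of the decay rate of the batch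
  law.\<close>

lemma exp_quadratic_bound:
  fixes y :: real
  shows "exp y \<le> 1 + y + y\<^sup>2 * exp \<bar>y\<bar>"
proof -
  obtain t where t: "\<bar>t\<bar> \<le> \<bar>y\<bar>" "exp y = (\<Sum>m<2. y ^ m / fact m) + exp t / fact 2 * y ^ 2"
    using Maclaurin_exp_le[of y 2] by blast
  have "exp t / fact 2 * y ^ 2 \<le> exp \<bar>y\<bar> * y\<^sup>2"
  proof (intro mult_right_mono)
    have "exp t / fact 2 \<le> exp t" by simp
    also have "\<dots> \<le> exp \<bar>y\<bar>" using t by simp
    finally show "exp t / fact 2 \<le> exp \<bar>y\<bar>" .
  qed simp
  then show ?thesis unfolding t(2) by (simp add: lessThan_nat_numeral mult.commute)
qed

section \<open>Exponential moments and deviation bounds\<close>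

locale light_bmap = bmap M d \<alpha> \<Lambda> N J
  for M :: "'a measure" and d \<alpha> \<Lambda> N J +
  fixes \<phi> :: "nat \<Rightarrow> real" and c C \<theta> :: real
  assumes \<Lambda>_0: "\<Lambda> 0 i j = 0" and \<alpha>_0: "\<alpha> 0 i = 0"
    and irred: "irreducible_mat d (\<lambda>i j. \<Sum>k. \<Lambda> k i j)"
    and \<phi>_nonneg: "0 \<le> \<phi> i" and \<phi>_sum: "(\<Sum>i<d. \<phi> i) = 1"
    and \<phi>_stat: "j < d \<Longrightarrow> (\<Sum>i<d. \<phi> i * P i j) = \<phi> j"
    and c: "c > 0" and C: "C > 0" and \<theta>: "0 < \<theta>" "\<theta> \<le> 1 / 3"
    and \<Lambda>_tail: "(\<Sum>l. \<Lambda> (k + 1 + l) i j) \<le> C * exp (- c * real k powr (3 * \<theta> / 2))"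
    and \<alpha>_tail: "(\<Sum>l. \<alpha> (k + 1 + l) i) \<le> C * exp (- c * real k powr (3 * \<theta> / 2))"
begin

definition \<gamma> :: real where "\<gamma> = 3 * \<theta> / 2"

lemma \<gamma>: "0 < \<gamma>" "\<gamma> \<le> 1" using \<theta> by (auto simp: \<gamma>_def)

definition lam :: real where "lam = (\<Sum>i<d. \<phi> i * mean_batch i)"

abbreviation "deviation_prob m v \<equiv> prob {\<omega>\<in>space M. \<bar>\<Sum>i<m. real (N i \<omega>) - lam\<bar> > v}"

text \<open>A single term is at most the tail starting with it. That tail is bounded in terms of
  \<open>k - 1\<close>, and subadditivity of the power limits the cost of replacing
  \<open>k - 1\<close> by \<open>k\<close> to the factor \<open>exp c\<close>.\<close>

lemma pointwise_bound:
  assumes "summable a" "\<And>k. 0 \<le> a k" "a 0 = 0"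
    and tail: "\<And>k. (\<Sum>l. a (k + 1 + l)) \<le> C * exp (- c * real k powr \<gamma>)"
  shows "a k \<le> C * exp c * exp (- c * real k powr \<gamma>)"
proof (cases "k = 0")
  case False
  have "summable (\<lambda>l. a (l + (k - 1 + 1)))" using assms(1) by (subst summable_iff_shift)
  then have "a k \<le> (\<Sum>l. a (k - 1 + 1 + l))"
    using sum_le_suminf[of "\<lambda>l. a (k - 1 + 1 + l)" "{0}"] False assms(2) by (simp add: add.commute)
  also have "\<dots> \<le> C * exp (- c * real (k - 1) powr \<gamma>)" by (rule tail)
  also have "\<dots> \<le> C * exp (c + - c * real k powr \<gamma>)"
  proof -
    have "real k powr \<gamma> = (real (k - 1) + 1) powr \<gamma>" using False by simp
    also have "\<dots> \<le> real (k - 1) powr \<gamma> + 1 powr \<gamma>" using \<gamma> by (intro powr_subadditive) auto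
    finally have "c * real k powr \<gamma> \<le> c * (real (k - 1) powr \<gamma> + 1)" using c by simp
    then show ?thesis using C by (simp add: algebra_simps)
  qed
  also have "\<dots> = C * exp c * exp (- c * real k powr \<gamma>)" by (simp only: exp_add mult.assoc)
  finally show ?thesis .
qed (use assms(3) C in simp)

lemma \<Lambda>_bound: "\<Lambda> k i j \<le> C * exp c * exp (- c * real k powr \<gamma>)"
  by (rule pointwise_bound[OF \<Lambda>_summable \<Lambda>_nonneg \<Lambda>_0 \<Lambda>_tail[folded \<gamma>_def]])

lemma \<alpha>_bound: "\<alpha> k i \<le> C * exp c * exp (- c * real k powr \<gamma>)"
  by (rule pointwise_bound[OF \<alpha>_summable \<alpha>_nonneg \<alpha>_0 \<alpha>_tail[folded \<gamma>_def]])

text \<open>Majorant of the second-order Taylor remainder of the tilted step, per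
  \<open>\<sigma>\<^sup>2\<close>. It spends half of the decay
  \<open>exp (- c * k powr \<gamma>)\<close>; the other half keeps it summable.\<close>

definition weight :: "real \<Rightarrow> nat \<Rightarrow> real" where
  "weight L k = (real k + L)\<^sup>2 * (exp L * exp (c / 2 * real k powr \<gamma>))"

lemma summable_weight:
  assumes "\<And>k. 0 \<le> a k" "\<And>k. a k \<le> C * exp c * exp (- c * real k powr \<gamma>)"
  shows "summable (\<lambda>k. a k * weight L k)"
proof -
  have "(\<lambda>k. (real k + L)\<^sup>2 * exp (- (c / 2) * real k powr \<gamma>)) \<in> O(\<lambda>k. 1 / real k ^ 2)"
    using c \<gamma> by real_asymp
  moreover have "summable (\<lambda>k. norm (1 / real k ^ 2))"
    using inverse_power_summable[of 2, where 'a = real] by (simp add: inverse_eq_divide)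
  ultimately have "summable (\<lambda>k. (real k + L)\<^sup>2 * exp (- (c / 2) * real k powr \<gamma>))"
    by (rule summable_comparison_test_bigo[rotated])
  then have s: "summable (\<lambda>k. C * exp c * exp L * ((real k + L)\<^sup>2 * exp (- (c / 2) * real k powr \<gamma>)))"
    by (rule summable_mult)
  show ?thesis
  proof (rule summable_comparison_test'[OF s])
    fix k
    have "norm (a k * weight L k) = a k * weight L k"
      using assms(1)[of k] by (simp add: weight_def)
    also have "\<dots> \<le> C * exp c * exp (- c * real k powr \<gamma>) * weight L k"
      using assms(2) by (intro mult_right_mono) (auto simp: weight_def)
    also have "\<dots> = C * exp c * exp L * ((real k + L)\<^sup>2 * (exp (- c * real k powr \<gamma>) * exp (c / 2 * real k powr \<gamma>)))"
      by (simp add: weight_def mult_ac)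
    also have "exp (- c * real k powr \<gamma>) * exp (c / 2 * real k powr \<gamma>) = exp (- (c / 2) * real k powr \<gamma>)"
      by (simp add: exp_add[symmetric] algebra_simps)
    finally show "norm (a k * weight L k) \<le> C * exp c * exp L * ((real k + L)\<^sup>2 * exp (- (c / 2) * real k powr \<gamma>))" .
  qed
qed

lemma weight_ge:
  assumes "L \<ge> 1"
  shows "(real k + L)\<^sup>2 \<le> weight L k" "real k \<le> weight L k"
proof -
  have "1 * 1 \<le> exp L * exp (c / 2 * real k powr \<gamma>)"
    using assms c by (intro mult_mono) auto
  then have "(real k + L)\<^sup>2 * 1 \<le> weight L k" unfolding weight_def by (intro mult_left_mono) auto
  then show *: "(real k + L)\<^sup>2 \<le> weight L k" by simp
  have "real k * 1 \<le> (real k + L) * (real k + L)" using assms by (intro mult_mono) auto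
  with * show "real k \<le> weight L k" by (simp add: power2_eq_square)
qed

lemma summable_mean:
  assumes "\<And>k. 0 \<le> a k" "\<And>k. a k \<le> C * exp c * exp (- c * real k powr \<gamma>)"
  shows "summable (\<lambda>k. real k * a k)"
proof (rule summable_comparison_test'[OF summable_weight[OF assms, of 1]])
  fix k
  have "real k * a k \<le> weight 1 k * a k" by (intro mult_right_mono weight_ge assms) simp
  then show "norm (real k * a k) \<le> a k * weight 1 k" using assms(1)[of k] by (simp add: mult.commute)
qed

lemma lam_nonneg: "lam \<ge> 0"
  unfolding lam_def
  by (intro sum_nonneg mult_nonneg_nonneg \<phi>_nonneg suminf_nonneg summable_mean \<Lambda>_nonneg \<Lambda>_bound) auto

text \<open>Centring by \<open>lam\<close> gives the right side \<phi>-mean zero, the solvability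
  condition of the Poisson equation. The extension by zero makes \<open>g\<close> bounded on all
  indices.\<close>

lemma exists_potential:
  obtains g where "\<And>i. i < d \<Longrightarrow> g i - (\<Sum>j<d. P i j * g j) = mean_batch i - lam"
    "\<And>i. d \<le> i \<Longrightarrow> g i = 0"
proof -
  have "(\<Sum>i<d. \<phi> i * (mean_batch i - lam)) = 0"
    by (simp add: right_diff_distrib sum_subtractf lam_def[symmetric] sum_distrib_right[symmetric] \<phi>_sum)
  then obtain g where g: "\<And>i. i < d \<Longrightarrow> g i - (\<Sum>j<d. P i j * g j) = mean_batch i - lam"
    using poisson_equation_solvable[of "\<lambda>i j. \<Sum>k. \<Lambda> k i j" d \<phi> "\<lambda>i. mean_batch i - lam",
        OF suminf_nonneg[OF \<Lambda>_summable \<Lambda>_nonneg] P_stoch irred \<phi>_sum \<phi>_stat]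
    by blast
  show ?thesis by (rule that[of "\<lambda>i. if i < d then g i else 0"]) (use g in auto)
qed

text \<open>Exponential weight of one step of the martingale, killed by a batch above
  \<open>T\<close>. The increment of \<open>g\<close> compensates the dependence of the mean batch
  size on the state.\<close>

definition tilt :: "(nat \<Rightarrow> real) \<Rightarrow> real \<Rightarrow> nat \<Rightarrow> nat \<Rightarrow> nat \<Rightarrow> nat \<Rightarrow> real" where
  "tilt g \<sigma> T i k j = exp (\<sigma> * (real k - lam + g j - g i)) * (if k \<le> T then 1 else 0)"

definition weight_sum :: "real \<Rightarrow> real" where
  "weight_sum L = (\<Sum>i<d. \<Sum>j<d. \<Sum>k. \<Lambda> k i j * weight L k)"

lemma weight_sum_nonneg: "weight_sum L \<ge> 0"
  unfolding weight_sum_def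
  by (intro sum_nonneg suminf_nonneg summable_weight \<Lambda>_nonneg \<Lambda>_bound mult_nonneg_nonneg) (auto simp: weight_def)

text \<open>Slot 0 is left out: its batch follows \<open>\<alpha>\<close>, and transitions governed
  by \<open>\<Lambda>\<close> begin with slot 1.\<close>

abbreviation "walk g n \<omega> \<equiv> (\<Sum>i\<in>{1..n}. real (N i \<omega>) - lam) + g (J n \<omega>) - g (J 0 \<omega>)"
abbreviation "bounded_batches T n \<omega> \<equiv> \<forall>i\<in>{1..n}. N i \<omega> \<le> T"

context
  fixes g :: "nat \<Rightarrow> real" and \<Gamma> L \<sigma> :: real and T :: nat
  assumes g: "\<And>i. i < d \<Longrightarrow> g i - (\<Sum>j<d. P i j * g j) = mean_batch i - lam"
    and \<Gamma>: "\<And>i. \<bar>g i\<bar> \<le> \<Gamma>" and L: "L = 1 + lam + 2 * \<Gamma>"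
    and \<sigma>: "\<bar>\<sigma>\<bar> \<le> 1" and T: "\<And>k. k \<le> T \<Longrightarrow> \<bar>\<sigma>\<bar> * real k \<le> c / 2 * real k powr \<gamma>"
begin

text \<open>In the Taylor expansion of the tilt the first-order term integrates to zero, exactly by
  the Poisson equation for \<open>g\<close>. What remains is the quadratic majorant, bounded
  uniformly over the states.\<close>

lemma kernel_tilt_le: "kernel_nn (\<lambda>k j. ennreal (tilt g \<sigma> T i k j)) i \<le> ennreal (1 + \<sigma>\<^sup>2 * weight_sum L)"
proof (cases "i < d")
  case True
  have \<Gamma>0: "\<Gamma> \<ge> 0" using \<Gamma>[of 0] by simp
  then have L1: "L \<ge> 1" using lam_nonneg L by simp
  define q where "q k j = 1 + \<sigma> * (real k - lam + g j - g i) + \<sigma>\<^sup>2 * weight L k" for k j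
  have D: "\<bar>real k - lam + g j - g i\<bar> \<le> real k + L" for k j
    using \<Gamma>[of j] \<Gamma>[of i] lam_nonneg L by linarith
  have sq: "(\<sigma> * (real k - lam + g j - g i))\<^sup>2 \<le> \<sigma>\<^sup>2 * (real k + L)\<^sup>2" for k j
    unfolding power_mult_distrib using D[of k j] by (intro mult_left_mono abs_le_square_iff[THEN iffD1]) auto
  \<comment> \<open>Needed twice: batches above \<open>T\<close> have tilt zero, and the kernel acts
    on nonnegative functions. It comes from \<open>1 + y + y\<^sup>2 > 0\<close>.\<close>
  have q_nonneg: "0 \<le> q k j" for k j
  proof -
    define y where "y = \<sigma> * (real k - lam + g j - g i)"
    have "0 \<le> (y + 1 / 2)\<^sup>2 + 3 / 4" by simp
    also have "\<dots> = 1 + y + y\<^sup>2" by (simp add: power2_eq_square algebra_simps)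
    also have "y\<^sup>2 \<le> \<sigma>\<^sup>2 * weight L k"
      unfolding y_def by (rule order_trans[OF sq mult_left_mono[OF weight_ge(1)[OF L1]]]) simp
    finally show ?thesis by (simp add: q_def y_def)
  qed
  have tilt_le: "tilt g \<sigma> T i k j \<le> q k j" for k j
  proof (cases "k \<le> T")
    case True
    define y where "y = \<sigma> * (real k - lam + g j - g i)"
    have "\<bar>y\<bar> \<le> \<bar>\<sigma>\<bar> * (real k + L)" unfolding y_def abs_mult using D by (intro mult_left_mono) auto
    also have "\<dots> = \<bar>\<sigma>\<bar> * real k + \<bar>\<sigma>\<bar> * L" by (simp add: algebra_simps)
    also have "\<dots> \<le> c / 2 * real k powr \<gamma> + 1 * L"
      using T[OF True] \<sigma> L1 by (intro add_mono mult_right_mono) auto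
    finally have y: "\<bar>y\<bar> \<le> c / 2 * real k powr \<gamma> + 1 * L" .
    have "exp y \<le> 1 + y + y\<^sup>2 * exp \<bar>y\<bar>" by (rule exp_quadratic_bound)
    also have "y\<^sup>2 * exp \<bar>y\<bar> \<le> (\<sigma>\<^sup>2 * (real k + L)\<^sup>2) * exp (c / 2 * real k powr \<gamma> + 1 * L)"
      unfolding y_def by (intro mult_mono sq) (use y in \<open>auto simp: y_def\<close>)
    also have "\<dots> = \<sigma>\<^sup>2 * weight L k" by (simp add: weight_def exp_add mult_ac)
    finally show ?thesis using True by (simp add: tilt_def q_def y_def)
  qed (use q_nonneg in \<open>auto simp: tilt_def\<close>)
  note s1 = \<Lambda>_summable
  note s2 = summable_mean[OF \<Lambda>_nonneg \<Lambda>_bound]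
  note s3 = summable_weight[OF \<Lambda>_nonneg \<Lambda>_bound, where L = L]
  have sums: "(\<lambda>k. \<Lambda> k i j * q k j) sums
     ((1 - \<sigma> * lam + \<sigma> * g j - \<sigma> * g i) * P i j + \<sigma> * (\<Sum>k. real k * \<Lambda> k i j)
      + \<sigma>\<^sup>2 * (\<Sum>k. \<Lambda> k i j * weight L k))" for j
  proof -
    have "(\<lambda>k. (1 - \<sigma> * lam + \<sigma> * g j - \<sigma> * g i) * \<Lambda> k i j + \<sigma> * (real k * \<Lambda> k i j) + \<sigma>\<^sup>2 * (\<Lambda> k i j * weight L k)) sums
     ((1 - \<sigma> * lam + \<sigma> * g j - \<sigma> * g i) * P i j + \<sigma> * (\<Sum>k. real k * \<Lambda> k i j)
      + \<sigma>\<^sup>2 * (\<Sum>k. \<Lambda> k i j * weight L k))"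
      by (intro sums_add sums_mult summable_sums s1 s2 s3)
    moreover have "(\<lambda>k. \<Lambda> k i j * q k j) = (\<lambda>k. (1 - \<sigma> * lam + \<sigma> * g j - \<sigma> * g i) * \<Lambda> k i j + \<sigma> * (real k * \<Lambda> k i j) + \<sigma>\<^sup>2 * (\<Lambda> k i j * weight L k))"
      by (simp add: q_def algebra_simps)
    ultimately show ?thesis by simp
  qed
  have "kernel_nn (\<lambda>k j. ennreal (tilt g \<sigma> T i k j)) i \<le> kernel_nn (\<lambda>k j. ennreal (q k j)) i"
    by (intro kernel_nn_mono ennreal_leI tilt_le)
  also have "\<dots> = ennreal (\<Sum>j<d. \<Sum>k. \<Lambda> k i j * q k j)"
    using q_nonneg sums by (intro kernel_nn_eq) (auto simp: sums_iff)
  also have "(\<Sum>j<d. \<Sum>k. \<Lambda> k i j * q k j) = (\<Sum>j<d. (1 - \<sigma> * lam - \<sigma> * g i) * P i j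
      + \<sigma> * (P i j * g j) + \<sigma> * (\<Sum>k. real k * \<Lambda> k i j) + \<sigma>\<^sup>2 * (\<Sum>k. \<Lambda> k i j * weight L k))"
    using sums by (intro sum.cong refl) (simp add: sums_iff algebra_simps)
  also have "\<dots> = (1 - \<sigma> * lam - \<sigma> * g i) * (\<Sum>j<d. \<Sum>k. \<Lambda> k i j)
      + \<sigma> * (\<Sum>j<d. P i j * g j) + \<sigma> * mean_batch i
      + \<sigma>\<^sup>2 * (\<Sum>j<d. \<Sum>k. \<Lambda> k i j * weight L k)"
    by (simp add: sum.distrib sum_distrib_left)
  also have "\<dots> = 1 + \<sigma> * (mean_batch i - lam - (g i - (\<Sum>j<d. P i j * g j)))
      + \<sigma>\<^sup>2 * (\<Sum>j<d. \<Sum>k. \<Lambda> k i j * weight L k)"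
    using P_stoch[OF True] by (simp add: algebra_simps)
  also have "\<dots> = 1 + \<sigma>\<^sup>2 * (\<Sum>j<d. \<Sum>k. \<Lambda> k i j * weight L k)" using g[OF True] by simp
  also have "\<dots> \<le> 1 + \<sigma>\<^sup>2 * weight_sum L"
  proof (intro add_left_mono mult_left_mono)
    have "0 \<le> (\<Sum>j<d. \<Sum>k. \<Lambda> k i' j * weight L k)" for i'
      by (intro sum_nonneg suminf_nonneg s3 mult_nonneg_nonneg \<Lambda>_nonneg) (simp add: weight_def)
    then show "(\<Sum>j<d. \<Sum>k. \<Lambda> k i j * weight L k) \<le> weight_sum L"
      unfolding weight_sum_def using True by (intro member_le_sum[of i "{..<d}"]) auto
  qed simp
  finally show ?thesis by (simp add: ennreal_leI)
qed (simp add: kernel_nn_outside)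

text \<open>The tilt and the indicator of bounded batches both factorise over slots, so each further
  slot multiplies the bound by the one-step estimate. The restriction to bounded batches matters
  because a stretched exponential tail need not have exponential moments.\<close>

lemma truncated_exponential_moment:
  "(\<integral>\<^sup>+\<omega>. ennreal (exp (\<sigma> * walk g n \<omega>)
           * (if bounded_batches T n \<omega> then 1 else 0)) \<partial>M) \<le> ennreal ((1 + \<sigma>\<^sup>2 * weight_sum L) ^ n)"
proof (induction n)
  case 0
  then show ?case by (simp add: emeasure_space_1)
next
  case (Suc n)
  define F where "F h = ennreal (exp (\<sigma> * ((\<Sum>i\<in>{1..n}. real (fst (h ! i)) - lam) + g (snd (h ! n)) - g (snd (h ! 0))))
           * (if \<forall>i\<in>{1..n}. fst (h ! i) \<le> T then 1 else 0))" for h :: "(nat \<times> nat) list"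
  have F: "F (hist n \<omega>) = ennreal (exp (\<sigma> * walk g n \<omega>)
           * (if bounded_batches T n \<omega> then 1 else 0))" for \<omega>
    by (simp add: F_def hist_nth)
  have split: "ennreal (exp (\<sigma> * walk g (Suc n) \<omega>)
           * (if bounded_batches T (Suc n) \<omega> then 1 else 0))
      = F (hist n \<omega>) * ennreal (tilt g \<sigma> T (J n \<omega>) (N (Suc n) \<omega>) (J (Suc n) \<omega>))" for \<omega>
  proof -
    have "bounded_batches T (Suc n) \<omega> \<longleftrightarrow> bounded_batches T n \<omega> \<and> N (Suc n) \<omega> \<le> T"
      by (auto simp: le_Suc_eq)
    then show ?thesis unfolding F tilt_def
      by (subst ennreal_mult[symmetric]) (auto simp: exp_add[symmetric] algebra_simps)
  qed
  have "(\<integral>\<^sup>+\<omega>. ennreal (exp (\<sigma> * walk g (Suc n) \<omega>)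
           * (if bounded_batches T (Suc n) \<omega> then 1 else 0)) \<partial>M)
     = (\<integral>\<^sup>+\<omega>. F (hist n \<omega>) * kernel_nn (\<lambda>k j. ennreal (tilt g \<sigma> T (J n \<omega>) k j)) (J n \<omega>) \<partial>M)"
    unfolding split by (rule one_step_nn_integral)
  also have "\<dots> \<le> (\<integral>\<^sup>+\<omega>. F (hist n \<omega>) * ennreal (1 + \<sigma>\<^sup>2 * weight_sum L) \<partial>M)"
    by (intro nn_integral_mono mult_left_mono kernel_tilt_le) auto
  also have "\<dots> = (\<integral>\<^sup>+\<omega>. F (hist n \<omega>) \<partial>M) * ennreal (1 + \<sigma>\<^sup>2 * weight_sum L)"
    by (rule nn_integral_multc) (rule measurable_compose[OF hist_meas], simp)
  also have "\<dots> \<le> ennreal ((1 + \<sigma>\<^sup>2 * weight_sum L) ^ n) * ennreal (1 + \<sigma>\<^sup>2 * weight_sum L)"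
    using Suc.IH unfolding F by (rule mult_right_mono) simp
  also have "\<dots> = ennreal ((1 + \<sigma>\<^sup>2 * weight_sum L) ^ Suc n)"
    using weight_sum_nonneg[of L] by (subst ennreal_mult[symmetric]) (auto simp: mult.commute)
  finally show ?case .
qed

lemma chernoff_truncated:
  "prob {\<omega>\<in>space M. bounded_batches T n \<omega> \<and>
      v \<le> \<sigma> * walk g n \<omega>}
    \<le> exp (- v + \<sigma>\<^sup>2 * weight_sum L * real n)"
proof -
  define Z where "Z \<omega> = exp (\<sigma> * walk g n \<omega>)
           * (if bounded_batches T n \<omega> then 1 else 0)" for \<omega>
  let ?S = "{\<omega>\<in>space M. bounded_batches T n \<omega> \<and>
      v \<le> \<sigma> * walk g n \<omega>}"
  have [measurable]: "(\<lambda>\<omega>. g (J i \<omega>)) \<in> borel_measurable M" for i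
    by (rule measurable_compose[OF J_meas]) simp
  have S: "?S \<in> sets M" by measurable
  have Z: "Z \<in> borel_measurable M" unfolding Z_def by measurable
  have "emeasure M ?S = (\<integral>\<^sup>+\<omega>. indicator ?S \<omega> \<partial>M)" using S by simp
  also have "\<dots> \<le> (\<integral>\<^sup>+\<omega>. ennreal (exp (- v)) * ennreal (Z \<omega>) \<partial>M)"
  proof (intro nn_integral_mono)
    fix \<omega>
    have "1 \<le> exp (- v) * Z \<omega>" if "\<omega> \<in> ?S"
      using that by (simp add: Z_def exp_add[symmetric])
    then show "indicator ?S \<omega> \<le> ennreal (exp (- v)) * ennreal (Z \<omega>)"
      by (cases "\<omega> \<in> ?S") (auto simp: ennreal_mult[symmetric] Z_def simp del: mem_Collect_eq intro: order_trans[OF _ ennreal_leI, of 1 1])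
  qed
  also have "\<dots> = ennreal (exp (- v)) * (\<integral>\<^sup>+\<omega>. ennreal (Z \<omega>) \<partial>M)"
    using Z by (intro nn_integral_cmult) measurable
  also have "\<dots> \<le> ennreal (exp (- v)) * ennreal ((1 + \<sigma>\<^sup>2 * weight_sum L) ^ n)"
    unfolding Z_def by (intro mult_left_mono truncated_exponential_moment) auto
  also have "\<dots> = ennreal (exp (- v) * (1 + \<sigma>\<^sup>2 * weight_sum L) ^ n)"
    using weight_sum_nonneg[of L] by (subst ennreal_mult[symmetric]) auto
  also have "\<dots> \<le> ennreal (exp (- v) * exp (\<sigma>\<^sup>2 * weight_sum L * real n))"
  proof (intro ennreal_leI mult_left_mono)
    have "(1 + \<sigma>\<^sup>2 * weight_sum L) ^ n \<le> exp (\<sigma>\<^sup>2 * weight_sum L) ^ n"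
      using weight_sum_nonneg[of L] by (intro power_mono exp_ge_add_one_self) auto
    then show "(1 + \<sigma>\<^sup>2 * weight_sum L) ^ n \<le> exp (\<sigma>\<^sup>2 * weight_sum L * real n)"
      by (simp add: exp_of_nat2_mult)
  qed simp
  finally show ?thesis by (simp add: emeasure_eq_measure exp_add[symmetric])
qed

end

text \<open>The bound holds given any previous state, hence uniformly in \<open>n\<close>; the
  factor \<open>d\<close> counts the possible new states.\<close>

lemma N_tail: "prob {\<omega>\<in>space M. N n \<omega> > T} \<le> real d * C * exp (- c * real T powr \<gamma>)"
proof -
  have shift: "(\<Sum>k. a k * (if k > T then 1 else 0)) = (\<Sum>l. a (T + 1 + l))" "summable (\<lambda>k. a k * (if k > T then 1 else 0))"
    if "summable a" for a :: "nat \<Rightarrow> real"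
  proof -
    have "summable (\<lambda>k. a (k + (T + 1)))" using that by (subst summable_iff_shift)
    then have "(\<lambda>k. (a (k + (T + 1)) * (if k + (T + 1) > T then 1 else 0))) sums (\<Sum>k. a (k + (T + 1)))"
      by (simp add: summable_sums)
    then have "(\<lambda>k. a k * (if k > T then 1 else 0)) sums (\<Sum>k. a (k + (T + 1)))"
      using sums_iff_shift'[of "\<lambda>k. a k * (if k > T then 1 else 0)" "T + 1"] by simp
    then show "(\<Sum>k. a k * (if k > T then 1 else 0)) = (\<Sum>l. a (T + 1 + l))" "summable (\<lambda>k. a k * (if k > T then 1 else 0))"
      by (simp_all add: sums_iff add.commute)
  qed
  have bound: "(\<Sum>j<d. b j) \<le> real d * C * exp (- c * real T powr \<gamma>)"
    if "\<And>j. b j \<le> C * exp (- c * real T powr \<gamma>)" for b :: "nat \<Rightarrow> real"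
    using sum_bounded_above[of "{..<d}" b, OF that] by simp
  have "emeasure M {\<omega>\<in>space M. N n \<omega> > T} = (\<integral>\<^sup>+\<omega>. ennreal (if N n \<omega> > T then 1 else 0) \<partial>M)"
  proof -
    have "(\<integral>\<^sup>+\<omega>. ennreal (if N n \<omega> > T then 1 else 0) \<partial>M) = (\<integral>\<^sup>+\<omega>. indicator {\<omega>\<in>space M. N n \<omega> > T} \<omega> \<partial>M)"
      by (intro nn_integral_cong) (auto simp: indicator_def)
    then show ?thesis by simp
  qed
  also have "\<dots> \<le> ennreal (real d * C * exp (- c * real T powr \<gamma>))"
  proof (cases n)
    case 0
    have "(\<integral>\<^sup>+\<omega>. ennreal ((\<lambda>k j. if k > T then 1 else 0) (N 0 \<omega>) (J 0 \<omega>)) \<partial>M)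
      = ennreal (\<Sum>j<d. \<Sum>k. \<alpha> k j * (if k > T then 1 else 0))"
      by (rule initial_nn_integral) (auto intro: shift(2) \<alpha>_summable)
    also have "\<dots> \<le> ennreal (real d * C * exp (- c * real T powr \<gamma>))"
      using \<alpha>_tail by (intro ennreal_leI bound) (simp add: shift(1) \<alpha>_summable \<gamma>_def)
    finally show ?thesis using 0 by simp
  next
    case (Suc m)
    have K: "kernel_nn (\<lambda>k j. ennreal (if k > T then 1 else 0)) i \<le> ennreal (real d * C * exp (- c * real T powr \<gamma>))" for i
    proof -
      have "kernel_nn (\<lambda>k j. ennreal (if k > T then 1 else 0)) i = ennreal (\<Sum>j<d. \<Sum>k. \<Lambda> k i j * (if k > T then 1 else 0))"
        by (rule kernel_nn_eq) (auto intro: shift(2) \<Lambda>_summable)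
      also have "\<dots> \<le> ennreal (real d * C * exp (- c * real T powr \<gamma>))"
        using \<Lambda>_tail by (intro ennreal_leI bound) (simp add: shift(1) \<Lambda>_summable \<gamma>_def)
      finally show ?thesis .
    qed
    have "(\<integral>\<^sup>+\<omega>. ennreal (if N n \<omega> > T then 1 else 0) \<partial>M)
      = (\<integral>\<^sup>+\<omega>. kernel_nn (\<lambda>k j. ennreal (if k > T then 1 else 0)) (J m \<omega>) \<partial>M)"
      using one_step_marginal[of "\<lambda>i k j. ennreal (if k > T then 1 else 0)" m] by (simp add: Suc)
    also have "\<dots> \<le> (\<integral>\<^sup>+\<omega>. ennreal (real d * C * exp (- c * real T powr \<gamma>)) \<partial>M)"
      using K by (intro nn_integral_mono) simp
    also have "\<dots> = ennreal (real d * C * exp (- c * real T powr \<gamma>))" by (simp add: emeasure_space_1)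
    finally show ?thesis .
  qed
  finally show ?thesis using C by (simp add: emeasure_eq_measure)
qed

text \<open>Either some batch exceeds the truncation level \<open>T\<close>, close to
  \<open>w\<close>, or the tilts \<open>s\<close> and \<open>- s\<close> bound the two directions of
  the truncated walk. The first case is a union bound over the slots, which explains the prefactor
  \<open>real m\<close>.\<close>

lemma large_deviation:
  obtains \<kappa> \<eta> K where "\<kappa> > 0" "\<eta> > 0" "K > 0"
    "\<And>m. m \<ge> 1 \<Longrightarrow> deviation_prob m (\<kappa> * real m powr (1 - \<theta>))
       \<le> K * real m * exp (- \<eta> * real m powr \<theta>)"
proof -
  obtain g where g: "\<And>i. i < d \<Longrightarrow> g i - (\<Sum>j<d. P i j * g j) = mean_batch i - lam"
    and g0: "\<And>i. d \<le> i \<Longrightarrow> g i = 0"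
    by (rule exists_potential) blast
  define \<Gamma> where "\<Gamma> = (\<Sum>i<d. \<bar>g i\<bar>)"
  have \<Gamma>: "\<bar>g i\<bar> \<le> \<Gamma>" for i
  proof (cases "i < d")
    case True
    then show ?thesis unfolding \<Gamma>_def by (intro member_le_sum) auto
  qed (auto simp: g0 \<Gamma>_def intro!: sum_nonneg)
  have \<Gamma>0: "\<Gamma> \<ge> 0" using \<Gamma>[of 0] by simp
  define L where "L = 1 + lam + 2 * \<Gamma>"
  define W where "W = weight_sum L"
  have W: "W \<ge> 0" unfolding W_def by (rule weight_sum_nonneg)
  define \<eta> where "\<eta> = min 1 (c / 2)"
  have \<eta>: "\<eta> > 0" "\<eta> \<le> 1" "\<eta> \<le> c / 2" using c by (auto simp: \<eta>_def)
  \<comment> \<open>\<open>1 + W\<close> is the deviation demanded of the walk; the rest, multiplied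
    by \<open>w \<ge> 1\<close>, covers slot 0 (a batch of at most \<open>w\<close> and its centring
    by \<open>lam\<close>) and the oscillation \<open>2 * \<Gamma>\<close> of
    \<open>g\<close>.\<close>
  define \<kappa> where "\<kappa> = 2 + W + 2 * lam + 2 * \<Gamma>"
  define K where "K = real d * C * exp c + 2"
  have "deviation_prob m (\<kappa> * real m powr (1 - \<theta>))
       \<le> K * real m * exp (- \<eta> * real m powr \<theta>)" if m: "m \<ge> 1" for m
  proof -
    define x where "x = real m"
    have x: "x \<ge> 1" using m by (simp add: x_def)
    define w where "w = x powr (1 - \<theta>)"
    have w: "w \<ge> 1" using x \<theta> by (simp add: w_def ge_one_powr_ge_zero)
    define T where "T = nat \<lfloor>w\<rfloor>"
    have T: "real T \<le> w" "w \<le> real T + 1" using w by (auto simp: T_def)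
    \<comment> \<open>Determined by the target: tilt times deviation, \<open>s * w\<close>, has to
      equal \<open>\<eta> * x powr \<theta>\<close>.\<close>
    define s where "s = \<eta> * x powr (2 * \<theta> - 1)"
    have "x powr (2 * \<theta> - 1) \<le> x powr 0" using x \<theta> by (intro powr_mono) auto
    then have s: "s > 0" "s \<le> 1" using \<eta> x by (auto simp: s_def intro: mult_le_one)
    have s_w: "s * w = \<eta> * x powr \<theta>"
      by (simp add: s_def w_def powr_add[symmetric])
    have s_T: "s * real k \<le> c / 2 * real k powr \<gamma>" if "k \<le> T" for k
    proof (cases "k = 0")
      case False
      have "real k = real k powr \<gamma> * real k powr (1 - \<gamma>)" using False by (simp add: powr_add[symmetric])
      also have "\<dots> \<le> real k powr \<gamma> * w powr (1 - \<gamma>)"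
        using \<gamma> that T by (intro mult_left_mono powr_mono2) auto
      also have "w powr (1 - \<gamma>) = x powr ((1 - \<theta>) * (1 - \<gamma>))" by (simp add: w_def powr_powr)
      finally have "s * real k \<le> s * (real k powr \<gamma> * x powr ((1 - \<theta>) * (1 - \<gamma>)))"
        using s by (intro mult_left_mono) auto
      also have "\<dots> = \<eta> * x powr (2 * \<theta> - 1 + (1 - \<theta>) * (1 - \<gamma>)) * real k powr \<gamma>"
        by (simp add: s_def powr_add mult_ac)
      also have "\<dots> \<le> c / 2 * 1 * real k powr \<gamma>"
      proof (intro mult_right_mono mult_mono)
        \<comment> \<open>This exponent is nonpositive precisely for
          \<open>\<theta> \<le> 1 / 3\<close>. It makes the tilt admissible for every batch up to
          \<open>T\<close>.\<close>
        have "2 * \<theta> - 1 + (1 - \<theta>) * (1 - \<gamma>) = - (\<theta> / 2) * (1 - 3 * \<theta>)"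
          by (simp add: \<gamma>_def field_simps)
        also have "\<dots> \<le> 0" using \<theta> by (simp add: mult_nonpos_nonneg)
        finally have "x powr (2 * \<theta> - 1 + (1 - \<theta>) * (1 - \<gamma>)) \<le> x powr 0"
          using x by (intro powr_mono) auto
        then show "x powr (2 * \<theta> - 1 + (1 - \<theta>) * (1 - \<gamma>)) \<le> 1" using x by simp
      qed (use \<eta> c in auto)
      finally show ?thesis by simp
    qed (use c in simp)
    have s2x: "s\<^sup>2 * x \<le> \<eta> * x powr \<theta>"
    proof -
      have "s\<^sup>2 * x = \<eta>\<^sup>2 * (x powr (2 * \<theta> - 1) * x powr (2 * \<theta> - 1) * x powr 1)"
        using x by (simp add: s_def power2_eq_square)
      also have "\<dots> = \<eta>\<^sup>2 * x powr (4 * \<theta> - 1)" by (simp only: powr_add[symmetric]) simp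
      also have "\<dots> \<le> \<eta> * x powr \<theta>"
        using \<eta> x \<theta> by (intro mult_mono powr_mono) (auto simp: power2_eq_square mult_left_le)
      finally show ?thesis .
    qed
    define n where "n = m - 1"
    define X where "X \<omega> = walk g n \<omega>" for \<omega>
    \<comment> \<open>The quadratic term costs at most \<open>W\<close> times
      \<open>\<eta> * x powr \<theta>\<close>; the level gains \<open>1 + W\<close> times as much,
      so one copy is left in the exponent.\<close>
    define v where "v = s * ((1 + W) * w)"
    define E where "E \<sigma> = {\<omega>\<in>space M. bounded_batches T n \<omega> \<and> v \<le> \<sigma> * X \<omega>}" for \<sigma>
    have [measurable]: "(\<lambda>\<omega>. g (J i \<omega>)) \<in> borel_measurable M" for i
      by (rule measurable_compose[OF J_meas]) simp
    have E_sets: "E \<sigma> \<in> sets M" for \<sigma> unfolding E_def X_def by measurable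
    have E_prob: "prob (E \<sigma>) \<le> exp (- \<eta> * x powr \<theta>)" if "\<bar>\<sigma>\<bar> = s" for \<sigma>
    proof -
      have "prob (E \<sigma>) \<le> exp (- v + \<sigma>\<^sup>2 * W * real n)"
        unfolding E_def X_def W_def using that s s_T
        by (intro chernoff_truncated[OF g \<Gamma> L_def]) auto
      also have "\<dots> \<le> exp (- \<eta> * x powr \<theta>)"
      proof -
        have "\<sigma>\<^sup>2 = s\<^sup>2" using that by (metis power2_abs)
        then have "\<sigma>\<^sup>2 * W * real n \<le> s\<^sup>2 * W * x"
          using W m by (intro mult_mono) (auto simp: n_def x_def)
        also have "\<dots> \<le> W * (\<eta> * x powr \<theta>)"
          using mult_left_mono[OF s2x W] by (simp add: mult_ac)
        moreover have "v = (1 + W) * (\<eta> * x powr \<theta>)" unfolding v_def s_w[symmetric] by (simp add: mult_ac)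
        ultimately show ?thesis by (simp add: algebra_simps)
      qed
      finally show ?thesis .
    qed
    define G where "G i = {\<omega>\<in>space M. N i \<omega> > T}" for i
    have G_sets: "G i \<in> sets M" for i unfolding G_def by measurable
    have G_prob: "prob (G i) \<le> real d * C * exp c * exp (- \<eta> * x powr \<theta>)" for i
    proof -
      have "x powr \<theta> \<le> x powr ((1 - \<theta>) * \<gamma>)"
      proof (intro powr_mono x)
        have "\<theta> * 1 \<le> \<theta> * ((1 - \<theta>) * (3 / 2))" using \<theta> by (intro mult_left_mono) auto
        then show "\<theta> \<le> (1 - \<theta>) * \<gamma>" by (simp add: \<gamma>_def mult_ac)
      qed
      also have "\<dots> = w powr \<gamma>" by (simp add: w_def powr_powr)
      also have "\<dots> \<le> (real T + 1) powr \<gamma>" using T w \<gamma> by (intro powr_mono2) auto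
      also have "\<dots> \<le> real T powr \<gamma> + 1 powr \<gamma>" using \<gamma> by (intro powr_subadditive) auto
      finally have "c * (x powr \<theta>) \<le> c * (real T powr \<gamma> + 1)" using c by simp
      moreover have "\<eta> * (x powr \<theta>) \<le> c * (x powr \<theta>)" using \<eta> c by (intro mult_right_mono) auto
      ultimately have "exp (- c * real T powr \<gamma>) \<le> exp (c + - \<eta> * x powr \<theta>)"
        by (simp add: algebra_simps)
      then have "real d * C * exp (- c * real T powr \<gamma>) \<le> real d * C * exp (c + - \<eta> * x powr \<theta>)"
        using C by (intro mult_left_mono) auto
      also have "\<dots> = real d * C * exp c * exp (- \<eta> * x powr \<theta>)" by (simp only: exp_add mult.assoc)
      finally show ?thesis using N_tail[of T i] unfolding G_def by linarith
    qed
    have sub: "{\<omega>\<in>space M. \<bar>\<Sum>i<m. real (N i \<omega>) - lam\<bar> > \<kappa> * real m powr (1 - \<theta>)}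
      \<subseteq> (\<Union>i<m. G i) \<union> (E s \<union> E (- s))"
    proof
      fix \<omega> assume "\<omega> \<in> {\<omega>\<in>space M. \<bar>\<Sum>i<m. real (N i \<omega>) - lam\<bar> > \<kappa> * real m powr (1 - \<theta>)}"
      then have \<omega>: "\<omega> \<in> space M" and dev: "\<bar>\<Sum>i<m. real (N i \<omega>) - lam\<bar> > \<kappa> * w" by (auto simp: w_def x_def)
      show "\<omega> \<in> (\<Union>i<m. G i) \<union> (E s \<union> E (- s))"
      proof (cases "\<exists>i<m. N i \<omega> > T")
        case False
        then have NT: "N i \<omega> \<le> T" if "i < m" for i using that by force
        have "{..<m} = insert 0 {1..n}" using m by (auto simp: n_def)
        then have "(\<Sum>i<m. real (N i \<omega>) - lam) = (real (N 0 \<omega>) - lam) + (X \<omega> - g (J n \<omega>) + g (J 0 \<omega>))"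
          by (simp add: X_def)
        moreover have "real (N 0 \<omega>) \<le> w" using NT[of 0] m T by simp
        moreover have "lam \<le> lam * w" "\<Gamma> \<le> \<Gamma> * w"
          using w lam_nonneg \<Gamma>0 by (auto simp: mult_le_cancel_left1)
        moreover have "\<kappa> * w = 2 * w + W * w + 2 * (lam * w) + 2 * (\<Gamma> * w)" by (simp add: \<kappa>_def algebra_simps)
        moreover have "\<bar>g (J n \<omega>)\<bar> \<le> \<Gamma>" "\<bar>g (J 0 \<omega>)\<bar> \<le> \<Gamma>" by (rule \<Gamma>)+
        moreover have "(1 + W) * w = w + W * w" by (simp add: algebra_simps)
        ultimately have "\<bar>X \<omega>\<bar> \<ge> (1 + W) * w" using dev lam_nonneg w by linarith
        then have "v \<le> s * \<bar>X \<omega>\<bar>" unfolding v_def using s by (intro mult_left_mono) auto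
        then have "v \<le> s * X \<omega> \<or> v \<le> - s * X \<omega>" by (auto simp: abs_if split: if_splits)
        then show ?thesis using \<omega> NT m by (auto simp: E_def n_def)
      qed (use \<omega> in \<open>auto simp: G_def\<close>)
    qed
    have "deviation_prob m (\<kappa> * real m powr (1 - \<theta>))
      \<le> prob ((\<Union>i<m. G i) \<union> (E s \<union> E (- s)))"
      using sub G_sets E_sets by (intro finite_measure_mono) auto
    also have "\<dots> \<le> prob (\<Union>i<m. G i) + prob (E s \<union> E (- s))"
      using G_sets E_sets by (intro measure_Un_le) auto
    also have "prob (\<Union>i<m. G i) \<le> (\<Sum>i<m. prob (G i))"
      using G_sets by (intro finite_measure_subadditive_finite) auto
    also have "\<dots> \<le> (\<Sum>i<m. real d * C * exp c * exp (- \<eta> * x powr \<theta>))"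
      by (intro sum_mono G_prob)
    also have "\<dots> = real m * (real d * C * exp c * exp (- \<eta> * x powr \<theta>))" by simp
    also have "prob (E s \<union> E (- s)) \<le> prob (E s) + prob (E (- s))"
      using E_sets by (intro measure_Un_le) auto
    also have "\<dots> \<le> exp (- \<eta> * x powr \<theta>) + exp (- \<eta> * x powr \<theta>)"
      using s by (intro add_mono E_prob) auto
    also have "\<dots> \<le> real m * (exp (- \<eta> * x powr \<theta>) + exp (- \<eta> * x powr \<theta>))"
      using m by (simp add: mult_le_cancel_right1)
    also have "real m * (real d * C * exp c * exp (- \<eta> * x powr \<theta>)) + real m * (exp (- \<eta> * x powr \<theta>) + exp (- \<eta> * x powr \<theta>))
      = K * real m * exp (- \<eta> * real m powr \<theta>)" by (simp add: K_def x_def algebra_simps)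
    finally show ?thesis by simp
  qed
  moreover have "\<kappa> > 0" "K > 0" using W lam_nonneg \<Gamma>0 C by (auto simp: \<kappa>_def K_def intro: add_nonneg_pos)
  ultimately show ?thesis using \<eta>(1) that by blast
qed

end

section \<open>Tails of the total on-period input\<close>

lemma tail_measurable:
  fixes D :: "real measure"
  assumes D: "prob_space D" "sets D = sets borel"
  shows "(\<lambda>y. measure D {y<..}) \<in> borel_measurable borel"
proof -
  interpret D: prob_space D by fact
  have "measure D {y<..} \<le> measure D {x<..}" if "x \<le> y" for x y
    using that D(2) by (intro D.finite_measure_mono) auto
  then have "mono (\<lambda>y. - measure D {y<..})" by (auto simp: mono_def)
  then have "(\<lambda>y. - (- measure D {y<..})) \<in> borel_measurable borel"
    by (intro borel_measurable_uminus borel_measurable_mono)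
  then show ?thesis by simp
qed

text \<open>The equilibrium density is a nonincreasing tail divided by the mean, so on an interval
  it lies between its endpoint values. This relates increments of the equilibrium law to the plain
  tail.\<close>

lemma equilibrium_interval:
  assumes D: "prob_space D" "sets D = sets borel" and E: "prob_space (equilibrium D)"
    and m: "(\<integral>x. x \<partial>D) > 0" and ab: "0 \<le> a" "a \<le> b"
  shows "measure D {b<..} * (b - a) / (\<integral>x. x \<partial>D) \<le> measure (equilibrium D) {a<..b}"
    and "measure (equilibrium D) {a<..b} \<le> measure D {a<..} * (b - a) / (\<integral>x. x \<partial>D)"
proof -
  interpret D: prob_space D by fact
  interpret E: prob_space "equilibrium D" by fact
  define m where "m = (\<integral>x. x \<partial>D)"
  have m0: "m > 0" using m by (simp add: m_def)
  have anti: "measure D {y<..} \<le> measure D {x<..}" if "x \<le> y" for x y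
    using that D(2) by (intro D.finite_measure_mono) auto
  note [measurable] = tail_measurable[OF D]
  have eq: "emeasure (equilibrium D) {a<..b}
     = (\<integral>\<^sup>+y. ennreal (indicator {0..} y * measure D {y<..} / m) * indicator {a<..b} y \<partial>lborel)"
    unfolding equilibrium_def m_def[symmetric] by (subst emeasure_density) auto
  have "\<dots> \<le> (\<integral>\<^sup>+y. ennreal (measure D {a<..} / m) * indicator {a<..b} y \<partial>lborel)"
    using m0 anti ab
    by (intro nn_integral_mono) (auto simp: indicator_def intro!: ennreal_leI divide_right_mono)
  also have "\<dots> = ennreal (measure D {a<..} * (b - a) / m)"
    using ab m0 by (simp add: nn_integral_cmult_indicator ennreal_mult[symmetric])
  finally show "measure (equilibrium D) {a<..b} \<le> measure D {a<..} * (b - a) / (\<integral>x. x \<partial>D)"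
    unfolding eq[symmetric] E.emeasure_eq_measure m_def[symmetric] using ab m0 by simp
  have "ennreal (measure D {b<..} * (b - a) / m) = (\<integral>\<^sup>+y. ennreal (measure D {b<..} / m) * indicator {a<..b} y \<partial>lborel)"
    using ab m0 by (simp add: nn_integral_cmult_indicator ennreal_mult[symmetric])
  also have "\<dots> \<le> (\<integral>\<^sup>+y. ennreal (indicator {0..} y * measure D {y<..} / m) * indicator {a<..b} y \<partial>lborel)"
    using m0 anti ab
    by (intro nn_integral_mono) (auto simp: indicator_def intro!: ennreal_leI divide_right_mono)
  finally show "measure D {b<..} * (b - a) / (\<integral>x. x \<partial>D) \<le> measure (equilibrium D) {a<..b}"
    unfolding eq[symmetric] E.emeasure_eq_measure m_def[symmetric] by simp
qed

text \<open>From \<open>n0\<close> on, \<open>g - f\<close> is nonincreasing with limit 0, hence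
  nonnegative. It lifts comparisons of plain tails to integrated tails without summing
  series.\<close>

lemma telescoping_compare:
  fixes f g :: "nat \<Rightarrow> real"
  assumes "f \<longlonglongrightarrow> 0" "g \<longlonglongrightarrow> 0" and le: "\<And>n. n \<ge> n0 \<Longrightarrow> f n - f (Suc n) \<le> g n - g (Suc n)"
    and n: "n \<ge> n0"
  shows "f n \<le> g n"
proof -
  have "decseq (\<lambda>k. g (k + n) - f (k + n))"
    by (rule decseq_SucI) (use le n in \<open>simp add: algebra_simps\<close>)
  moreover have "(\<lambda>k. g (k + n) - f (k + n)) \<longlonglongrightarrow> 0 - 0"
    using assms(1,2) by (intro tendsto_diff LIMSEQ_ignore_initial_segment)
  ultimately have "0 \<le> g (0 + n) - f (0 + n)" using decseq_ge by fastforce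
  then show ?thesis by simp
qed

text \<open>A unit shift eventually multiplies a long-tailed function by more than
  \<open>exp (- \<epsilon>)\<close>, because the ratio tends to 1; iteration bounds the decay by any
  exponential rate. The extra \<open>exp (- \<epsilon>)\<close> in the constant pays for rounding
  \<open>t - t0\<close> up.\<close>

lemma long_tailed_exp_lower:
  assumes G: "long_tailed G" and anti: "\<And>x y. x \<le> y \<Longrightarrow> G y \<le> G x" and \<epsilon>: "\<epsilon> > 0"
  obtains c where "c > 0" "\<forall>\<^sub>F t in at_top. c * exp (- \<epsilon> * t) \<le> G t"
proof -
  have pos: "G x > 0" for x using G by (simp add: long_tailed_def)
  have "((\<lambda>x. G (x + 1) / G x) \<longlongrightarrow> 1) at_top"
    by (rule asymp_equivD_strong) (use G pos in \<open>auto simp: long_tailed_def less_imp_neq[symmetric]\<close>)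
  then have "\<forall>\<^sub>F x in at_top. exp (- \<epsilon>) < G (x + 1) / G x"
    by (rule order_tendstoD) (use \<epsilon> in simp)
  then obtain t0 where t0: "\<And>x. x \<ge> t0 \<Longrightarrow> exp (- \<epsilon>) < G (x + 1) / G x"
    by (auto simp: eventually_at_top_linorder)
  have step: "exp (- \<epsilon>) * G x \<le> G (x + 1)" if "x \<ge> t0" for x
    using t0[OF that] pos[of x] by (simp add: field_simps)
  have iter: "exp (- \<epsilon> * real n) * G t0 \<le> G (t0 + real n)" for n
  proof (induction n)
    case (Suc n)
    have "exp (- \<epsilon> * real (Suc n)) * G t0 = exp (- \<epsilon>) * (exp (- \<epsilon> * real n) * G t0)"
      by (simp add: exp_add[symmetric] algebra_simps)
    also have "\<dots> \<le> exp (- \<epsilon>) * G (t0 + real n)" using Suc by simp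
    also have "\<dots> \<le> G (t0 + real n + 1)" by (rule step) simp
    finally show ?case by (simp add: algebra_simps)
  qed simp
  show ?thesis
  proof (rule that[of "exp (- \<epsilon>) * exp (\<epsilon> * t0) * G t0"])
    show "exp (- \<epsilon>) * exp (\<epsilon> * t0) * G t0 > 0" using pos by simp
    show "\<forall>\<^sub>F t in at_top. exp (- \<epsilon>) * exp (\<epsilon> * t0) * G t0 * exp (- \<epsilon> * t) \<le> G t"
      using eventually_ge_at_top[of t0]
    proof eventually_elim
      case (elim t)
      define n where "n = nat \<lceil>t - t0\<rceil>"
      have n: "t \<le> t0 + real n" "real n \<le> t - t0 + 1" using elim by (auto simp: n_def) linarith+
      have "exp (- \<epsilon>) * exp (\<epsilon> * t0) * G t0 * exp (- \<epsilon> * t) = exp (- \<epsilon> * (t - t0 + 1)) * G t0"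
      proof -
        have "- \<epsilon> * (t - t0 + 1) = - \<epsilon> + \<epsilon> * t0 + - \<epsilon> * t" by (simp add: algebra_simps)
        then show ?thesis by (simp only: exp_add) (simp add: mult_ac)
      qed
      also have "\<dots> \<le> exp (- \<epsilon> * real n) * G t0"
        using n \<epsilon> pos[of t0] by (intro mult_right_mono) auto
      also have "\<dots> \<le> G (t0 + real n)" by (rule iter)
      also have "\<dots> \<le> G t" using n by (intro anti)
      finally show ?case .
    qed
  qed
qed

lemma long_tailed_shift:
  assumes G: "long_tailed G" and k: "k > 0" and e: "e > 0"
  shows "\<forall>\<^sub>F t in at_top. G (t - k) \<le> (1 + e) * G t" "\<forall>\<^sub>F t in at_top. (1 - e) * G t \<le> G (t + k)"
proof -
  have pos: "G x > 0" for x using G by (simp add: long_tailed_def)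
  have lim: "((\<lambda>x. G (x + k) / G x) \<longlongrightarrow> 1) at_top"
    by (rule asymp_equivD_strong) (use G pos k in \<open>auto simp: long_tailed_def less_imp_neq[symmetric]\<close>)
  have "\<forall>\<^sub>F x in at_top. 1 - e < G (x + k) / G x"
    by (rule order_tendstoD[OF lim]) (use e in simp)
  then show "\<forall>\<^sub>F t in at_top. (1 - e) * G t \<le> G (t + k)"
    by eventually_elim (use pos in \<open>simp add: pos_less_divide_eq less_imp_le\<close>)
  have "\<forall>\<^sub>F x in at_top. 1 / (1 + e) < G (x + k) / G x"
    by (rule order_tendstoD[OF lim]) (use e in simp)
  then have "\<forall>\<^sub>F x in at_top. G x \<le> (1 + e) * G (x + k)"
    by eventually_elim (use pos e in \<open>simp add: field_simps less_imp_le\<close>)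
  moreover have "filterlim (\<lambda>t::real. t - k) at_top at_top" by real_asymp
  ultimately have "\<forall>\<^sub>F t in at_top. G (t - k) \<le> (1 + e) * G (t - k + k)"
    by (rule eventually_compose_filterlim)
  then show "\<forall>\<^sub>F t in at_top. G (t - k) \<le> (1 + e) * G t" by simp
qed

lemma powr_sublinear:
  assumes "k > 0" "0 < (\<theta>::real)"
  shows "\<forall>\<^sub>F z in at_top. k * z powr (1 - \<theta>) \<le> z / 2"
proof -
  have "((\<lambda>z. k * z powr (- \<theta>)) \<longlongrightarrow> k * 0) at_top"
    using assms by (intro tendsto_intros tendsto_neg_powr filterlim_ident) auto
  then have "\<forall>\<^sub>F z in at_top. k * z powr (- \<theta>) < 1 / 2"
    by (rule order_tendstoD) simp
  then show ?thesis using eventually_gt_at_top[of 0]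
  proof eventually_elim
    case (elim z)
    have "k * z powr (1 - \<theta>) = k * z powr (- \<theta>) * z"
      using elim powr_add[of z "- \<theta>" 1] by (simp add: add.commute)
    also have "\<dots> \<le> 1 / 2 * z" using elim by (intro mult_right_mono) auto
    finally show ?case by simp
  qed
qed

text \<open>In the variable \<open>z powr \<theta>\<close> a shift of \<open>z\<close> by
  \<open>k * z powr (1 - \<theta>)\<close> is a shift by at most \<open>k\<close>. Both parts come
  from comparing \<open>u powr \<theta>\<close> with \<open>u\<close> above and below 1.\<close>

lemma powr_shift_bounds:
  fixes z k \<theta> :: real
  assumes z: "z \<ge> 1" and \<theta>: "0 < \<theta>" "\<theta> \<le> 1" and k: "k \<ge> 0"
  shows "(z + k * z powr (1 - \<theta>)) powr \<theta> \<le> z powr \<theta> + k"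
    and "k \<le> z powr \<theta> \<Longrightarrow> z powr \<theta> - k \<le> (z - k * z powr (1 - \<theta>)) powr \<theta>"
proof -
  have e: "z powr (1 - \<theta>) = z * z powr (- \<theta>)" using z by (simp add: powr_diff powr_minus field_simps)
  have inv: "z powr \<theta> * z powr (- \<theta>) = 1" using z by (simp add: powr_add[symmetric])
  have "(z + k * z powr (1 - \<theta>)) powr \<theta> = z powr \<theta> * (1 + k * z powr (- \<theta>)) powr \<theta>"
    using z k by (subst powr_mult[symmetric]) (auto simp: e algebra_simps)
  also have "\<dots> \<le> z powr \<theta> * (1 + k * z powr (- \<theta>)) powr 1"
    using \<theta> k by (intro mult_left_mono powr_mono) auto
  also have "\<dots> = z powr \<theta> + k * (z powr \<theta> * z powr (- \<theta>))"
    using k by (simp add: algebra_simps add_nonneg_nonneg)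
  finally show "(z + k * z powr (1 - \<theta>)) powr \<theta> \<le> z powr \<theta> + k" by (simp add: inv)
  assume kz: "k \<le> z powr \<theta>"
  then have "k * z powr (- \<theta>) \<le> z powr \<theta> * z powr (- \<theta>)" by (intro mult_right_mono) auto
  then have u: "0 \<le> 1 - k * z powr (- \<theta>)" "1 - k * z powr (- \<theta>) \<le> 1" using inv k by auto
  have "z powr \<theta> - k = z powr \<theta> * (1 - k * z powr (- \<theta>)) powr 1"
    using inv u by (simp add: algebra_simps)
  also have "\<dots> \<le> z powr \<theta> * (1 - k * z powr (- \<theta>)) powr \<theta>"
    using \<theta> u by (intro mult_left_mono powr_mono') auto
  also have "\<dots> = (z - k * z powr (1 - \<theta>)) powr \<theta>"
    using z u by (subst powr_mult[symmetric]) (auto simp: e algebra_simps)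
  finally show "z powr \<theta> - k \<le> (z - k * z powr (1 - \<theta>)) powr \<theta>" .
qed

section \<open>From the on-period tail to the arrival tail\<close>

locale onoff = light_bmap M d \<alpha> \<Lambda> N J \<phi> c C \<theta>
  for M :: "'a measure" and d \<alpha> \<Lambda> N J \<phi> c C \<theta> +
  fixes Ion :: "'a \<Rightarrow> nat"
  assumes Ion_meas [measurable]: "Ion \<in> M \<rightarrow>\<^sub>M count_space UNIV"
    and Ion_pos: "\<omega> \<in> space M \<Longrightarrow> 1 \<le> Ion \<omega>"
    and lam_gt: "lam > 1"
    and Ion_long_tailed: "in_L_pow M (1 / \<theta>) (\<lambda>\<omega>. real (Ion \<omega>))"
begin

definition A :: "'a \<Rightarrow> nat" where "A = onA N Ion"
definition \<mu> :: real where "\<mu> = lam - 1"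
definition W :: "real \<Rightarrow> real" where "W z = prob {\<omega>\<in>space M. real (Ion \<omega>) > z}"
text \<open>Tail of the on-period on the scale \<open>z powr \<theta>\<close>, on which condition
  (i) is ordinary long-tailedness.\<close>

definition G :: "real \<Rightarrow> real" where "G t = prob {\<omega>\<in>space M. real (Ion \<omega>) powr \<theta> > t}"

abbreviation "tail_A n \<equiv> prob {\<omega>\<in>space M. A \<omega> > n}"

lemma \<mu>: "\<mu> > 0" using lam_gt by (simp add: \<mu>_def)

lemma A_meas [measurable]: "A \<in> M \<rightarrow>\<^sub>M count_space UNIV"
proof -
  have "(\<lambda>\<omega>. \<Sum>n<m. N n \<omega> - 1) \<in> M \<rightarrow>\<^sub>M count_space UNIV" for m
  proof (induction m)
    case (Suc m)
    have "(\<lambda>\<omega>. (\<lambda>s. s + (N m \<omega> - 1)) (\<Sum>n<m. N n \<omega> - 1)) \<in> M \<rightarrow>\<^sub>M count_space UNIV"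
      by (rule measurable_compose_countable[OF _ Suc]) (rule measurable_compose[OF N_meas], simp)
    then show ?case by simp
  qed simp
  then have "(\<lambda>\<omega>. (\<lambda>m \<omega>. \<Sum>n<m. N n \<omega> - 1) (Ion \<omega>) \<omega>) \<in> M \<rightarrow>\<^sub>M count_space UNIV"
    by (rule measurable_compose_countable) (rule Ion_meas)
  then show ?thesis by (simp add: A_def onA_def[abs_def])
qed

text \<open>Almost surely no slot of the BMAP is empty, so the truncated subtraction
  \<open>N n \<omega> - 1\<close> agrees with the real one and partial sums become centred sums plus
  drift.\<close>

lemma N_pos: "AE \<omega> in M. \<forall>n. N n \<omega> \<ge> 1"
proof (subst AE_all_countable, rule allI)
  fix n
  have "(\<integral>\<^sup>+\<omega>. ennreal (if N n \<omega> = 0 then 1 else 0) \<partial>M) = 0"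
  proof (cases n)
    case 0
    have z: "(\<lambda>k. \<alpha> k j * (if k = 0 then 1 else 0)) = (\<lambda>k. 0)" for j using \<alpha>_0 by auto
    have "(\<integral>\<^sup>+\<omega>. ennreal ((\<lambda>k j. if k = 0 then 1 else 0) (N 0 \<omega>) (J 0 \<omega>)) \<partial>M)
      = ennreal (\<Sum>j<d. \<Sum>k. \<alpha> k j * (if k = 0 then 1 else 0))"
      by (rule initial_nn_integral) (auto simp only: z intro: summable_zero split: if_splits)
    then show ?thesis using 0 by (simp only: z) simp
  next
    case (Suc m)
    have K: "kernel_nn (\<lambda>k j. ennreal (if k = 0 then 1 else 0)) i = 0" for i
    proof -
      have "(\<lambda>(k, j). ennreal (\<Lambda> k i j) * ennreal (if k = 0 then 1 else 0)) = (\<lambda>_. 0)"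
        using \<Lambda>_0 by (auto simp: fun_eq_iff)
      then show ?thesis unfolding kernel_nn_def by (simp only:) simp
    qed
    have "(\<integral>\<^sup>+\<omega>. ennreal (if N n \<omega> = 0 then 1 else 0) \<partial>M)
      = (\<integral>\<^sup>+\<omega>. kernel_nn (\<lambda>k j. ennreal (if k = 0 then 1 else 0)) (J m \<omega>) \<partial>M)"
      using one_step_marginal[of "\<lambda>i k j. ennreal (if k = 0 then 1 else 0)" m] by (simp add: Suc)
    also have "\<dots> = 0" unfolding K by simp
    finally show ?thesis .
  qed
  then have "AE \<omega> in M. ennreal (if N n \<omega> = 0 then 1 else 0) = 0"
    by (subst (asm) nn_integral_0_iff_AE) auto
  then show "AE \<omega> in M. N n \<omega> \<ge> 1" by eventually_elim (auto split: if_splits)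
qed

lemma real_partial_sum:
  assumes "\<forall>n. N n \<omega> \<ge> 1"
  shows "real (\<Sum>i<m. N i \<omega> - 1) = (\<Sum>i<m. real (N i \<omega>) - lam) + \<mu> * real m"
  using assms by (simp add: of_nat_diff \<mu>_def sum_subtractf algebra_simps)

lemma G_long_tailed: "long_tailed G"
  using Ion_long_tailed \<theta> by (simp add: in_L_pow_def G_def[abs_def])

lemma G_antimono: "x \<le> y \<Longrightarrow> G y \<le> G x"
  unfolding G_def by (intro finite_measure_mono) auto

lemma W_eq_G: "z \<ge> 0 \<Longrightarrow> W z = G (z powr \<theta>)"
proof -
  assume z: "z \<ge> 0"
  have "z < real k \<longleftrightarrow> z powr \<theta> < real k powr \<theta>" for k
  proof
    show "z < real k \<Longrightarrow> z powr \<theta> < real k powr \<theta>" using z \<theta> by (intro powr_less_mono2) auto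
    show "z powr \<theta> < real k powr \<theta> \<Longrightarrow> z < real k"
      using powr_mono2[of \<theta> "real k" z] \<theta> by (meson less_le_not_le linorder_not_le of_nat_0_le_iff order.strict_implies_order)
  qed
  then show ?thesis unfolding W_def G_def by (simp only:)
qed

text \<open>Stopping the arrivals at a deterministic slot \<open>m\<close> sandwiches the on-period total,
  because every slot of an on-period adds a nonnegative amount.\<close>

lemma prob_A_upper:
  assumes \<kappa>: "\<mu> * real m + v \<le> real n"
  shows "tail_A n \<le> W (real m) + deviation_prob m v"
proof -
  have "tail_A n \<le> prob ({\<omega>\<in>space M. real (Ion \<omega>) > real m} \<union> {\<omega>\<in>space M. \<bar>\<Sum>i<m. real (N i \<omega>) - lam\<bar> > v})"
  proof (intro finite_measure_mono_AE)
    show "AE \<omega> in M. \<omega> \<in> {\<omega>\<in>space M. A \<omega> > n} \<longrightarrow>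
        \<omega> \<in> {\<omega>\<in>space M. real (Ion \<omega>) > real m} \<union> {\<omega>\<in>space M. \<bar>\<Sum>i<m. real (N i \<omega>) - lam\<bar> > v}"
      using N_pos
    proof eventually_elim
      case (elim \<omega>)
      have "\<bar>\<Sum>i<m. real (N i \<omega>) - lam\<bar> > v" if "n < A \<omega>" "\<not> m < Ion \<omega>"
      proof -
        have "A \<omega> \<le> (\<Sum>i<m. N i \<omega> - 1)"
          unfolding A_def onA_def using that by (intro sum_mono2) auto
        then have "real n < real (\<Sum>i<m. N i \<omega> - 1)" using that by linarith
        then show ?thesis unfolding real_partial_sum[OF elim] using \<kappa> by linarith
      qed
      then show ?case by auto
    qed
  qed measurable
  also have "\<dots> \<le> W (real m) + deviation_prob m v"
    unfolding W_def by (intro measure_Un_le) measurable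
  finally show ?thesis .
qed

lemma prob_A_lower:
  assumes \<kappa>: "real n < \<mu> * real m - v"
  shows "W (real m) \<le> tail_A n + deviation_prob m v"
proof -
  have "W (real m) \<le> prob ({\<omega>\<in>space M. A \<omega> > n} \<union> {\<omega>\<in>space M. \<bar>\<Sum>i<m. real (N i \<omega>) - lam\<bar> > v})"
    unfolding W_def
  proof (intro finite_measure_mono_AE)
    show "AE \<omega> in M. \<omega> \<in> {\<omega>\<in>space M. real (Ion \<omega>) > real m} \<longrightarrow>
        \<omega> \<in> {\<omega>\<in>space M. A \<omega> > n} \<union> {\<omega>\<in>space M. \<bar>\<Sum>i<m. real (N i \<omega>) - lam\<bar> > v}"
      using N_pos
    proof eventually_elim
      case (elim \<omega>)
      have "\<bar>\<Sum>i<m. real (N i \<omega>) - lam\<bar> > v" if "\<not> n < A \<omega>" "m < Ion \<omega>"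
      proof -
        have "(\<Sum>i<m. N i \<omega> - 1) \<le> A \<omega>"
          unfolding A_def onA_def using that by (intro sum_mono2) auto
        then have "real (\<Sum>i<m. N i \<omega> - 1) \<le> real n" using that by linarith
        then show ?thesis unfolding real_partial_sum[OF elim] using \<kappa> by linarith
      qed
      then show ?case by auto
    qed
  qed measurable
  also have "\<dots> \<le> tail_A n + deviation_prob m v"
    by (intro measure_Un_le) measurable
  finally show ?thesis .
qed

text \<open>The deviation bound in the variable \<open>t = m powr \<theta>\<close>, so that
  \<open>m\<close> reads \<open>t powr (1 / \<theta>)\<close>. Half of the rate beats the polynomial
  factor, the other half beats the decay of the long-tailed \<open>G\<close>.\<close>

lemma deviation_negligible:
  assumes "\<eta> > 0" "K > 0" "e > 0"
  shows "\<forall>\<^sub>F t in at_top. K * t powr (1 / \<theta>) * exp (- \<eta> * t) \<le> e * G t"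
proof -
  obtain c where c: "c > 0" "\<forall>\<^sub>F t in at_top. c * exp (- (\<eta> / 2) * t) \<le> G t"
    using long_tailed_exp_lower[OF G_long_tailed G_antimono, of "\<eta> / 2"] assms by auto
  have "((\<lambda>t. K * t powr (1 / \<theta>) * exp (- (\<eta> / 2) * t)) \<longlongrightarrow> 0) at_top"
    using assms(1) \<theta>(1) by real_asymp
  then have "\<forall>\<^sub>F t in at_top. K * t powr (1 / \<theta>) * exp (- (\<eta> / 2) * t) < e * c"
    by (rule order_tendstoD) (use assms c in simp)
  with c(2) show ?thesis
  proof eventually_elim
    case (elim t)
    have "K * t powr (1 / \<theta>) * exp (- \<eta> * t) = (K * t powr (1 / \<theta>) * exp (- (\<eta> / 2) * t)) * exp (- (\<eta> / 2) * t)"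
      by (simp add: exp_add[symmetric])
    also have "\<dots> \<le> (e * c) * exp (- (\<eta> / 2) * t)" using elim by (intro mult_right_mono) auto
    also have "\<dots> = e * (c * exp (- (\<eta> / 2) * t))" by simp
    also have "\<dots> \<le> e * G t" using elim assms by (intro mult_left_mono) auto
    finally show ?case .
  qed
qed

text \<open>The stopping slot \<open>m\<close> is moved away from \<open>n / \<mu>\<close> just far
  enough for the drift to absorb the typical deviation. On the scale of \<open>G\<close> this
  displacement is a bounded shift, which long-tailedness ignores.\<close>

lemma tail_A_bounds:
  assumes e: "e > 0"
  shows "\<forall>\<^sub>F n in sequentially. tail_A n \<le> (1 + e) * W (real n / \<mu>)"
    and "\<forall>\<^sub>F n in sequentially. (1 - e) * W (real n / \<mu>) \<le> tail_A n"
proof -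
  obtain \<kappa> \<eta> K where LD: "\<kappa> > 0" "\<eta> > 0" "K > 0"
    "\<And>m. m \<ge> 1 \<Longrightarrow> deviation_prob m (\<kappa> * real m powr (1 - \<theta>))
       \<le> K * real m * exp (- \<eta> * real m powr \<theta>)"
    by (rule large_deviation) blast
  have \<theta>1: "0 < \<theta>" "\<theta> \<le> 1" "\<theta> < 1" using \<theta> by auto
  have "filterlim (\<lambda>n::nat. real n / u) at_top sequentially" if "u > 0" for u :: real
    using that by real_asymp
  from this[OF \<mu>] have z_top: "filterlim (\<lambda>n::nat. real n / \<mu>) at_top sequentially" .
  have "filterlim (\<lambda>z::real. z powr \<theta>) at_top at_top" using \<theta>1 by real_asymp
  from filterlim_compose[OF this z_top]
  have t_top: "filterlim (\<lambda>n::nat. (real n / \<mu>) powr \<theta>) at_top sequentially" .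

  \<comment> \<open>\<open>\<kappa> / \<mu>\<close> offsets the deviation by drift; the added 1
    absorbs the rounding of \<open>m\<close>, because
    \<open>z powr (1 - \<theta>) \<ge> 1\<close>.\<close>
  define k where "k = \<kappa> / \<mu> + 1"
  have k: "k > 0" using LD \<mu> by (simp add: k_def add_pos_pos)
  have "\<forall>\<^sub>F z in at_top. z - k * z powr (1 - \<theta>) \<ge> 1"
    using powr_sublinear[OF k \<theta>1(1)] eventually_ge_at_top[of 2] by eventually_elim linarith
  note ev1 = eventually_compose_filterlim[OF this z_top]
  note ev2 = eventually_compose_filterlim[OF long_tailed_shift(1)[OF G_long_tailed k, of "e/2"] t_top]
  have "K * exp (\<eta> * k) > 0" "e / 2 > 0" using LD e by auto
  note ev3 = eventually_compose_filterlim[OF deviation_negligible[OF LD(2) this] t_top]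
  have ev4: "\<forall>\<^sub>F n in sequentially. real n / \<mu> \<ge> 1" "\<forall>\<^sub>F n in sequentially. (real n / \<mu>) powr \<theta> \<ge> k"
    using z_top t_top by (auto simp: filterlim_at_top)
  show "\<forall>\<^sub>F n in sequentially. tail_A n \<le> (1 + e) * W (real n / \<mu>)"
    using ev1 ev2[OF half_gt_zero[OF e]] ev3 ev4
  proof eventually_elim
    case (elim n)
    define z t where "z = real n / \<mu>" and "t = z powr \<theta>"
    have z: "z \<ge> 1" "real n = \<mu> * z" using elim \<mu> by (auto simp: z_def)
    define m where "m = nat \<lfloor>z - (\<kappa> / \<mu>) * z powr (1 - \<theta>)\<rfloor>"
    have zp: "z powr (1 - \<theta>) \<ge> 1" using z \<theta>1 by (simp add: ge_one_powr_ge_zero)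
    have y: "z - k * z powr (1 - \<theta>) = z - (\<kappa> / \<mu>) * z powr (1 - \<theta>) - z powr (1 - \<theta>)" by (simp add: k_def algebra_simps)
    have m: "real m \<le> z - (\<kappa> / \<mu>) * z powr (1 - \<theta>)" "z - k * z powr (1 - \<theta>) \<le> real m" "m \<ge> 1"
      using elim(1) zp unfolding z_def[symmetric] y m_def by linarith+
    have mz: "real m \<le> z" using m(1) LD \<mu> by (smt (verit) divide_nonneg_nonneg mult_nonneg_nonneg powr_ge_zero)
    have mp: "real m powr (1 - \<theta>) \<le> z powr (1 - \<theta>)"
      using mz \<theta>1 by (intro powr_mono2) linarith+
    have "\<mu> * real m + \<kappa> * real m powr (1 - \<theta>) \<le> \<mu> * (z - (\<kappa> / \<mu>) * z powr (1 - \<theta>)) + \<kappa> * z powr (1 - \<theta>)"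
      by (intro add_mono mult_left_mono m(1) mp less_imp_le[OF \<mu>] less_imp_le[OF LD(1)])
    also have "\<dots> = real n" unfolding z(2) using \<mu> by (simp add: right_diff_distrib)
    finally have up: "tail_A n \<le> W (real m) + deviation_prob m (\<kappa> * real m powr (1 - \<theta>))"
      by (rule prob_A_upper)
    have tm: "t - k \<le> real m powr \<theta>"
    proof -
      have "t - k \<le> (z - k * z powr (1 - \<theta>)) powr \<theta>"
        unfolding t_def
        by (rule powr_shift_bounds(2)[OF z(1) \<theta>1(1,2) less_imp_le[OF k]]) (use elim(5) in \<open>simp add: z_def\<close>)
      also have "\<dots> \<le> real m powr \<theta>"
        by (rule powr_mono2[OF less_imp_le[OF \<theta>1(1)] _ m(2)]) (use elim(1) in \<open>simp add: z_def\<close>)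
      finally show ?thesis .
    qed
    have "W (real m) \<le> G (t - k)" unfolding W_eq_G[OF of_nat_0_le_iff] by (rule G_antimono[OF tm])
    also have "G (t - k) \<le> (1 + e / 2) * G t" using elim by (simp add: t_def z_def)
    finally have W1: "W (real m) \<le> (1 + e / 2) * G t" .
    have "K * real m * exp (- \<eta> * real m powr \<theta>) \<le> K * z * exp (\<eta> * k + - \<eta> * t)"
    proof (intro mult_mono)
      have "\<eta> * (t - k) \<le> \<eta> * (real m powr \<theta>)" using tm LD by simp
      then show "exp (- \<eta> * real m powr \<theta>) \<le> exp (\<eta> * k + - \<eta> * t)" by (simp add: algebra_simps)
    qed (use LD(3) mz in auto)
    also have "\<dots> = K * exp (\<eta> * k) * z * exp (- \<eta> * t)" by (simp only: exp_add mult_ac)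
    also have "z = t powr (1 / \<theta>)" using z \<theta>1 by (simp add: t_def powr_powr)
    also have "K * exp (\<eta> * k) * t powr (1 / \<theta>) * exp (- \<eta> * t) \<le> e / 2 * G t" using elim by (simp add: t_def z_def)
    finally have dev: "K * real m * exp (- \<eta> * real m powr \<theta>) \<le> e / 2 * G t" .
    have Gz: "W (real n / \<mu>) = G t" unfolding t_def z_def[symmetric] by (rule W_eq_G) (use z in simp)
    have "tail_A n \<le> (1 + e / 2) * G t + e / 2 * G t"
      by (rule order_trans[OF up add_mono[OF W1 order_trans[OF LD(4)[OF m(3)] dev]]])
    also have "\<dots> = (1 + e) * G t" by (simp add: algebra_simps)
    finally show ?case unfolding Gz .
  qed

  \<comment> \<open>Here \<open>m\<close> exceeds \<open>z\<close>; as \<open>m \<le> 2 * z\<close>,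
    the deviation is at most \<open>2 * \<kappa> * z powr (1 - \<theta>)\<close>. The inner 1 gives
    the strict inequality that the lower estimate requires, the outer one absorbs rounding
    up.\<close>
  define k' where "k' = (2 * \<kappa> + 1) / \<mu> + 1"
  have k': "k' > 0" using LD \<mu> by (simp add: k'_def add_pos_pos)
  have "\<forall>\<^sub>F z in at_top. z + k' * z powr (1 - \<theta>) \<le> 2 * z"
    using powr_sublinear[OF k' \<theta>1(1)] eventually_ge_at_top[of 2] by eventually_elim linarith
  note ev1' = eventually_compose_filterlim[OF this z_top]
  note ev2' = eventually_compose_filterlim[OF long_tailed_shift(2)[OF G_long_tailed k', of "e/2"] t_top]
  have "K * 2 > 0" "e / 2 > 0" using LD e by auto
  note ev3' = eventually_compose_filterlim[OF deviation_negligible[OF LD(2) this] t_top]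
  show "\<forall>\<^sub>F n in sequentially. (1 - e) * W (real n / \<mu>) \<le> tail_A n"
    using ev1' ev2'[OF half_gt_zero[OF e]] ev3' ev4
  proof eventually_elim
    case (elim n)
    define z t where "z = real n / \<mu>" and "t = z powr \<theta>"
    have z: "z \<ge> 1" "real n = \<mu> * z" using elim \<mu> by (auto simp: z_def)
    define y where "y = z + ((2 * \<kappa> + 1) / \<mu>) * z powr (1 - \<theta>)"
    define m where "m = nat \<lceil>y\<rceil>"
    have zp: "z powr (1 - \<theta>) \<ge> 1" using z \<theta>1 by (simp add: ge_one_powr_ge_zero)
    have y: "z + k' * z powr (1 - \<theta>) = y + z powr (1 - \<theta>)" by (simp add: y_def k'_def algebra_simps)
    have yz: "z \<le> y" unfolding y_def using LD \<mu> by simp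
    have m: "y \<le> real m" "real m \<le> z + k' * z powr (1 - \<theta>)" "m \<ge> 1"
      unfolding y m_def using zp z yz by linarith+
    have m2z: "real m \<le> 2 * z" using m(2) elim(1) by (simp add: z_def)
    have "real m powr (1 - \<theta>) \<le> (2 * z) powr (1 - \<theta>)" using m2z \<theta>1 by (intro powr_mono2) linarith+
    also have "\<dots> = 2 powr (1 - \<theta>) * z powr (1 - \<theta>)" using z by (simp add: powr_mult)
    also have "\<dots> \<le> 2 powr 1 * z powr (1 - \<theta>)" using \<theta>1 by (intro mult_right_mono powr_mono) auto
    finally have mp: "real m powr (1 - \<theta>) \<le> 2 * z powr (1 - \<theta>)" by simp
    have "real n < \<mu> * y - \<kappa> * (2 * z powr (1 - \<theta>))"
    proof -
      have "\<mu> * y = \<mu> * z + (2 * \<kappa> + 1) * z powr (1 - \<theta>)"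
        unfolding y_def using \<mu> by (simp add: distrib_left)
      moreover have "\<kappa> * (2 * z powr (1 - \<theta>)) < (2 * \<kappa> + 1) * z powr (1 - \<theta>)"
        using zp z(1) by (simp add: algebra_simps)
      ultimately show ?thesis unfolding z(2) by linarith
    qed
    also have "\<dots> \<le> \<mu> * real m - \<kappa> * real m powr (1 - \<theta>)"
      by (intro diff_mono mult_left_mono m(1) mp less_imp_le[OF \<mu>] less_imp_le[OF LD(1)])
    finally have low: "W (real m) \<le> tail_A n + deviation_prob m (\<kappa> * real m powr (1 - \<theta>))"
      by (rule prob_A_lower)
    have "real m powr \<theta> \<le> (z + k' * z powr (1 - \<theta>)) powr \<theta>"
      by (rule powr_mono2[OF less_imp_le[OF \<theta>1(1)] of_nat_0_le_iff m(2)])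
    also have "\<dots> \<le> t + k'"
      unfolding t_def by (rule powr_shift_bounds(1)[OF z(1) \<theta>1(1,2) less_imp_le[OF k']])
    finally have "G (t + k') \<le> W (real m)" unfolding W_eq_G[OF of_nat_0_le_iff] by (rule G_antimono)
    moreover have "(1 - e / 2) * G t \<le> G (t + k')" using elim by (simp add: t_def z_def)
    moreover have "K * real m * exp (- \<eta> * real m powr \<theta>) \<le> e / 2 * G t"
    proof -
      have "K * real m * exp (- \<eta> * real m powr \<theta>) \<le> K * (2 * z) * exp (- \<eta> * t)"
      proof (intro mult_mono)
        have "t \<le> real m powr \<theta>" unfolding t_def using yz m(1) z(1) \<theta>1 by (intro powr_mono2) linarith+
        then show "exp (- \<eta> * real m powr \<theta>) \<le> exp (- \<eta> * t)" using LD by simp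
      qed (use LD(3) m2z in auto)
      also have "\<dots> = K * 2 * z * exp (- \<eta> * t)" by simp
      also have "z = t powr (1 / \<theta>)" using z \<theta>1 by (simp add: t_def powr_powr)
      also have "K * 2 * t powr (1 / \<theta>) * exp (- \<eta> * t) \<le> e / 2 * G t" using elim by (simp add: t_def z_def)
      finally show ?thesis .
    qed
    moreover have Gz: "W (real n / \<mu>) = G t" unfolding t_def z_def[symmetric] by (rule W_eq_G) (use z in simp)
    moreover have "(1 + e / 2) * G t + e / 2 * G t = (1 + e) * G t" "(1 - e / 2) * G t - e / 2 * G t = (1 - e) * G t"
      by (simp_all add: algebra_simps)
    ultimately show ?case
      using low LD(4)[OF m(3)] unfolding Gz by linarith
  qed
qed

end

section \<open>Explicit constants from the tail hypotheses\<close>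

lemma bigo_nat_bound:
  fixes f g :: "nat \<Rightarrow> real"
  assumes "f \<in> O(g)" "\<And>n. g n > 0"
  obtains c where "c > 0" "\<And>n. \<bar>f n\<bar> \<le> c * g n"
proof -
  obtain b where "\<forall>\<^sub>F n in sequentially. norm (f n) \<le> b * norm (g n)"
    using assms(1) by (elim landau_o.bigE)
  then have "\<forall>\<^sub>F n in sequentially. norm (f n / g n) \<le> b"
    by eventually_elim (use assms(2) in \<open>simp add: field_simps less_imp_le\<close>)
  then have "Bseq (\<lambda>n. f n / g n)" by (rule BfunI)
  then obtain c where c: "c > 0" "\<And>n. norm (f n / g n) \<le> c" by (auto simp: Bseq_def)
  show ?thesis
  proof (rule that[OF c(1)])
    fix n
    have "\<bar>f n\<bar> / g n \<le> c" using c(2)[of n] assms(2)[of n] by simp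
    then show "\<bar>f n\<bar> \<le> c * g n" using assms(2)[of n] by (simp add: pos_divide_le_eq)
  qed
qed

lemma bigo_nat_uniform_bound:
  fixes f :: "'b \<Rightarrow> nat \<Rightarrow> real"
  assumes S: "finite S" and f: "\<And>x. x \<in> S \<Longrightarrow> f x \<in> O(g)" and g: "\<And>n. g n > 0"
  obtains c where "c > 0" "\<And>x n. x \<in> S \<Longrightarrow> f x n \<le> c * g n"
proof -
  have "\<forall>x\<in>S. \<exists>b>0. \<forall>n. \<bar>f x n\<bar> \<le> b * g n" using bigo_nat_bound[OF f g] by blast
  then obtain b where b: "\<And>x. x \<in> S \<Longrightarrow> b x > 0" "\<And>x n. x \<in> S \<Longrightarrow> \<bar>f x n\<bar> \<le> b x * g n"
    by metis
  have pos: "0 \<le> sum b S" using b(1) by (intro sum_nonneg) (simp add: less_imp_le)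
  have le: "f x n \<le> (1 + sum b S) * g n" if "x \<in> S" for x n
  proof -
    have "b x \<le> sum b S" using that b(1) S by (intro member_le_sum) (auto simp: less_imp_le)
    then have "b x * g n \<le> (1 + sum b S) * g n" using g[of n] by (intro mult_right_mono) auto
    then show ?thesis using b(2)[OF that, of n] by linarith
  qed
  show ?thesis by (rule that[of "1 + sum b S"]) (use pos le in auto)
qed

text \<open>As minus the logarithm of a tail, \<open>Q\<close> is nondecreasing, so Markov's
  inequality for \<open>exp (Q Y)\<close> bounds the tail of \<open>Y\<close> by a multiple of
  \<open>exp (- Q x)\<close>. The order hypothesis then replaces \<open>Q x\<close> by a multiple of
  \<open>x powr \<gamma>\<close>.\<close>

lemma stretched_exponential_tail:
  assumes D: "real_distr D" and Q: "SC_hazard Q" "(\<integral>\<^sup>+y. ennreal (exp (Q y)) \<partial>D) < \<infinity>"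
    "(\<lambda>x. x powr \<gamma>) \<in> O(Q)"
  obtains c where "c > 0" "(\<lambda>k::nat. measure D {real k<..}) \<in> O(\<lambda>k. exp (- c * real k powr \<gamma>))"
proof -
  interpret D: prob_space D using D by (simp add: real_distr_def)
  have sD [measurable_cong]: "sets D = sets borel" using D by (simp add: real_distr_def)
  obtain D' where D': "real_distr D'" "\<And>x. measure D' {x<..} > 0" "\<And>x. Q x = - ln (measure D' {x<..})"
    using Q(1) by (auto simp: SC_hazard_def)
  interpret D': prob_space D' using D'(1) by (simp add: real_distr_def)
  have sD': "sets D' = sets borel" using D'(1) by (simp add: real_distr_def)
  have Q_mono: "Q x \<le> Q y" if "x \<le> y" for x y
  proof -
    have "measure D' {y<..} \<le> measure D' {x<..}" using that by (intro D'.finite_measure_mono) (auto simp: sD')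
    then show ?thesis using D'(2)[of x] D'(2)[of y] by (simp add: D'(3))
  qed
  have Q_nonneg: "Q x \<ge> 0" for x using D'(2)[of x] by (simp add: D'(3) ln_le_zero_iff)
  obtain b where b: "b > 0" "\<forall>\<^sub>F x in at_top. norm (x powr \<gamma>) \<le> b * norm (Q x)"
    using Q(3) by (elim landau_o.bigE)
  define r where "r = enn2real (\<integral>\<^sup>+y. ennreal (exp (Q y)) \<partial>D)"
  have r: "(\<integral>\<^sup>+y. ennreal (exp (Q y)) \<partial>D) = ennreal r" "r \<ge> 0"
    using Q(2) by (auto simp: r_def less_top)
  have markov: "measure D {x<..} \<le> r * exp (- Q x)" for x
  proof -
    have "ennreal (exp (Q x) * measure D {x<..}) = (\<integral>\<^sup>+y. ennreal (exp (Q x)) * indicator {x<..} y \<partial>D)"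
      by (subst nn_integral_cmult_indicator) (auto simp: sD D.emeasure_eq_measure ennreal_mult)
    also have "\<dots> \<le> (\<integral>\<^sup>+y. ennreal (exp (Q y)) \<partial>D)"
      by (intro nn_integral_mono) (auto simp: indicator_def intro!: ennreal_leI Q_mono)
    finally have "exp (Q x) * measure D {x<..} \<le> r" by (simp add: r)
    then show ?thesis by (simp add: exp_minus field_simps)
  qed
  have "\<forall>\<^sub>F x in at_top. measure D {x<..} \<le> r * exp (- (1 / b) * x powr \<gamma>)"
    using b(2)
  proof eventually_elim
    case (elim x)
    have "(1 / b) * x powr \<gamma> \<le> Q x" using elim b(1) Q_nonneg[of x] by (simp add: field_simps)
    then have "r * exp (- Q x) \<le> r * exp (- (1 / b) * x powr \<gamma>)" using r by (intro mult_left_mono) auto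
    with markov[of x] show ?case by linarith
  qed
  then have "\<forall>\<^sub>F k in sequentially. measure D {real k<..} \<le> r * exp (- (1 / b) * real k powr \<gamma>)"
    by (rule eventually_compose_filterlim) (rule filterlim_real_sequentially)
  then have "(\<lambda>k::nat. measure D {real k<..}) \<in> O(\<lambda>k. exp (- (1 / b) * real k powr \<gamma>))"
    by (intro landau_o.bigI[of "r"] bigoI[of _ r]) (auto elim!: eventually_mono)
  with b(1) show ?thesis by (intro that[of "1 / b"]) auto
qed

section \<open>Integrated tail and mean of the on-period input\<close>

context onoff
begin

definition EI :: real where "EI = (\<integral>\<omega>. real (Ion \<omega>) \<partial>M)"
definition DI :: "real measure" where "DI = distr M borel (\<lambda>\<omega>. real (Ion \<omega>))"

lemma Ion_real_meas [measurable]: "(\<lambda>\<omega>. real (Ion \<omega>)) \<in> borel_measurable M"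
  by (rule measurable_compose[OF Ion_meas]) simp

lemma measure_DI: "measure DI {z<..} = W z"
  unfolding DI_def W_def by (subst measure_distr) (auto intro!: arg_cong[where f = prob])

lemma expectation_DI: "(\<integral>x. x \<partial>DI) = EI"
  unfolding DI_def EI_def by (subst integral_distr) auto

lemma EI_pos:
  assumes "integrable M (\<lambda>\<omega>. real (Ion \<omega>))"
  shows "EI \<ge> 1"
proof -
  have "(\<integral>\<omega>. 1 \<partial>M) \<le> EI"
    unfolding EI_def using assms Ion_pos by (intro integral_mono) auto
  then show ?thesis by (simp add: prob_space)
qed

text \<open>The decrements of the integrated tail are \<open>P(A > n)\<close>, asymptotically the
  tail of \<open>Ion\<close> at \<open>n / \<mu>\<close>. Up to the factor \<open>\<mu> * EI\<close>
  this is sandwiched by neighbouring decrements of the equilibrium tail, and both sequences tend to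
  0.\<close>

lemma excess_asymp:
  assumes int_A: "integrable M (\<lambda>\<omega>. real (A \<omega>))" and int_I: "integrable M (\<lambda>\<omega>. real (Ion \<omega>))"
    and S: "subexponential (equilibrium DI)"
  defines "U \<equiv> \<lambda>n. measure (equilibrium DI) {real n / \<mu><..}"
  shows "subexp_seq U" "(\<lambda>n. \<integral>\<omega>. real (A \<omega> - n) \<partial>M) \<sim>[sequentially] (\<lambda>n. (\<mu> * EI) * U n)"
proof -
  have EI: "EI > 0" using EI_pos[OF int_I] by simp
  interpret DI: prob_space DI unfolding DI_def by (rule prob_space_distr) simp
  have sDI: "sets DI = sets borel" by (simp add: DI_def)
  note [measurable] = tail_measurable[OF DI.prob_space_axioms sDI]
  have "emeasure (equilibrium DI) {..<0}
      = (\<integral>\<^sup>+y. ennreal (indicator {0..} y * measure DI {y<..} / (\<integral>x. x \<partial>DI)) * indicator {..<0} y \<partial>lborel)"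
    unfolding equilibrium_def by (subst emeasure_density) auto
  also have "\<dots> = (\<integral>\<^sup>+y. 0 \<partial>(lborel :: real measure))"
    by (intro nn_integral_cong) (simp add: indicator_def)
  finally have "emeasure (equilibrium DI) {..<0} = 0" by simp
  then have neg: "measure (equilibrium DI) {..<0} = 0" by (simp add: measure_def)
  interpret E: subexp_nonneg "equilibrium DI" "\<lambda>y. measure (equilibrium DI) {y<..}"
    by unfold_locales (use S neg in auto)
  show U: "subexp_seq U" unfolding U_def by (rule E.subexp_seq_scaled[OF \<mu>])
  interpret U: subexp_seq U by fact
  interpret IC: integrable_count M A by unfold_locales (use int_A in auto)
  define b where "b = \<mu> * EI"
  have b: "b > 0" using \<mu> EI by (simp add: b_def)
  \<comment> \<open>One step of \<open>n\<close> is an interval of length \<open>1 / \<mu>\<close>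
    for a law with density \<open>W / EI\<close>; this is the origin of
    \<open>b = \<mu> * EI\<close>.\<close>
  have step: "W (real (Suc n) / \<mu>) \<le> b * (U n - U (Suc n))" "b * (U n - U (Suc n)) \<le> W (real n / \<mu>)" for n
  proof -
    let ?a = "real n / \<mu>" and ?b = "real (Suc n) / \<mu>"
    have ab: "0 \<le> ?a" "?a \<le> ?b" "?b - ?a = 1 / \<mu>" using \<mu> by (auto simp: divide_right_mono diff_divide_distrib[symmetric])
    have eq: "measure (equilibrium DI) {?a<..?b} = U n - U (Suc n)"
      unfolding U_def by (rule E.measure_Ioc[OF ab(2)])
    have "(\<integral>x. x \<partial>DI) > 0" using EI by (simp only: expectation_DI)
    from equilibrium_interval[OF DI.prob_space_axioms sDI E.prob_D this ab(1,2), unfolded expectation_DI measure_DI ab(3) eq]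
    have "W ?b * (1 / \<mu>) / EI \<le> U n - U (Suc n)" "U n - U (Suc n) \<le> W ?a * (1 / \<mu>) / EI" .
    then show "W (real (Suc n) / \<mu>) \<le> b * (U n - U (Suc n))" "b * (U n - U (Suc n)) \<le> W (real n / \<mu>)"
      using \<mu> EI by (simp_all add: b_def field_simps)
  qed
  have U_lim: "(\<lambda>n. U (n - 1)) \<longlonglongrightarrow> 0"
    by (rule filterlim_compose[OF U.U_tendsto_0]) (simp add: filterlim_minus_const_nat_at_top)
  have T: "IC.H n - IC.H (Suc n) = tail_A n" for n
    by (simp add: IC.H_diff_Suc IC.T_def)
  have "IC.H \<sim>[sequentially] (\<lambda>n. b * U n)"
  proof (rule asymp_equiv_sandwich)
    fix e :: real assume e: "e > 0"
    obtain e' where e': "e' > 0" and e2: "(1 + e') * (1 + e') \<le> 1 + e"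
      by (rule square_one_plus_le[OF e]) blast
    have "\<forall>\<^sub>F n in sequentially. tail_A n \<le> (1 + e') * W (real n / \<mu>) \<and> n \<ge> 1"
      using tail_A_bounds(1)[OF e'] eventually_ge_at_top[of 1] by eventually_elim simp
    then obtain n0 where n0: "\<And>n. n \<ge> n0 \<Longrightarrow> tail_A n \<le> (1 + e') * W (real n / \<mu>) \<and> n \<ge> 1"
      by (auto simp: eventually_sequentially)
    \<comment> \<open>The upper comparison needs the equilibrium mass of the preceding cell, hence
      \<open>U (n - 1)\<close>; \<open>n0 \<ge> 1\<close> keeps that index honest, and
      long-tailedness of \<open>U\<close> removes the shift afterwards.\<close>
    have bound: "IC.H n \<le> (1 + e') * b * U (n - 1)" if "n \<ge> n0" for n
    proof (rule telescoping_compare[OF IC.H_tendsto_0 _ _ that])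
      show "(\<lambda>n. (1 + e') * b * U (n - 1)) \<longlonglongrightarrow> 0"
        using tendsto_mult_right_zero[OF U_lim] by simp
      fix n assume n: "n \<ge> n0"
      have "IC.H n - IC.H (Suc n) \<le> (1 + e') * W (real n / \<mu>)" unfolding T using n0[OF n] by simp
      also have "\<dots> \<le> (1 + e') * (b * (U (n - 1) - U n))"
        using step(1)[of "n - 1"] n0[OF n] e' by (intro mult_left_mono) auto
      finally show "IC.H n - IC.H (Suc n) \<le> (1 + e') * b * U (n - 1) - (1 + e') * b * U (Suc n - 1)"
        by (simp add: algebra_simps)
    qed
    show "\<forall>\<^sub>F n in sequentially. IC.H n \<le> (1 + e) * (b * U n)"
      using U.U_diff[OF e', of 1] eventually_ge_at_top[of n0]
    proof eventually_elim
      case (elim n)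
      have "IC.H n \<le> (1 + e') * b * U (n - 1)" using elim by (intro bound)
      also have "\<dots> \<le> (1 + e') * b * ((1 + e') * U n)" using elim e' b by (intro mult_left_mono) auto
      also have "\<dots> = ((1 + e') * (1 + e')) * (b * U n)" by simp
      also have "\<dots> \<le> (1 + e) * (b * U n)" using e2 b U.U_pos[of n] by (intro mult_right_mono) auto
      finally show ?case .
    qed
    have "\<forall>\<^sub>F n in sequentially. (1 - e) * W (real n / \<mu>) \<le> tail_A n"
      by (rule tail_A_bounds(2)[OF e])
    then obtain n1 where n1: "\<And>n. n \<ge> n1 \<Longrightarrow> (1 - e) * W (real n / \<mu>) \<le> tail_A n"
      by (auto simp: eventually_sequentially)
    show "\<forall>\<^sub>F n in sequentially. (1 - e) * (b * U n) \<le> IC.H n"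
    proof (cases "e \<le> 1")
      case True
      show ?thesis using eventually_ge_at_top[of n1]
      proof eventually_elim
        case (elim n)
        show ?case
        proof (rule telescoping_compare[OF _ IC.H_tendsto_0 _ elim, of "\<lambda>n. (1 - e) * (b * U n)"])
          show "(\<lambda>n. (1 - e) * (b * U n)) \<longlonglongrightarrow> 0"
            by (intro tendsto_mult_right_zero U.U_tendsto_0)
          fix n assume n: "n \<ge> n1"
          have "(1 - e) * (b * U n) - (1 - e) * (b * U (Suc n)) = (1 - e) * (b * (U n - U (Suc n)))"
            by (simp add: algebra_simps)
          also have "\<dots> \<le> (1 - e) * W (real n / \<mu>)" using step(2)[of n] True by (intro mult_left_mono) auto
          also have "\<dots> \<le> IC.H n - IC.H (Suc n)" unfolding T by (rule n1[OF n])
          finally show "(1 - e) * (b * U n) - (1 - e) * (b * U (Suc n)) \<le> IC.H n - IC.H (Suc n)" .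
        qed
      qed
    next
      \<comment> \<open>For \<open>e > 1\<close> the left side is not positive, whereas comparing
        decrements requires \<open>1 - e \<ge> 0\<close>.\<close>
      case False
      show ?thesis
      proof (intro always_eventually allI)
        fix n
        have "(1 - e) * (b * U n) \<le> 0" using False b U.U_pos[of n] by (intro mult_nonpos_nonneg) auto
        then show "(1 - e) * (b * U n) \<le> IC.H n" using IC.H_nonneg[of n] by linarith
      qed
    qed
  qed (use b U.U_pos in auto)
  then show "(\<lambda>n. \<integral>\<omega>. real (A \<omega> - n) \<partial>M) \<sim>[sequentially] (\<lambda>n. (\<mu> * EI) * U n)"
    by (simp add: IC.H_def[abs_def] b_def)
qed

text \<open>With initial vector \<phi>\<Lambda>(k) the first state has law \<phi>P = \<phi>, and
  every further step preserves it. Stated with test functions, since this is the form in which the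
  kernel propagates it.\<close>

lemma stationary_state_law:
  assumes v: "\<And>k j. \<alpha> k j = (\<Sum>i<d. \<phi> i * \<Lambda> k i j)" and f: "\<And>j. f j \<ge> 0"
  shows "(\<integral>\<^sup>+\<omega>. ennreal (f (J n \<omega>)) \<partial>M) = ennreal (\<Sum>j<d. \<phi> j * f j)"
  using f
proof (induction n arbitrary: f)
  case 0
  have "(\<integral>\<^sup>+\<omega>. ennreal (f (J 0 \<omega>)) \<partial>M) = ennreal (\<Sum>j<d. \<Sum>k. \<alpha> k j * f j)"
    using initial_nn_integral[of "\<lambda>k j. f j"] 0 \<alpha>_summable by (simp add: summable_mult2)
  also have "(\<Sum>j<d. \<Sum>k. \<alpha> k j * f j) = (\<Sum>j<d. \<phi> j * f j)"
  proof (intro sum.cong refl)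
    fix j assume j: "j \<in> {..<d}"
    have "(\<Sum>k. \<alpha> k j * f j) = (\<Sum>k. \<alpha> k j) * f j" using \<alpha>_summable by (rule suminf_mult2[symmetric])
    also have "(\<Sum>k. \<alpha> k j) = (\<Sum>i<d. \<phi> i * P i j)"
      unfolding v by (subst suminf_sum) (auto simp: suminf_mult \<Lambda>_summable summable_mult)
    also have "\<dots> = \<phi> j" using j by (intro \<phi>_stat) auto
    finally show "(\<Sum>k. \<alpha> k j * f j) = \<phi> j * f j" .
  qed
  finally show ?case .
next
  case (Suc n)
  have K: "kernel_nn (\<lambda>k j. ennreal (f j)) i = ennreal (\<Sum>j<d. P i j * f j)" for i
    using kernel_nn_eq[of "\<lambda>k j. f j" i] Suc.prems \<Lambda>_summable by (simp add: summable_mult2 suminf_mult2)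
  have "(\<integral>\<^sup>+\<omega>. ennreal (f (J (Suc n) \<omega>)) \<partial>M)
      = (\<integral>\<^sup>+\<omega>. kernel_nn (\<lambda>k j. ennreal (f j)) (J n \<omega>) \<partial>M)"
      using one_step_marginal[of "\<lambda>i k j. ennreal (f j)" n] by simp
  also have "\<dots> = (\<integral>\<^sup>+\<omega>. ennreal ((\<lambda>i. \<Sum>j<d. P i j * f j) (J n \<omega>)) \<partial>M)"
    by (simp add: K)
  also have "\<dots> = ennreal (\<Sum>i<d. \<phi> i * (\<Sum>j<d. P i j * f j))"
    by (rule Suc.IH) (intro sum_nonneg mult_nonneg_nonneg suminf_nonneg \<Lambda>_summable \<Lambda>_nonneg Suc.prems)
  also have "(\<Sum>i<d. \<phi> i * (\<Sum>j<d. P i j * f j)) = (\<Sum>j<d. (\<Sum>i<d. \<phi> i * P i j) * f j)"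
    by (simp add: sum_distrib_left sum_distrib_right mult.assoc) (rule sum.swap)
  also have "\<dots> = (\<Sum>j<d. \<phi> j * f j)" by (simp add: \<phi>_stat)
  finally show ?case .
qed

lemma stationary_mean:
  assumes v: "\<And>k j. \<alpha> k j = (\<Sum>i<d. \<phi> i * \<Lambda> k i j)"
  shows "(\<integral>\<^sup>+\<omega>. ennreal (real (N n \<omega>)) \<partial>M) = ennreal lam"
proof (cases n)
  case 0
  have "(\<integral>\<^sup>+\<omega>. ennreal (real (N 0 \<omega>)) \<partial>M) = ennreal (\<Sum>j<d. \<Sum>k. \<alpha> k j * real k)"
    using initial_nn_integral[of "\<lambda>k j. real k"] summable_mean[OF \<alpha>_nonneg \<alpha>_bound] by (simp add: mult.commute)
  also have "(\<Sum>j<d. \<Sum>k. \<alpha> k j * real k) = (\<Sum>j<d. \<Sum>i<d. \<phi> i * (\<Sum>k. real k * \<Lambda> k i j))"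
  proof (intro sum.cong refl)
    fix j
    have "(\<lambda>k. \<alpha> k j * real k) = (\<lambda>k. \<Sum>i<d. \<phi> i * (real k * \<Lambda> k i j))"
      by (simp add: v sum_distrib_left sum_distrib_right mult_ac)
    then show "(\<Sum>k. \<alpha> k j * real k) = (\<Sum>i<d. \<phi> i * (\<Sum>k. real k * \<Lambda> k i j))"
      using summable_mean[OF \<Lambda>_nonneg \<Lambda>_bound] by (simp add: suminf_sum suminf_mult summable_mult)
  qed
  also have "\<dots> = lam" unfolding lam_def sum_distrib_left by (rule sum.swap)
  finally show ?thesis using 0 by simp
next
  case (Suc m)
  have K: "kernel_nn (\<lambda>k j. ennreal (real k)) i = ennreal (mean_batch i)" for i
    using kernel_nn_eq[of "\<lambda>k j. real k" i] summable_mean[OF \<Lambda>_nonneg \<Lambda>_bound] by (simp add: mult.commute)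
  have "(\<integral>\<^sup>+\<omega>. ennreal (real (N n \<omega>)) \<partial>M)
      = (\<integral>\<^sup>+\<omega>. kernel_nn (\<lambda>k j. ennreal (real k)) (J m \<omega>) \<partial>M)"
      using one_step_marginal[of "\<lambda>i k j. ennreal (real k)" m] by (simp add: Suc)
  also have "\<dots> = (\<integral>\<^sup>+\<omega>. ennreal ((\<lambda>i. \<Sum>j<d. \<Sum>k. real k * \<Lambda> k i j) (J m \<omega>)) \<partial>M)"
    by (simp add: K)
  also have "\<dots> = ennreal lam"
    unfolding lam_def
    by (intro stationary_state_law[OF v] sum_nonneg suminf_nonneg summable_mean \<Lambda>_nonneg \<Lambda>_bound) (auto simp: \<Lambda>_nonneg)
  finally show ?thesis .
qed

text \<open>A Wald identity taken slot by slot: \<open>A\<close> is the sum over all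
  \<open>n\<close> of the excess of slot \<open>n\<close> on the event \<open>n < Ion\<close>. For
  each slot it takes only the independence of this event and \<open>N n\<close>, and the stationary
  mean excess \<open>lam - 1\<close>.\<close>

lemma expectation_A:
  assumes v: "\<And>k j. \<alpha> k j = (\<Sum>i<d. \<phi> i * \<Lambda> k i j)"
    and indep: "\<And>n. indep_rv M (count_space UNIV) (\<lambda>\<omega>. n + 1 \<le> Ion \<omega>) (count_space UNIV) (N n)"
    and int_A: "integrable M (\<lambda>\<omega>. real (A \<omega>))" and int_I: "integrable M (\<lambda>\<omega>. real (Ion \<omega>))"
  shows "(\<integral>\<omega>. real (A \<omega>) \<partial>M) = (lam - 1) * EI"
proof -
  have N1: "(\<integral>\<^sup>+\<omega>. ennreal (real (N n \<omega> - 1)) \<partial>M) = ennreal (lam - 1)" for n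
  proof -
    have "ennreal lam = (\<integral>\<^sup>+\<omega>. ennreal (real (N n \<omega> - 1)) + 1 \<partial>M)"
      unfolding stationary_mean[OF v, of n, symmetric]
    proof (rule nn_integral_cong_AE)
      show "AE \<omega> in M. ennreal (real (N n \<omega>)) = ennreal (real (N n \<omega> - 1)) + 1"
        using N_pos
      proof eventually_elim
        case (elim \<omega>)
        then have "real (N n \<omega>) = real (N n \<omega> - 1) + 1" by (simp add: of_nat_diff)
        then show ?case by (simp only: ennreal_plus of_nat_0_le_iff zero_le_one ennreal_1)
      qed
    qed
    also have "\<dots> = (\<integral>\<^sup>+\<omega>. ennreal (real (N n \<omega> - 1)) \<partial>M) + 1"
      by (subst nn_integral_add) (auto simp: emeasure_space_1)
    finally have "(\<integral>\<^sup>+\<omega>. ennreal (real (N n \<omega> - 1)) \<partial>M) + 1 = ennreal (lam - 1) + 1"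
      using lam_gt by (simp add: ennreal_plus[symmetric] flip: ennreal_1)
    then show ?thesis by simp
  qed
  have slot: "(\<integral>\<^sup>+\<omega>. ennreal (real (if n < Ion \<omega> then N n \<omega> - 1 else 0)) \<partial>M)
     = ennreal (lam - 1) * emeasure M {\<omega>\<in>space M. n < Ion \<omega>}" for n
  proof -
    \<comment> \<open>Independence is given for events, so the mean of the product is computed
      through its tail probabilities, each of which factorises.\<close>
    have ev: "emeasure M {\<omega>\<in>space M. t < (if n < Ion \<omega> then N n \<omega> - 1 else 0)}
       = emeasure M {\<omega>\<in>space M. n < Ion \<omega>} * emeasure M {\<omega>\<in>space M. t < N n \<omega> - 1}" for t
    proof -
      have "measure M {\<omega>\<in>space M. (n + 1 \<le> Ion \<omega>) \<in> {True} \<and> N n \<omega> \<in> {t + 1<..}}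
        = measure M {\<omega>\<in>space M. (n + 1 \<le> Ion \<omega>) \<in> {True}} * measure M {\<omega>\<in>space M. N n \<omega> \<in> {t + 1<..}}"
        using indep[of n, unfolded indep_rv_def, rule_format, of "{True}" "{t + 1<..}"] by simp
      moreover have "{\<omega>\<in>space M. (n + 1 \<le> Ion \<omega>) \<in> {True} \<and> N n \<omega> \<in> {t + 1<..}}
          = {\<omega>\<in>space M. t < (if n < Ion \<omega> then N n \<omega> - 1 else 0)}"
        "{\<omega>\<in>space M. (n + 1 \<le> Ion \<omega>) \<in> {True}} = {\<omega>\<in>space M. n < Ion \<omega>}"
        "{\<omega>\<in>space M. N n \<omega> \<in> {t + 1<..}} = {\<omega>\<in>space M. t < N n \<omega> - 1}"
        by auto
      ultimately show ?thesis by (simp add: emeasure_eq_measure ennreal_mult)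
    qed
    have meas: "(\<lambda>\<omega>. if n < Ion \<omega> then N n \<omega> - 1 else 0) \<in> M \<rightarrow>\<^sub>M count_space UNIV"
      by (intro measurable_If measurable_compose[OF N_meas]) auto
    have "(\<integral>\<^sup>+\<omega>. ennreal (real (if n < Ion \<omega> then N n \<omega> - 1 else 0)) \<partial>M)
      = (\<Sum>t. emeasure M {\<omega>\<in>space M. t < (if n < Ion \<omega> then N n \<omega> - 1 else 0)})"
      using nn_integral_nat_function[OF meas] by (simp add: ennreal_of_nat_eq_real_of_nat)
    also have "\<dots> = emeasure M {\<omega>\<in>space M. n < Ion \<omega>} * (\<Sum>t. emeasure M {\<omega>\<in>space M. t < N n \<omega> - 1})"
      unfolding ev by simp
    also have "(\<Sum>t. emeasure M {\<omega>\<in>space M. t < N n \<omega> - 1}) = (\<integral>\<^sup>+\<omega>. ennreal (real (N n \<omega> - 1)) \<partial>M)"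
      using nn_integral_nat_function[of "\<lambda>\<omega>. N n \<omega> - 1" M] measurable_compose[OF N_meas, of "\<lambda>k. k - 1" "count_space UNIV"]
      by (simp add: ennreal_of_nat_eq_real_of_nat)
    finally show ?thesis unfolding N1 by (simp only: mult.commute)
  qed
  have A_sum: "ennreal (real (A \<omega>)) = (\<Sum>n. ennreal (real (if n < Ion \<omega> then N n \<omega> - 1 else 0)))" for \<omega>
  proof -
    have "(\<Sum>n. ennreal (real (if n < Ion \<omega> then N n \<omega> - 1 else 0)))
      = (\<Sum>n<Ion \<omega>. ennreal (real (if n < Ion \<omega> then N n \<omega> - 1 else 0)))"
      by (rule suminf_finite) auto
    also have "\<dots> = ennreal (\<Sum>n<Ion \<omega>. real (N n \<omega> - 1))" by (subst sum_ennreal[symmetric]) auto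
    also have "\<dots> = ennreal (real (A \<omega>))" by (simp add: A_def onA_def)
    finally show ?thesis by simp
  qed
  have meas: "(\<lambda>\<omega>. ennreal (real (if n < Ion \<omega> then N n \<omega> - 1 else 0))) \<in> borel_measurable M" for n
  proof -
    have "(\<lambda>\<omega>. if n < Ion \<omega> then N n \<omega> - 1 else 0) \<in> M \<rightarrow>\<^sub>M count_space UNIV"
      by (intro measurable_If measurable_compose[OF N_meas]) auto
    then show ?thesis by (rule measurable_compose) simp
  qed
  have "(\<integral>\<^sup>+\<omega>. ennreal (real (A \<omega>)) \<partial>M) = (\<Sum>n. \<integral>\<^sup>+\<omega>. ennreal (real (if n < Ion \<omega> then N n \<omega> - 1 else 0)) \<partial>M)"
    unfolding A_sum by (rule nn_integral_suminf[OF meas])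
  also have "\<dots> = ennreal (lam - 1) * (\<Sum>n. emeasure M {\<omega>\<in>space M. n < Ion \<omega>})"
    unfolding slot by simp
  also have "(\<Sum>n. emeasure M {\<omega>\<in>space M. n < Ion \<omega>}) = (\<integral>\<^sup>+\<omega>. ennreal (real (Ion \<omega>)) \<partial>M)"
    using nn_integral_nat_function[OF Ion_meas] by (simp add: ennreal_of_nat_eq_real_of_nat)
  finally have "ennreal (\<integral>\<omega>. real (A \<omega>) \<partial>M) = ennreal (lam - 1) * ennreal EI"
    using int_A int_I by (simp add: nn_integral_eq_integral EI_def)
  also have "\<dots> = ennreal ((lam - 1) * EI)"
    using lam_gt EI_pos[OF int_I] by (simp add: ennreal_mult)
  finally show ?thesis using lam_gt EI_pos[OF int_I] by (simp add: Bochner_Integration.integral_nonneg)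
qed

end

section \<open>Loss probability\<close>

theorem theorem4p1:
  fixes M :: "'a measure"
    and d :: nat
    and \<alpha> :: "nat \<Rightarrow> nat \<Rightarrow> real"            \<comment> \<open>\<alpha> k i = \<alpha>_i(k)\<close>
    and \<Lambda> :: "nat \<Rightarrow> nat \<Rightarrow> nat \<Rightarrow> real"     \<comment> \<open>\<Lambda> k i j = \<Lambda>_{i,j}(k)\<close>
    and \<phi> :: "nat \<Rightarrow> real"
    and N J :: "nat \<Rightarrow> 'a \<Rightarrow> nat"
    and Ion Ioff :: "'a \<Rightarrow> nat"
    and DY :: "real measure"
    and Q :: "real \<Rightarrow> real"
    and \<theta> :: real
    and p :: "nat \<Rightarrow> nat \<Rightarrow> real"          \<comment> \<open>p K = stationary law of L^(K)\<close>
  defines "P \<equiv> (\<lambda>i j. \<Sum>k. \<Lambda> k i j)"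
    and "lam \<equiv> (\<Sum>i<d. \<phi> i * (\<Sum>j<d. \<Sum>k. real k * \<Lambda> k i j))"
    and "A \<equiv> onA N Ion"
    and "DIon \<equiv> distr M borel (\<lambda>\<omega>. real (Ion \<omega>))"
  assumes M: "prob_space M"
    \<comment> \<open>BMAP parameters\<close>
    and \<alpha>_nonneg: "\<forall>k i. 0 \<le> \<alpha> k i"
    and \<alpha>_supp: "\<forall>i. \<alpha> 0 i = 0" "\<forall>k i. d \<le> i \<longrightarrow> \<alpha> k i = 0"
    and \<alpha>_summable: "\<forall>i. summable (\<lambda>k. \<alpha> k i)"
    and \<alpha>_prob: "(\<Sum>i<d. \<Sum>k. \<alpha> k i) = 1"
    and \<Lambda>_nonneg: "\<forall>k i j. 0 \<le> \<Lambda> k i j"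
    and \<Lambda>_supp: "\<forall>i j. \<Lambda> 0 i j = 0" "\<forall>k i j. d \<le> i \<or> d \<le> j \<longrightarrow> \<Lambda> k i j = 0"
    and \<Lambda>_summable: "\<forall>i j. summable (\<lambda>k. \<Lambda> k i j)"
    and P_stoch: "\<forall>i<d. (\<Sum>j<d. P i j) = 1"
    and P_irred: "irreducible_mat d P"
    and \<phi>_stat: "\<forall>i. 0 \<le> \<phi> i" "\<forall>i. d \<le> i \<longrightarrow> \<phi> i = 0" "(\<Sum>i<d. \<phi> i) = 1"
                 "\<forall>j<d. (\<Sum>i<d. \<phi> i * P i j) = \<phi> j"
    \<comment> \<open>the on-period data and the off-period length as random variables\<close>
    and meas: "\<forall>n. N n \<in> M \<rightarrow>\<^sub>M count_space UNIV" "\<forall>n. J n \<in> M \<rightarrow>\<^sub>M count_space UNIV"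
              "Ion \<in> M \<rightarrow>\<^sub>M count_space UNIV" "Ioff \<in> M \<rightarrow>\<^sub>M count_space UNIV"
    and BMAP: "\<forall>n (ks :: nat \<Rightarrow> nat) (js :: nat \<Rightarrow> nat).
                 measure M {\<omega>\<in>space M. \<forall>i\<le>n. N i \<omega> = ks i \<and> J i \<omega> = js i}
                 = \<alpha> (ks 0) (js 0) * (\<Prod>i\<in>{1..n}. \<Lambda> (ks i) (js (i - 1)) (js i))"
    and Ion_pos: "\<forall>\<omega>\<in>space M. 1 \<le> Ion \<omega>"
    and Ioff_indep: "indep_rv M (count_space UNIV) Ioff
          (count_space UNIV \<Otimes>\<^sub>M (\<Pi>\<^sub>M n\<in>UNIV. count_space UNIV))
          (\<lambda>\<omega>. (Ion \<omega>, \<lambda>n. (N n \<omega>, J n \<omega>)))"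
    \<comment> \<open>stationary distributions of L^(K)\<close>
    and p_stat: "\<forall>K. stationary_dist M A Ioff K (p K)"
    \<comment> \<open>main hypotheses\<close>
    and lam_gt: "lam > 1"
    and Y: "real_distr DY" "emeasure DY {..<0} = 0" "subexponential DY"
    and \<alpha>_tail: "\<forall>i<d. (\<lambda>k::nat. \<Sum>l. \<alpha> (k + 1 + l) i) \<in> O(\<lambda>k. measure DY {real k<..})"
    and \<Lambda>_tail: "\<forall>i<d. \<forall>j<d. (\<lambda>k::nat. \<Sum>l. \<Lambda> (k + 1 + l) i j) \<in> O(\<lambda>k. measure DY {real k<..})"
    and EA_lt: "(\<integral>\<^sup>+\<omega>. ennreal (real (A \<omega>)) \<partial>M) < (\<integral>\<^sup>+\<omega>. ennreal (real (Ioff \<omega>)) \<partial>M)"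
    \<comment> \<open>(i)\<close>
    and \<theta>: "0 < \<theta>" "\<theta> \<le> 1 / 3"
    and cond_i: "in_L_pow M (1 / \<theta>) (\<lambda>\<omega>. real (Ion \<omega>))"
    \<comment> \<open>(ii)\<close>
    and cond_ii: "(\<integral>\<^sup>+\<omega>. ennreal (real (Ion \<omega>)) \<partial>M) < \<infinity>" "subexponential (equilibrium DIon)"
    \<comment> \<open>(iii)\<close>
    and cond_iii: "SC_hazard Q" "(\<integral>\<^sup>+y. ennreal (exp (Q y)) \<partial>DY) < \<infinity>"
                  "(\<lambda>x. x powr (3 * \<theta> / 2)) \<in> O(Q)"
  shows "(\<lambda>K. loss_prob M A Ion K (p K)) \<sim>[at_top]
           (\<lambda>K. (lam - 1) * (\<integral>\<omega>. real (Ion \<omega>) \<partial>M)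
                  / ((\<integral>\<omega>. real (A \<omega>) \<partial>M) + (\<integral>\<omega>. real (Ion \<omega>) \<partial>M))
                  * measure (equilibrium DIon) {real K / (lam - 1)<..})
       \<and> ((\<forall>n. indep_rv M (count_space UNIV) (\<lambda>\<omega>. n + 1 \<le> Ion \<omega>)
                                     (count_space UNIV) (N n))
           \<and> (\<forall>k\<ge>1. \<forall>j. \<alpha> k j = (\<Sum>i<d. \<phi> i * \<Lambda> k i j))
          \<longrightarrow> (\<lambda>K. loss_prob M A Ion K (p K)) \<sim>[at_top]
              (\<lambda>K. (lam - 1) / lam * measure (equilibrium DIon) {real K / (lam - 1)<..}))"
proof -
  interpret M: prob_space M by (rule M)
  obtain c where c: "c > 0" and DY_tail: "(\<lambda>k::nat. measure DY {real k<..}) \<in> O(\<lambda>k. exp (- c * real k powr (3 * \<theta> / 2)))"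
    by (rule stretched_exponential_tail[OF Y(1) cond_iii])
  define h where "h k = exp (- c * real k powr (3 * \<theta> / 2))" for k :: nat
  note tail = landau_o.big_trans[OF _ DY_tail[folded h_def]]
  have h: "h k > 0" for k by (simp add: h_def)
  have "(\<lambda>k. \<Sum>l. \<alpha> (k + 1 + l) i) \<in> O(h)" if "i \<in> {..<d}" for i
    using tail \<alpha>_tail that by simp
  then obtain C\<alpha> where C\<alpha>: "C\<alpha> > 0" "\<And>i k. i \<in> {..<d} \<Longrightarrow> (\<Sum>l. \<alpha> (k + 1 + l) i) \<le> C\<alpha> * h k"
    using bigo_nat_uniform_bound[of "{..<d}" "\<lambda>i k. \<Sum>l. \<alpha> (k + 1 + l) i" h, OF finite_lessThan _ h] by blast
  have "(\<lambda>k. \<Sum>l. \<Lambda> (k + 1 + l) (fst x) (snd x)) \<in> O(h)" if "x \<in> {..<d} \<times> {..<d}" for x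
    using tail \<Lambda>_tail that by (auto simp: mem_Times_iff)
  then obtain C\<Lambda> where C\<Lambda>: "C\<Lambda> > 0"
    "\<And>x k. x \<in> {..<d} \<times> {..<d} \<Longrightarrow> (\<Sum>l. \<Lambda> (k + 1 + l) (fst x) (snd x)) \<le> C\<Lambda> * h k"
    using bigo_nat_uniform_bound[of "{..<d} \<times> {..<d}" "\<lambda>x k. \<Sum>l. \<Lambda> (k + 1 + l) (fst x) (snd x)" h,
        OF finite_cartesian_product[OF finite_lessThan finite_lessThan] _ h] by blast
  define C where "C = C\<alpha> + C\<Lambda>"
  have C: "C > 0" using C\<alpha>(1) C\<Lambda>(1) by (simp add: C_def)
  have le: "C\<alpha> * h k \<le> C * h k" "C\<Lambda> * h k \<le> C * h k" for k
    using C\<alpha>(1) C\<Lambda>(1) h[of k] by (auto simp: C_def intro: mult_right_mono)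
  \<comment> \<open>The hypotheses bound only indices below \<open>d\<close>; beyond them the series
    vanish, so one constant serves all indices.\<close>
  have \<alpha>_le: "(\<Sum>l. \<alpha> (k + 1 + l) i) \<le> C * exp (- c * real k powr (3 * \<theta> / 2))" for k i
  proof (cases "i < d")
    case True
    with order_trans[OF C\<alpha>(2)[of i k] le(1)] show ?thesis by (simp add: h_def)
  qed (use \<alpha>_supp(2) C in auto)
  have \<Lambda>_le: "(\<Sum>l. \<Lambda> (k + 1 + l) i j) \<le> C * exp (- c * real k powr (3 * \<theta> / 2))" for k i j
  proof (cases "i < d \<and> j < d")
    case True
    with order_trans[OF C\<Lambda>(2)[of "(i, j)" k] le(2)] show ?thesis by (simp add: h_def)
  next
    case False
    then have "\<Lambda> k i j = 0" for k using \<Lambda>_supp(2) by (meson not_less)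
    then show ?thesis using C by simp
  qed
  interpret L: light_bmap M d \<alpha> \<Lambda> N J \<phi> c C \<theta>
  proof
    show "irreducible_mat d (\<lambda>i j. \<Sum>k. \<Lambda> k i j)" using P_irred by (simp add: P_def)
    show "(\<Sum>j<d. \<Sum>k. \<Lambda> k i j) = 1" if "i < d" for i using P_stoch that by (simp add: P_def)
    show "(\<Sum>i<d. \<phi> i * (\<Sum>k. \<Lambda> k i j)) = \<phi> j" if "j < d" for j using \<phi>_stat(4) that by (simp add: P_def)
    show "N n \<in> M \<rightarrow>\<^sub>M count_space UNIV" "J n \<in> M \<rightarrow>\<^sub>M count_space UNIV" for n using meas by auto
    show "measure M {\<omega>\<in>space M. \<forall>i\<le>n. N i \<omega> = ks i \<and> J i \<omega> = js i}
        = \<alpha> (ks 0) (js 0) * (\<Prod>i\<in>{1..n}. \<Lambda> (ks i) (js (i - 1)) (js i))" for n ks js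
      using BMAP by blast
    show "(\<Sum>l. \<Lambda> (k + 1 + l) i j) \<le> C * exp (- c * real k powr (3 * \<theta> / 2))" for k i j by (rule \<Lambda>_le)
    show "(\<Sum>l. \<alpha> (k + 1 + l) i) \<le> C * exp (- c * real k powr (3 * \<theta> / 2))" for k i by (rule \<alpha>_le)
  qed (use \<alpha>_nonneg \<alpha>_supp \<alpha>_summable \<alpha>_prob \<Lambda>_nonneg \<Lambda>_supp \<Lambda>_summable \<phi>_stat(1,3) c C \<theta> in auto)
  have "L.lam = lam" by (simp add: L.lam_def lam_def)
  then interpret O: onoff M d \<alpha> \<Lambda> N J \<phi> c C \<theta> Ion
    by unfold_locales (use meas(3) Ion_pos cond_i lam_gt in auto)
  have eqs: "O.A = A" "L.lam = lam" "O.DI = DIon" "O.EI = (\<integral>\<omega>. real (Ion \<omega>) \<partial>M)" "O.\<mu> = lam - 1"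
    by (simp_all add: O.A_def A_def L.lam_def lam_def O.DI_def DIon_def O.EI_def O.\<mu>_def)
  have int_A: "integrable M (\<lambda>\<omega>. real (A \<omega>))"
  proof (rule integrableI_nonneg)
    show "(\<lambda>\<omega>. real (A \<omega>)) \<in> borel_measurable M"
      using O.A_meas unfolding eqs by (rule measurable_compose) simp
    show "(\<integral>\<^sup>+\<omega>. ennreal (real (A \<omega>)) \<partial>M) < \<infinity>"
      using EA_lt by (rule less_le_trans) simp
  qed simp
  have int_I: "integrable M (\<lambda>\<omega>. real (Ion \<omega>))"
    by (rule integrableI_nonneg) (use cond_ii(1) in auto)
  define U where "U n = measure (equilibrium DIon) {real n / (lam - 1)<..}" for n :: nat
  define EA EI where "EA = (\<integral>\<omega>. real (A \<omega>) \<partial>M)" and "EI = (\<integral>\<omega>. real (Ion \<omega>) \<partial>M)"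
  have EI: "EI \<ge> 1" using O.EI_pos[OF int_I] by (simp add: eqs EI_def)
  have U: "subexp_seq U" and H: "(\<lambda>n. \<integral>\<omega>. real (A \<omega> - n) \<partial>M) \<sim>[sequentially] (\<lambda>n. ((lam - 1) * EI) * U n)"
    using O.excess_asymp[unfolded eqs, OF int_A int_I cond_ii(2)] by (simp_all add: U_def[abs_def] EI_def)
  interpret Q: buffer_queues M U A Ioff p "(lam - 1) * EI"
  proof -
    interpret U: subexp_seq U by (rule U)
    show "buffer_queues M U A Ioff p ((lam - 1) * EI)"
      by unfold_locales (use O.A_meas meas(4) int_A p_stat EA_lt lam_gt EI H in \<open>auto simp: eqs\<close>)
  qed
  have loss: "loss_prob M A Ion K (p K) = (\<Sum>l\<le>K. p K l * Q.H (K - l)) / (EA + EI)" for K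
  proof -
    have "(\<integral>\<omega>. real ((l + A \<omega>) - K) \<partial>M) = Q.H (K - l)" if "l \<le> K" for l
    proof -
      \<comment> \<open>Correct for truncated subtraction because \<open>l \<le> K\<close>: the loss
        is the overflow into \<open>K - l\<close> free places.\<close>
      have "(l + A \<omega>) - K = A \<omega> - (K - l)" for \<omega> using that by simp
      then show ?thesis unfolding Q.Q.H_def by simp
    qed
    then show ?thesis unfolding loss_prob_def EA_def EI_def using int_A int_I by simp
  qed
  have "(\<lambda>K. (\<Sum>l\<le>K. p K l * Q.H (K - l)) / (EA + EI)) \<sim>[sequentially] (\<lambda>K. ((lam - 1) * EI) * U K / (EA + EI))"
    by (intro asymp_equiv_intros asymp_equiv_trans[OF Q.loss_asymp Q.H_asymp'])
  then have main: "(\<lambda>K. loss_prob M A Ion K (p K)) \<sim>[at_top] (\<lambda>K. (lam - 1) * EI / (EA + EI) * U K)"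
    by (simp add: loss)
  show ?thesis
  proof (intro conjI impI)
    show "(\<lambda>K. loss_prob M A Ion K (p K)) \<sim>[at_top]
           (\<lambda>K. (lam - 1) * (\<integral>\<omega>. real (Ion \<omega>) \<partial>M)
                  / ((\<integral>\<omega>. real (A \<omega>) \<partial>M) + (\<integral>\<omega>. real (Ion \<omega>) \<partial>M))
                  * measure (equilibrium DIon) {real K / (lam - 1)<..})"
      using main by (simp only: EA_def EI_def U_def)
    assume iv_v: "(\<forall>n. indep_rv M (count_space UNIV) (\<lambda>\<omega>. n + 1 \<le> Ion \<omega>) (count_space UNIV) (N n))
           \<and> (\<forall>k\<ge>1. \<forall>j. \<alpha> k j = (\<Sum>i<d. \<phi> i * \<Lambda> k i j))"
    \<comment> \<open>Condition (v) speaks of \<open>k \<ge> 1\<close>; at \<open>k = 0\<close> both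
      sides vanish, as batches of size 0 carry no mass.\<close>
    have "\<alpha> k j = (\<Sum>i<d. \<phi> i * \<Lambda> k i j)" for k j
      using iv_v \<alpha>_supp(1) \<Lambda>_supp(1) by (cases "k = 0") auto
    from O.expectation_A[OF this _ int_A[folded eqs(1)] int_I] iv_v
    have "EA = (lam - 1) * EI" by (simp add: eqs EA_def EI_def)
    then have "EA + EI = lam * EI" by (simp add: algebra_simps)
    then have "(lam - 1) * EI / (EA + EI) = (lam - 1) / lam" using EI by simp
    with main show "(\<lambda>K. loss_prob M A Ion K (p K)) \<sim>[at_top]
              (\<lambda>K. (lam - 1) / lam * measure (equilibrium DIon) {real K / (lam - 1)<..})"
      by (simp only: U_def)
  qed
qed

end
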